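(* Let $B=\prod_{i=1}^d I_i$ be a box in ${}^\bullet\mathbb{R}^d$ (each $I_i\in\mathscr{I}$), let $U\subseteq{}^\bullet\mathbb{R}^d$ be a Fermat open set with $B\subseteq U$, and let $f:U\to{}^\bullet\mathbb{R}$ be a smooth function. Let $(\sigma_1,\dots,\sigma_d)$ be a permutation of $\{1,\dots,d\}$. Then $$\int_{I_1}\cdots\left(\int_{I_d}f(x_1,\dots,x_d)\,\mathrm{d}x_d\right)\cdots\mathrm{d}x_1=\int_{I_{\sigma_1}}\cdots\left(\int_{I_{\sigma_d}}f(x_1,\dots,x_d)\,\mathrm{d}x_{\sigma_d}\right)\cdots\mathrm{d}x_{\sigma_1}.$$ (This common value is denoted $\int_B f$.)
   Context: Fermat reals: let $\mathbb{R}_o[t]$ be the set of maps $x:\mathbb{R}_{\ge0}\to\mathbb{R}$, $t\mapsto x_t$, of the form $x_t=r+\sum_{i=1}^k\alpha_i t^{a_i}+o(t)$ as $t\to0^+$, with $k\in\mathbb{N}$, $r,\alpha_i\in\mathbb{R}$, $a_i\in\mathbb{R}_{\ge0}$. Write $x\sim y$ iff $x_t=y_t+o(t)$ as $t\to0^+$. The ring of Fermat reals is ${}^\bullet\mathbb{R}:=\mathbb{R}_o[t]/\sim$ with pointwise operations; $\mathbb{R}\subseteq{}^\bullet\mathbb{R}$ via constants. The standard part of $x=[x_t]$ is ${}^\circ x:=x_0$ (componentwise on ${}^\bullet\mathbb{R}^d$). ${}^\bullet\mathbb{R}$ is totally ordered by: $x\le y$ iff for representatives there is $z\in\mathbb{R}_o[t]$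 with $z\sim0$ and $x_t\le y_t+z_t$ for all small $t\ge0$. $\overline{{}^\bullet\mathbb{R}}:={}^\bullet\mathbb{R}\cup\{\pm\infty\}$, ${}^\circ(\pm\infty):=\pm\infty$. An interval is a set $[a,b],(a,b),[a,b),(a,b]$ of points of ${}^\bullet\mathbb{R}$ with $a\le b$ in $\overline{{}^\bullet\mathbb{R}}$ (it determines $a=\inf$, $b=\sup$); non-infinitesimal if ${}^\circ a<{}^\circ b$; $\mathscr{I}$ is the set of all intervals; a box is a product of $d$ intervals. The Fermat topology on ${}^\bullet\mathbb{R}^n$ has open sets ${}^\bullet V:=\{x:{}^\circ x\in V\}$, $V\subseteq\mathbb{R}^n$ open (Fermat open sets). For $\alpha\in C^\infty(W,\mathbb{R}^m)$, $W\subseteq\mathbb{R}^k$ open, ${}^\bullet\alpha([x_t]):=[\alpha(x_t)]$. A map $f:S\to{}^\bullet\mathbb{R}^m$, $S\subseteq{}^\bullet\mathbb{R}^n$, is smooth if for every $x\in S$ there exist open $V\subseteq\mathbb{R}^n$ with $x\in{}^\bullet V$, open $P\subseteq\mathbb{R}^{\mathsf p}$, $p\in{}^\bullet P$, $\alpha\in C^\infty(P\times V,\mathbb{R}^m)$ with $f(y)={}^\bullet\alpha(p,y)$ for $y\in{}^\bullet V\cap S$. For $g$ smooth on a non-infinitesimal interval $J$ and $x\in J$, $g'(x):={}^\bullet(\partial_2\alpha)(p,x)$ for any local representation of $g$ around $x$ (independent of it). Integral: for a non-infinitesimal interval $J$, smooth $f:J\to{}^\bullet\mathbb{R}$ and $u\in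 J$, $\int_u^{(-)}f$ is the unique smooth $I:J\to{}^\bullet\mathbb{R}$ with $I(u)=0$ and $I'(x)=f(x)$ for all $x\in J$, and $\int_u^v f:=I(v)$ for $v\in J$. For an interval $I$ and a smooth $g$ defined on a set containing a non-infinitesimal interval $K\supseteq I$, $\int_I g:=\int_{\inf(I)}^{\sup(I)}g|_K$ (independent of $K$); any smooth function on a Fermat open set containing $I$ may be restricted to such a $K$. *)

theory Defs
  imports "HOL-Analysis.Analysis"
begin

text \<open>Only the values of a map on t >= 0 matter; maps are modelled as real => real.
  A map z is o(t) (as t -> 0+) iff z(0) = 0 and z(t)/t -> 0 as t -> 0+.\<close>

definition is_o :: "(real \<Rightarrow> real) \<Rightarrow> bool" where
  "is_o z \<longleftrightarrow> z 0 = 0 \<and> ((\<lambda>t. z t / t) \<longlongrightarrow> 0) (at_right 0)"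

text \<open>t^a for t >= 0, a >= 0, with the convention t^0 = 1 (also at t = 0).\<close>
definition tpow :: "real \<Rightarrow> real \<Rightarrow> real" where
  "tpow t a = (if a = 0 then 1 else t powr a)"

definition Ro :: "(real \<Rightarrow> real) \<Rightarrow> bool" where
  "Ro x \<longleftrightarrow> (\<exists>(r::real) (k::nat) (al::nat \<Rightarrow> real) (a::nat \<Rightarrow> real).
      (\<forall>i<k. 0 \<le> a i) \<and> is_o (\<lambda>t. x t - (r + (\<Sum>i<k. al i * tpow t (a i)))))"

definition fsim :: "(real \<Rightarrow> real) \<Rightarrow> (real \<Rightarrow> real) \<Rightarrow> bool" where
  "fsim x y \<longleftrightarrow> is_o (\<lambda>t. x t - y t)"

lemma Ro_zero: "Ro (\<lambda>t. 0)"
  unfolding Ro_def is_o_def by (rule exI[of _ 0], rule exI[of _ 0]) simp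

typedef fermat = "{S. \<exists>x. Ro x \<and> S = {y. Ro y \<and> fsim x y}}"
  using Ro_zero by blast

definition fclass :: "(real \<Rightarrow> real) \<Rightarrow> fermat" where
  "fclass h = (if Ro h then Abs_fermat {y. Ro y \<and> fsim h y}
               else Abs_fermat {y. Ro y \<and> fsim (\<lambda>t. 0) y})"

definition frep :: "fermat \<Rightarrow> (real \<Rightarrow> real)" where
  "frep X = (SOME x. x \<in> Rep_fermat X)"

definition fzero :: fermat where "fzero = fclass (\<lambda>t. 0)"

definition fst_part :: "fermat \<Rightarrow> real" where "fst_part X = frep X 0"

definition fle :: "fermat \<Rightarrow> fermat \<Rightarrow> bool" where
  "fle X Y \<longleftrightarrow> (\<exists>x\<in>Rep_fermat X. \<exists>y\<in>Rep_fermat Y. \<exists>z. Ro z \<and> fsim z (\<lambda>t. 0) \<and>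
      (\<exists>\<delta>>0. \<forall>t. 0 \<le> t \<and> t < \<delta> \<longrightarrow> x t \<le> y t + z t))"

datatype xfermat = NegInf | Fin fermat | PosInf

fun xle :: "xfermat \<Rightarrow> xfermat \<Rightarrow> bool" where
  "xle NegInf _ = True"
| "xle _ PosInf = True"
| "xle (Fin a) (Fin b) = fle a b"
| "xle _ _ = False"

definition xlt :: "xfermat \<Rightarrow> xfermat \<Rightarrow> bool" where
  "xlt u v \<longleftrightarrow> xle u v \<and> u \<noteq> v"

fun xst :: "xfermat \<Rightarrow> ereal" where
  "xst NegInf = -\<infinity>"
| "xst PosInf = \<infinity>"
| "xst (Fin x) = ereal (fst_part x)"

definition ivl :: "xfermat \<Rightarrow> xfermat \<Rightarrow> bool \<Rightarrow> bool \<Rightarrow> fermat set" where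
  "ivl a b lc rc = {x. (if lc then xle a (Fin x) else xlt a (Fin x)) \<and>
                       (if rc then xle (Fin x) b else xlt (Fin x) b)}"

definition finterval :: "fermat set \<Rightarrow> bool" where
  "finterval I \<longleftrightarrow> (\<exists>a b lc rc. xle a b \<and> I = ivl a b lc rc)"

definition noninf_interval :: "fermat set \<Rightarrow> bool" where
  "noninf_interval I \<longleftrightarrow> (\<exists>a b lc rc. xle a b \<and> I = ivl a b lc rc \<and> xst a < xst b)"

text \<open>R^k is modelled as the maps v :: nat => real with v i = 0 for i >= k.\<close>
definition kvec :: "nat \<Rightarrow> (nat \<Rightarrow> real) \<Rightarrow> bool" where
  "kvec k v \<longleftrightarrow> (\<forall>i\<ge>k. v i = 0)"

definition kopen :: "nat \<Rightarrow> (nat \<Rightarrow> real) set \<Rightarrow> bool" where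
  "kopen k W \<longleftrightarrow> W \<subseteq> {v. kvec k v} \<and>
     (\<forall>v\<in>W. \<exists>e>0. \<forall>w. kvec k w \<and> (\<forall>i<k. \<bar>w i - v i\<bar> < e) \<longrightarrow> w \<in> W)"

definition kcont :: "nat \<Rightarrow> (nat \<Rightarrow> real) set \<Rightarrow> ((nat \<Rightarrow> real) \<Rightarrow> real) \<Rightarrow> bool" where
  "kcont k W g \<longleftrightarrow> (\<forall>v\<in>W. \<forall>e>0. \<exists>\<delta>>0. \<forall>w\<in>W. (\<forall>i<k. \<bar>w i - v i\<bar> < \<delta>) \<longrightarrow> \<bar>g w - g v\<bar> < e)"

definition cinf :: "nat \<Rightarrow> (nat \<Rightarrow> real) set \<Rightarrow> ((nat \<Rightarrow> real) \<Rightarrow> real) \<Rightarrow> bool" where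
  "cinf k W \<alpha> \<longleftrightarrow> kopen k W \<and> (\<exists>D :: nat list \<Rightarrow> (nat \<Rightarrow> real) \<Rightarrow> real.
      (\<forall>v\<in>W. D [] v = \<alpha> v) \<and>
      (\<forall>is. set is \<subseteq> {..<k} \<longrightarrow> kcont k W (D is) \<and>
         (\<forall>v\<in>W. \<forall>i<k. ((\<lambda>s. D is (v(i := s))) has_real_derivative D (i # is) v) (at (v i)))))"

definition pderiv_k :: "nat \<Rightarrow> ((nat \<Rightarrow> real) \<Rightarrow> real) \<Rightarrow> (nat \<Rightarrow> real) \<Rightarrow> real" where
  "pderiv_k i \<alpha> v = deriv (\<lambda>s. \<alpha> (v(i := s))) (v i)"

definition catv :: "nat \<Rightarrow> (nat \<Rightarrow> 'a) \<Rightarrow> (nat \<Rightarrow> 'a) \<Rightarrow> nat \<Rightarrow> 'a" where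
  "catv p u v = (\<lambda>i. if i < p then u i else v (i - p))"

definition fpt :: "nat \<Rightarrow> (nat \<Rightarrow> fermat) \<Rightarrow> bool" where
  "fpt k X \<longleftrightarrow> (\<forall>i\<ge>k. X i = fzero)"

definition stv :: "nat \<Rightarrow> (nat \<Rightarrow> fermat) \<Rightarrow> nat \<Rightarrow> real" where
  "stv k X = (\<lambda>i. if i < k then fst_part (X i) else 0)"

definition fstar :: "nat \<Rightarrow> (nat \<Rightarrow> real) set \<Rightarrow> (nat \<Rightarrow> fermat) set" where
  "fstar k V = {X. fpt k X \<and> stv k X \<in> V}"

definition fopen :: "nat \<Rightarrow> (nat \<Rightarrow> fermat) set \<Rightarrow> bool" where
  "fopen k U \<longleftrightarrow> (\<exists>V. kopen k V \<and> U = fstar k V)"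

definition fext :: "nat \<Rightarrow> ((nat \<Rightarrow> real) \<Rightarrow> real) \<Rightarrow> (nat \<Rightarrow> fermat) \<Rightarrow> fermat" where
  "fext k \<alpha> X = fclass (\<lambda>t. \<alpha> (\<lambda>i. if i < k then frep (X i) t else 0))"

definition local_rep :: "nat \<Rightarrow> (nat \<Rightarrow> fermat) set \<Rightarrow> ((nat \<Rightarrow> fermat) \<Rightarrow> fermat)
     \<Rightarrow> (nat \<Rightarrow> real) set \<Rightarrow> nat \<Rightarrow> (nat \<Rightarrow> real) set \<Rightarrow> (nat \<Rightarrow> fermat)
     \<Rightarrow> ((nat \<Rightarrow> real) \<Rightarrow> real) \<Rightarrow> bool" where
  "local_rep n S f V pd P q \<alpha> \<longleftrightarrow> kopen n V \<and> kopen pd P \<and> q \<in> fstar pd P \<and>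
     cinf (pd + n) {catv pd u v | u v. u \<in> P \<and> v \<in> V} \<alpha> \<and>
     (\<forall>y \<in> fstar n V \<inter> S. f y = fext (pd + n) \<alpha> (catv pd q y))"

definition fsmooth :: "nat \<Rightarrow> (nat \<Rightarrow> fermat) set \<Rightarrow> ((nat \<Rightarrow> fermat) \<Rightarrow> fermat) \<Rightarrow> bool" where
  "fsmooth n S f \<longleftrightarrow> (\<forall>x\<in>S. \<exists>V pd P q \<alpha>. x \<in> fstar n V \<and> local_rep n S f V pd P q \<alpha>)"

definition pt1 :: "fermat \<Rightarrow> nat \<Rightarrow> fermat" where
  "pt1 x = (\<lambda>i. if i = 0 then x else fzero)"

definition fsmooth1 :: "fermat set \<Rightarrow> (fermat \<Rightarrow> fermat) \<Rightarrow> bool" where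
  "fsmooth1 J g \<longleftrightarrow> fsmooth 1 (pt1 ` J) (\<lambda>X. g (X 0))"

definition fderiv1 :: "fermat set \<Rightarrow> (fermat \<Rightarrow> fermat) \<Rightarrow> fermat \<Rightarrow> fermat" where
  "fderiv1 J g x = (SOME w. \<exists>V pd P q \<alpha>. pt1 x \<in> fstar 1 V \<and>
      local_rep 1 (pt1 ` J) (\<lambda>X. g (X 0)) V pd P q \<alpha> \<and>
      w = fext (pd + 1) (pderiv_k pd \<alpha>) (catv pd q (pt1 x)))"

definition fantider :: "fermat set \<Rightarrow> (fermat \<Rightarrow> fermat) \<Rightarrow> fermat \<Rightarrow> fermat \<Rightarrow> fermat" where
  "fantider J f u = (THE I. fsmooth1 J I \<and> I u = fzero \<and> (\<forall>x\<in>J. fderiv1 J I x = f x) \<and>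
                          (\<forall>x. x \<notin> J \<longrightarrow> I x = fzero))"

text \<open>Integral over an interval I: the integral from inf I to sup I computed on any
  non-infinitesimal interval K containing I (and its endpoints) on which g is smooth.
  Convention: 0 if no such data exist (e.g. an unbounded I).\<close>
definition fint_ok :: "fermat set \<Rightarrow> (fermat \<Rightarrow> fermat) \<Rightarrow> fermat \<Rightarrow> fermat \<Rightarrow> fermat set \<Rightarrow> bool" where
  "fint_ok I g a b K \<longleftrightarrow> (\<exists>lc rc. fle a b \<and> I = ivl (Fin a) (Fin b) lc rc) \<and>
      noninf_interval K \<and> I \<subseteq> K \<and> a \<in> K \<and> b \<in> K \<and> fsmooth1 K g"

definition fint :: "fermat set \<Rightarrow> (fermat \<Rightarrow> fermat) \<Rightarrow> fermat" where
  "fint I g = (if \<exists>a b K. fint_ok I g a b K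
     then SOME v. \<exists>a b K. fint_ok I g a b K \<and> v = fantider K g a b
     else fzero)"

fun iter_int :: "(nat \<Rightarrow> fermat set) \<Rightarrow> nat list \<Rightarrow> ((nat \<Rightarrow> fermat) \<Rightarrow> fermat)
    \<Rightarrow> (nat \<Rightarrow> fermat) \<Rightarrow> fermat" where
  "iter_int I [] f x = f x"
| "iter_int I (j # js) f x = fint (I j) (\<lambda>s. iter_int I js f (x(j := s)))"

definition fbox :: "nat \<Rightarrow> (nat \<Rightarrow> fermat set) \<Rightarrow> (nat \<Rightarrow> fermat) set" where
  "fbox d I = {x. fpt d x \<and> (\<forall>i<d. x i \<in> I i)}"

end

(* Taylor expansion in the nonstandard parameters turns every smooth function locally into a finite sum of
   Fermat multiples of ordinary smooth functions, because increments of Fermat reals are nilpotent. Expanding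
   the multiples in powers t^a with 0 <= a <= 1 makes the coefficient functions unique, so that they glue; by
   compactness finitely many of them suffice near a closed box. Integrals of such sums are differences of
   ordinary primitives, evaluated at the endpoints. If M is a primitive of the integrand in two coordinates,
   then both orders of integration give the same alternating sum of values of M, by the symmetry of mixed
   partial derivatives; adjacent interchanges generate all permutations. If some interval is empty or
   unbounded, both sides vanish. *)
theory Submission
  imports Defs "HOL-Library.Landau_Symbols"
begin

section \<open>The ring of Fermat reals\<close>

text \<open>Derivative, antiderivative and integral are introduced by choice or definite
  description. Nothing is known about them before the derivative is shown to be independent of the
  representation, also at points whose standard part is an endpoint, where the function is given on
  one side only. Sums of products of a Fermat number and a real smooth function are preferred to
  \<open>\<alpha>(p, y)\<close> because they are linear: differentiation, primitives and
  substitution of standard values act on the real factors alone, and uniqueness reduces to real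
  functions by reading off coefficients. Iterating integrals requires every inner integral to be a
  function of the same kind on the same domain. Hence one open box around the closed box of standard
  parts is fixed, and all functions keep all \<open>d\<close> variables. Since the endpoints of
  integration are nonstandard, inserting one of them is again a Taylor expansion, at its standard
  part. The bound 1 on exponents is dictated by the equivalence modulo o(t): every higher power of
  \<open>t\<close> vanishes in the quotient, while \<open>t\<close> itself survives as a nonzero
  infinitesimal.\<close>

abbreviation st :: "fermat \<Rightarrow> real" where
  "st \<equiv> fst_part"

text \<open>Right germs at 0 including the value at 0: with this filter \<^const>\<open>is_o\<close> is a Landau symbol.\<close>

definition F0 :: "real filter" where
  "F0 = inf (nhds 0) (principal {0..})"

lemma eventually_F0: "eventually P F0 \<longleftrightarrow> (\<exists>\<delta>>0. \<forall>t. 0 \<le> t \<and> t < \<delta> \<longrightarrow> P t)"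
proof -
  have "eventually P F0 \<longleftrightarrow> (\<exists>\<delta>>0. \<forall>t. dist t 0 < \<delta> \<longrightarrow> t \<in> {0..} \<longrightarrow> P t)"
    by (simp add: F0_def eventually_inf_principal eventually_nhds_metric)
  also have "\<dots> \<longleftrightarrow> (\<exists>\<delta>>0. \<forall>t. 0 \<le> t \<and> t < \<delta> \<longrightarrow> P t)"
    by (intro ex_cong1) auto
  finally show ?thesis .
qed

lemma eventually_F0_at_0: "eventually P F0 \<Longrightarrow> P 0"
  unfolding eventually_F0 by auto

lemma eventually_F0_iff: "eventually P F0 \<longleftrightarrow> P 0 \<and> eventually P (at_right 0)"
  unfolding eventually_F0 eventually_at_right_field
  by (safe; force simp: order_le_less)

lemma eventually_F0_nonneg: "eventually (\<lambda>t. 0 \<le> t) F0"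
  unfolding eventually_F0 by (auto intro!: exI[of _ 1])

lemma eventually_F0_less: "0 < e \<Longrightarrow> eventually (\<lambda>t. t < e) F0"
  unfolding eventually_F0 by auto

text \<open>At \<open>t = 0\<close> the estimate \<open>norm (z t) \<le> c * norm t\<close> says
  exactly \<open>z 0 = 0\<close>; away from 0 it is the limit of the quotient. The calculus of
  Landau symbols thus covers both conjuncts of \<open>is_o\<close> at once.\<close>

lemma is_o_iff: "is_o z \<longleftrightarrow> z \<in> o[F0](\<lambda>t. t)"
proof
  assume z: "is_o z"
  show "z \<in> o[F0](\<lambda>t. t)"
  proof (rule landau_o.smallI)
    fix c :: real assume c: "c > 0"
    have "eventually (\<lambda>t. dist (z t / t) 0 < c) (at_right 0)"
      using z c unfolding is_o_def tendsto_iff by blast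
    moreover have "eventually (\<lambda>t::real. t > 0) (at_right 0)"
      by (simp add: eventually_at_right_less)
    ultimately have "eventually (\<lambda>t. norm (z t) \<le> c * norm t) (at_right 0)"
      by eventually_elim (simp add: divide_simps)
    then show "eventually (\<lambda>t. norm (z t) \<le> c * norm t) F0"
      using z by (simp add: eventually_F0_iff is_o_def)
  qed
next
  assume z: "z \<in> o[F0](\<lambda>t. t)"
  have ev: "eventually (\<lambda>t. norm (z t) \<le> c * norm t) F0" if "c > 0" for c
    using landau_o.smallD[OF z that] .
  have "z 0 = 0"
    using eventually_F0_at_0[OF ev[of 1]] by simp
  moreover have "((\<lambda>t. z t / t) \<longlongrightarrow> 0) (at_right 0)"
    unfolding tendsto_iff
  proof safe
    fix e :: real assume e: "e > 0"
    \<comment> \<open>Half of \<open>e\<close>, because the Landau bound is weak and the limit asks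
      for a strict one.\<close>
    have "eventually (\<lambda>t. norm (z t) \<le> (e/2) * norm t) (at_right 0)"
      using ev[of "e/2"] e by (simp add: eventually_F0_iff)
    moreover have "eventually (\<lambda>t::real. t > 0) (at_right 0)"
      by (simp add: eventually_at_right_less)
    ultimately show "eventually (\<lambda>t. dist (z t / t) 0 < e) (at_right 0)"
    proof eventually_elim
      case (elim t)
      then have "\<bar>z t\<bar> \<le> e/2 * t" by simp
      also have "\<dots> < e * t" using elim e by simp
      finally show ?case using elim by (simp add: divide_simps)
    qed
  qed
  ultimately show "is_o z" by (simp add: is_o_def)
qed

lemma is_o_zero: "is_o (\<lambda>t. 0)"
  by (simp add: is_o_iff)

lemma is_o_add: "is_o x \<Longrightarrow> is_o y \<Longrightarrow> is_o (\<lambda>t. x t + y t)"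
  unfolding is_o_iff by (rule sum_in_smallo)

lemma is_o_diff: "is_o x \<Longrightarrow> is_o y \<Longrightarrow> is_o (\<lambda>t. x t - y t)"
  unfolding is_o_iff by (rule sum_in_smallo)

lemma is_o_uminus: "is_o x \<Longrightarrow> is_o (\<lambda>t. - x t)"
  unfolding is_o_iff by simp

lemma is_o_sum: "(\<And>i. i \<in> A \<Longrightarrow> is_o (x i)) \<Longrightarrow> is_o (\<lambda>t. \<Sum>i\<in>A. x i t)"
  unfolding is_o_iff by (rule big_sum_in_smallo)

lemma is_o_mult: "is_o x \<Longrightarrow> y \<in> O[F0](\<lambda>_. 1) \<Longrightarrow> is_o (\<lambda>t. y t * x t)"
  unfolding is_o_iff using landau_o.big_small_mult[of y F0 "\<lambda>_. 1" x "\<lambda>t. t"] by simp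

lemma is_o_bound:
  assumes "is_o z" "eventually (\<lambda>t. \<bar>y t\<bar> \<le> M * \<bar>z t\<bar>) F0"
  shows "is_o y"
proof -
  have "y \<in> O[F0](z)" using assms(2) by (intro bigoI[where c = M]) auto
  then show ?thesis using assms(1) unfolding is_o_iff by (rule landau_o.big_small_trans)
qed

lemma is_o_cong: "eventually (\<lambda>t. x t = y t) F0 \<Longrightarrow> is_o x \<longleftrightarrow> is_o y"
  unfolding is_o_iff by (rule landau_o.small.in_cong)

section \<open>Real powers of t and their finite sums\<close>

lemma tpow_add: "0 \<le> a \<Longrightarrow> 0 \<le> b \<Longrightarrow> tpow t (a + b) = tpow t a * tpow t b"
  by (auto simp: tpow_def powr_add)

lemma tpow_0: "tpow t 0 = 1"
  by (simp add: tpow_def)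

lemma tpow_zero_base: "tpow 0 a = (if a = 0 then 1 else 0)"
  by (simp add: tpow_def)

lemma tpow_1: "0 \<le> t \<Longrightarrow> tpow t 1 = t"
  by (simp add: tpow_def)

lemma tpow_bound: "0 \<le> a \<Longrightarrow> 0 \<le> t \<Longrightarrow> t \<le> 1 \<Longrightarrow> \<bar>tpow t a\<bar> \<le> 1"
  by (auto simp: tpow_def powr_le1)

lemma tpow_bigo: "0 \<le> a \<Longrightarrow> (\<lambda>t. tpow t a) \<in> O[F0](\<lambda>_. 1)"
proof (rule bigoI[where c = 1])
  assume "0 \<le> a"
  then show "\<forall>\<^sub>F t in F0. norm (tpow t a) \<le> 1 * norm (1::real)"
    using eventually_conj[OF eventually_F0_nonneg eventually_F0_less[of 1]]
    by (auto elim!: eventually_mono simp: tpow_bound)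
qed

lemma tpow_tendsto_0: "0 < a \<Longrightarrow> ((\<lambda>t. tpow t a) \<longlongrightarrow> 0) (at_right 0)"
proof -
  assume a: "0 < a"
  have "((\<lambda>t::real. t powr a) \<longlongrightarrow> 0) (at_right 0)"
    using tendsto_powr'[of "\<lambda>t::real. t" 0 "at_right 0" "\<lambda>_. a" a] a
      eventually_mono[OF eventually_at_right_less[of "0::real"], of "\<lambda>t. 0 \<le> t"]
    by (auto simp: tendsto_ident_at)
  then show ?thesis using a by (simp add: tpow_def)
qed

lemma is_o_tpow: "1 < a \<Longrightarrow> is_o (\<lambda>t. tpow t a)"
proof -
  assume a: "1 < a"
  have "((\<lambda>t. tpow t (a - 1)) \<longlongrightarrow> 0) (at_right 0)" using a by (intro tpow_tendsto_0) simp
  moreover have "eventually (\<lambda>t::real. t > 0) (at_right 0)"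
    by (simp add: eventually_at_right_less)
  then have "eventually (\<lambda>t. tpow t (a - 1) = tpow t a / t) (at_right 0)"
  proof eventually_elim
    case (elim t)
    then show ?case using a tpow_add[of "a - 1" 1 t] by (simp add: tpow_1)
  qed
  ultimately show ?thesis
    using a by (simp add: is_o_def tpow_zero_base tendsto_cong)
qed

text \<open>The sums occurring in \<open>Ro\<close>, generated term by term so that products need no
  reindexing of double sums. The separate constant \<open>r\<close> of \<open>Ro\<close> is the
  exponent 0, by the convention \<open>tpow t 0 = 1\<close>.\<close>

inductive lpol :: "(real \<Rightarrow> real) \<Rightarrow> bool" where
  lpol_0: "lpol (\<lambda>t. 0)"
| lpol_Cons: "lpol p \<Longrightarrow> 0 \<le> a \<Longrightarrow> lpol (\<lambda>t. c * tpow t a + p t)"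

lemma lpol_add: "lpol p \<Longrightarrow> lpol q \<Longrightarrow> lpol (\<lambda>t. p t + q t)"
  by (induction rule: lpol.induct) (auto simp: add.assoc intro: lpol.intros)

lemma lpol_monom_mult: "lpol p \<Longrightarrow> 0 \<le> a \<Longrightarrow> lpol (\<lambda>t. c * tpow t a * p t)"
proof (induction rule: lpol.induct)
  case lpol_0
  then show ?case by (simp add: lpol.lpol_0)
next
  case (lpol_Cons p b e)
  then have "lpol (\<lambda>t. (c * e) * tpow t (a + b) + c * tpow t a * p t)"
    by (intro lpol.lpol_Cons) auto
  then show ?case using lpol_Cons by (simp add: tpow_add algebra_simps)
qed

lemma lpol_mult: "lpol p \<Longrightarrow> lpol q \<Longrightarrow> lpol (\<lambda>t. p t * q t)"
proof (induction rule: lpol.induct)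
  case lpol_0
  then show ?case by (simp add: lpol.lpol_0)
next
  case (lpol_Cons p b e)
  then show ?case using lpol_add[OF lpol_monom_mult[of q b e]] by (simp add: algebra_simps)
qed

lemma lpol_const: "lpol (\<lambda>t. c)"
  using lpol_Cons[OF lpol_0, of 0 c] by (simp add: tpow_0)

lemma lpol_sum: "(\<forall>i<k. 0 \<le> a i) \<Longrightarrow> lpol (\<lambda>t. \<Sum>i<(k::nat). al i * tpow t (a i))"
proof (induction k)
  case 0
  then show ?case by (simp add: lpol.lpol_0)
next
  case (Suc k)
  then have "lpol (\<lambda>t. al k * tpow t (a k) + (\<Sum>i<k. al i * tpow t (a i)))"
    by (intro lpol.lpol_Cons) auto
  then show ?case by (simp add: add.commute)
qed

lemma lpol_sumE:
  assumes "lpol p"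
  obtains k :: nat and al a where "\<forall>i<k. 0 \<le> a i" "p = (\<lambda>t. \<Sum>i<k. al i * tpow t (a i))"
proof -
  have "\<exists>(k::nat) al a. (\<forall>i<k. 0 \<le> a i) \<and> p = (\<lambda>t. \<Sum>i<k. al i * tpow t (a i))"
    using assms
  proof (induction rule: lpol.induct)
    case lpol_0
    show ?case by (rule exI[of _ 0]) auto
  next
    case (lpol_Cons p b c)
    then obtain k :: nat and al a where
      k: "\<forall>i<k. 0 \<le> a i" "p = (\<lambda>t. \<Sum>i<k. al i * tpow t (a i))" by auto
    have "(\<lambda>t. c * tpow t b + p t) = (\<lambda>t. \<Sum>i<Suc k. (al(k := c)) i * tpow t ((a(k := b)) i))"
      by (auto simp: k intro!: sum.cong)
    then show ?case using k(1) lpol_Cons(2)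
      by (intro exI[of _ "Suc k"] exI[of _ "al(k := c)"] exI[of _ "a(k := b)"]) (auto simp: less_Suc_eq)
  qed
  then show thesis using that by blast
qed

lemma Ro_iff: "Ro x \<longleftrightarrow> (\<exists>p. lpol p \<and> is_o (\<lambda>t. x t - p t))"
proof
  assume "Ro x"
  then obtain r k al a where "\<forall>i<(k::nat). 0 \<le> (a i::real)"
    "is_o (\<lambda>t. x t - (r + (\<Sum>i<k. al i * tpow t (a i))))" unfolding Ro_def by blast
  then show "\<exists>p. lpol p \<and> is_o (\<lambda>t. x t - p t)"
    using lpol_add[OF lpol_const lpol_sum] by blast
next
  assume "\<exists>p. lpol p \<and> is_o (\<lambda>t. x t - p t)"
  then obtain p where p: "lpol p" "is_o (\<lambda>t. x t - p t)" by blast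
  from p(1) obtain k :: nat and al a where
    "\<forall>i<k. 0 \<le> a i" "p = (\<lambda>t. \<Sum>i<k. al i * tpow t (a i))" by (rule lpol_sumE)
  then show "Ro x" using p(2) unfolding Ro_def
    by (intro exI[of _ 0] exI[of _ k] exI[of _ al] exI[of _ a]) simp
qed

lemma lpol_bigo: "lpol p \<Longrightarrow> p \<in> O[F0](\<lambda>_. 1)"
proof (induction rule: lpol.induct)
  case (lpol_Cons p a c)
  have "(\<lambda>t. c * tpow t a) \<in> O[F0](\<lambda>_. 1)"
    using tpow_bigo[OF lpol_Cons(2)] by (cases "c = 0") auto
  then show ?case using lpol_Cons by (intro sum_in_bigo)
qed simp

lemma is_o_bigo_1: "is_o x \<Longrightarrow> x \<in> O[F0](\<lambda>_. 1)"
proof -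
  assume "is_o x"
  then have "x \<in> O[F0](\<lambda>t. t)" unfolding is_o_iff by (rule landau_o.small_imp_big)
  moreover have "(\<lambda>t. t) \<in> O[F0](\<lambda>_. 1::real)"
  proof (rule bigoI[where c = 1])
    show "\<forall>\<^sub>F t in F0. norm t \<le> 1 * norm (1::real)"
      using eventually_F0_nonneg eventually_F0_less[of 1, simplified]
      by eventually_elim auto
  qed
  ultimately show ?thesis by (rule landau_o.big_trans)
qed

lemma Ro_bigo: "Ro x \<Longrightarrow> x \<in> O[F0](\<lambda>_. 1)"
proof -
  assume "Ro x"
  then obtain p where "lpol p" "is_o (\<lambda>t. x t - p t)" unfolding Ro_iff by blast
  then have "(\<lambda>t. (x t - p t) + p t) \<in> O[F0](\<lambda>_. 1)"
    by (intro sum_in_bigo is_o_bigo_1 lpol_bigo)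
  then show ?thesis by simp
qed

lemma Ro_const: "Ro (\<lambda>t. c)"
  unfolding Ro_iff using lpol_const[of c] is_o_zero by fastforce

lemma Ro_tpow: "0 \<le> a \<Longrightarrow> Ro (\<lambda>t. tpow t a)"
  unfolding Ro_iff using lpol_Cons[OF lpol_0, of a 1] is_o_zero by fastforce

lemma Ro_is_o: "is_o x \<Longrightarrow> Ro x"
  unfolding Ro_iff using lpol_0 by fastforce

lemma Ro_add: "Ro x \<Longrightarrow> Ro y \<Longrightarrow> Ro (\<lambda>t. x t + y t)"
proof -
  assume "Ro x" "Ro y"
  then obtain p q where pq: "lpol p" "is_o (\<lambda>t. x t - p t)" "lpol q" "is_o (\<lambda>t. y t - q t)"
    unfolding Ro_iff by blast
  then have "is_o (\<lambda>t. (x t - p t) + (y t - q t))" by (intro is_o_add)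
  then have "is_o (\<lambda>t. (x t + y t) - (p t + q t))" by (simp add: algebra_simps)
  then show ?thesis unfolding Ro_iff using pq lpol_add by blast
qed

lemma Ro_mult: "Ro x \<Longrightarrow> Ro y \<Longrightarrow> Ro (\<lambda>t. x t * y t)"
proof -
  assume R: "Ro x" "Ro y"
  then obtain p q where pq: "lpol p" "is_o (\<lambda>t. x t - p t)" "lpol q" "is_o (\<lambda>t. y t - q t)"
    unfolding Ro_iff by blast
  then have "is_o (\<lambda>t. y t * (x t - p t) + p t * (y t - q t))"
    using R by (intro is_o_add is_o_mult Ro_bigo lpol_bigo)
  then have "is_o (\<lambda>t. (x t * y t) - (p t * q t))" by (simp add: algebra_simps)
  then show ?thesis unfolding Ro_iff using pq lpol_mult by blast
qed

lemma Ro_uminus: "Ro x \<Longrightarrow> Ro (\<lambda>t. - x t)"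
  using Ro_mult[OF Ro_const[of "-1"]] by simp

lemma Ro_diff: "Ro x \<Longrightarrow> Ro y \<Longrightarrow> Ro (\<lambda>t. x t - y t)"
  using Ro_add[OF _ Ro_uminus] by simp

lemma Ro_sum: "(\<And>i. i \<in> A \<Longrightarrow> Ro (x i)) \<Longrightarrow> Ro (\<lambda>t. \<Sum>i\<in>A. x i t)"
  by (induction A rule: infinite_finite_induct) (auto intro: Ro_add Ro_const)

lemma Ro_power: "Ro x \<Longrightarrow> Ro (\<lambda>t. x t ^ n)"
  by (induction n) (auto intro: Ro_mult Ro_const)

section \<open>Equivalence modulo o(t) and classes of representatives\<close>

lemma Ro_fsim: "Ro x \<Longrightarrow> fsim x y \<Longrightarrow> Ro y"
  using Ro_diff[OF _ Ro_is_o, of x "\<lambda>t. x t - y t"] by (simp add: fsim_def)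

lemma fsim_refl: "fsim x x"
  by (simp add: fsim_def is_o_zero)

lemma fsim_sym: "fsim x y \<Longrightarrow> fsim y x"
  unfolding fsim_def using is_o_uminus by fastforce

lemma fsim_trans: "fsim x y \<Longrightarrow> fsim y z \<Longrightarrow> fsim x z"
  unfolding fsim_def using is_o_add[of "\<lambda>t. x t - y t" "\<lambda>t. y t - z t"] by simp

lemma fsim_add: "fsim x x' \<Longrightarrow> fsim y y' \<Longrightarrow> fsim (\<lambda>t. x t + y t) (\<lambda>t. x' t + y' t)"
  unfolding fsim_def using is_o_add[of "\<lambda>t. x t - x' t" "\<lambda>t. y t - y' t"] by (simp add: algebra_simps)

lemma fsim_uminus: "fsim x x' \<Longrightarrow> fsim (\<lambda>t. - x t) (\<lambda>t. - x' t)"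
  unfolding fsim_def using is_o_uminus[of "\<lambda>t. x t - x' t"] by (simp add: algebra_simps)

lemma fsim_mult:
  assumes "fsim x x'" "fsim y y'" "Ro x" "Ro y'"
  shows "fsim (\<lambda>t. x t * y t) (\<lambda>t. x' t * y' t)"
proof -
  have "is_o (\<lambda>t. x t * (y t - y' t) + y' t * (x t - x' t))"
    using assms unfolding fsim_def by (intro is_o_add is_o_mult Ro_bigo)
  then show ?thesis by (simp add: fsim_def algebra_simps)
qed

lemma Rep_fclass: "Ro h \<Longrightarrow> Rep_fermat (fclass h) = {y. Ro y \<and> fsim h y}"
  unfolding fclass_def by (simp add: Abs_fermat_inverse) (metis (mono_tags, lifting) Abs_fermat_inverse mem_Collect_eq)

lemma frep_in: "frep X \<in> Rep_fermat X"
proof -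
  from Rep_fermat[of X] obtain x where "Ro x" "Rep_fermat X = {y. Ro y \<and> fsim x y}" by blast
  then have "x \<in> Rep_fermat X" by (simp add: fsim_refl)
  then show ?thesis unfolding frep_def by (rule someI[where P = "\<lambda>x. x \<in> Rep_fermat X"])
qed

lemma Rep_fermat_eq: "Rep_fermat X = {y. Ro y \<and> fsim (frep X) y}"
proof -
  from Rep_fermat[of X] obtain x where "Ro x" "Rep_fermat X = {y. Ro y \<and> fsim x y}" by blast
  then show ?thesis using frep_in[of X] by (auto intro: fsim_sym fsim_trans)
qed

lemma Ro_frep: "Ro (frep X)"
  using frep_in[of X] unfolding Rep_fermat_eq by blast

lemma fclass_frep: "fclass (frep X) = X"
  using Rep_fclass[OF Ro_frep] Rep_fermat_eq Rep_fermat_inject by metis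

lemma fclass_eq_iff: "Ro x \<Longrightarrow> Ro y \<Longrightarrow> fclass x = fclass y \<longleftrightarrow> fsim x y"
proof
  assume R: "Ro x" "Ro y" and "fclass x = fclass y"
  then have "{z. Ro z \<and> fsim x z} = {z. Ro z \<and> fsim y z}"
    by (metis Rep_fclass)
  then show "fsim x y" using R fsim_refl by blast
next
  assume R: "Ro x" "Ro y" and xy: "fsim x y"
  have "{z. Ro z \<and> fsim x z} = {z. Ro z \<and> fsim y z}"
    using xy fsim_sym fsim_trans by blast
  then show "fclass x = fclass y"
    using R by (simp add: fclass_def)
qed

lemma fclass_eqI: "Ro x \<Longrightarrow> fsim x y \<Longrightarrow> fclass x = fclass y"
  using fclass_eq_iff Ro_fsim by blast

lemma frep_fclass: "Ro x \<Longrightarrow> fsim (frep (fclass x)) x"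
  using fclass_eq_iff[OF Ro_frep] fclass_frep by blast

lemma fclass_cases: obtains x where "Ro x" "X = fclass x"
  using Ro_frep fclass_frep by metis

lemma fst_part_fclass: "Ro x \<Longrightarrow> st (fclass x) = x 0"
  using frep_fclass[of x] by (simp add: fst_part_def fsim_def is_o_def)

section \<open>Ring structure and the embedding of the reals\<close>

instantiation fermat :: comm_ring_1
begin

definition "0 = fclass (\<lambda>t. 0)"
definition "1 = fclass (\<lambda>t. 1)"
definition "X + Y = fclass (\<lambda>t. frep X t + frep Y t)"
definition "X * Y = fclass (\<lambda>t. frep X t * frep Y t)"
definition "- X = fclass (\<lambda>t. - frep X t)"
definition "X - Y = X + - (Y::fermat)"

lemma fclass_add: "Ro x \<Longrightarrow> Ro y \<Longrightarrow> fclass x + fclass y = fclass (\<lambda>t. x t + y t)"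
  unfolding plus_fermat_def by (intro fclass_eqI fsim_add frep_fclass Ro_add Ro_frep)

lemma fclass_mult: "Ro x \<Longrightarrow> Ro y \<Longrightarrow> fclass x * fclass y = fclass (\<lambda>t. x t * y t)"
  unfolding times_fermat_def by (intro fclass_eqI fsim_mult frep_fclass Ro_mult Ro_frep)

lemma fclass_uminus: "Ro x \<Longrightarrow> - fclass x = fclass (\<lambda>t. - x t)"
  unfolding uminus_fermat_def by (intro fclass_eqI fsim_uminus frep_fclass Ro_uminus Ro_frep)

instance
proof
  fix X Y Z :: fermat
  obtain x y z where [simp]: "Ro x" "Ro y" "Ro z" and X: "X = fclass x" "Y = fclass y" "Z = fclass z"
    using fclass_cases by metis
  note [simp] = fclass_add fclass_mult fclass_uminus Ro_add Ro_mult Ro_uminus Ro_const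
  show "X * Y * Z = X * (Y * Z)" by (simp add: X mult.assoc)
  show "X * Y = Y * X" by (simp add: X mult.commute)
  show "1 * X = X" by (simp add: X one_fermat_def)
  show "X + Y + Z = X + (Y + Z)" by (simp add: X add.assoc)
  show "X + Y = Y + X" by (simp add: X add.commute)
  show "0 + X = X" by (simp add: X zero_fermat_def)
  show "- X + X = 0" by (simp add: X zero_fermat_def)
  show "X - Y = X + - Y" by (simp add: minus_fermat_def)
  show "(X + Y) * Z = X * Z + Y * Z" by (simp add: X distrib_right)
  show "(0::fermat) \<noteq> 1"
    by (simp add: zero_fermat_def one_fermat_def fclass_eq_iff fsim_def is_o_def)
qed

end

lemma fzero_eq: "fzero = 0"
  by (simp add: fzero_def zero_fermat_def)

lemma fclass_diff: "Ro x \<Longrightarrow> Ro y \<Longrightarrow> fclass x - fclass y = fclass (\<lambda>t. x t - y t)"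
  by (simp add: minus_fermat_def fclass_uminus fclass_add Ro_uminus)

lemma fclass_sum: "(\<And>i. i \<in> A \<Longrightarrow> Ro (x i)) \<Longrightarrow> (\<Sum>i\<in>A. fclass (x i)) = fclass (\<lambda>t. \<Sum>i\<in>A. x i t)"
  by (induction A rule: infinite_finite_induct) (auto simp: zero_fermat_def fclass_add Ro_sum)

lemma fclass_power: "Ro x \<Longrightarrow> fclass x ^ n = fclass (\<lambda>t. x t ^ n)"
  by (induction n) (auto simp: one_fermat_def fclass_mult Ro_power)

definition fconst :: "real \<Rightarrow> fermat" where
  "fconst r = fclass (\<lambda>t. r)"

lemma fconst_add: "fconst (r + s) = fconst r + fconst s"
  by (simp add: fconst_def fclass_add Ro_const)

lemma fconst_mult: "fconst (r * s) = fconst r * fconst s"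
  by (simp add: fconst_def fclass_mult Ro_const)

lemma fconst_0 [simp]: "fconst 0 = 0"
  by (simp add: fconst_def zero_fermat_def)

lemma fconst_1 [simp]: "fconst 1 = 1"
  by (simp add: fconst_def one_fermat_def)

lemma fconst_diff: "fconst (r - s) = fconst r - fconst s"
  by (simp add: fconst_def fclass_diff Ro_const)

lemma fst_part_fconst [simp]: "st (fconst r) = r"
  by (simp add: fconst_def fst_part_fclass Ro_const)

lemma fst_part_add: "st (X + Y) = st X + st Y"
  using fst_part_fclass[OF Ro_add[OF Ro_frep[of X] Ro_frep[of Y]]]
  by (simp add: plus_fermat_def fst_part_def)

lemma fst_part_diff: "st (X - Y) = st X - st Y"
  using fst_part_add[of "X - Y" Y] by simp

section \<open>Normal form: unique expansion in the powers of t\<close>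

definition fmonom :: "real \<Rightarrow> fermat" where
  "fmonom a = fclass (\<lambda>t. tpow t a)"

text \<open>The set \<open>E\<close> only has to contain the support of \<open>r\<close>, so two
  expansions can be compared over a common index set. The coefficients form a function on all reals,
  which makes uniqueness an equation between functions.\<close>

definition fexp :: "(real \<Rightarrow> real) \<Rightarrow> fermat \<Rightarrow> bool" where
  "fexp r w \<longleftrightarrow> (\<exists>E. finite E \<and> E \<subseteq> {0..1} \<and> (\<forall>a. a \<notin> E \<longrightarrow> r a = 0) \<and>
     w = (\<Sum>a\<in>E. fconst (r a) * fmonom a))"

lemma fexp_finite: "fexp r w \<Longrightarrow> finite {a. r a \<noteq> 0}"
  unfolding fexp_def by (auto intro: finite_subset)

lemma fexp_sum:
  assumes "fexp r w" "finite E" "\<And>a. a \<notin> E \<Longrightarrow> r a = 0"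
  shows "w = (\<Sum>a\<in>E. fconst (r a) * fmonom a)"
proof -
  obtain D where D: "finite D" "\<And>a. a \<notin> D \<Longrightarrow> r a = 0" "w = (\<Sum>a\<in>D. fconst (r a) * fmonom a)"
    using assms(1) unfolding fexp_def by blast
  have "(\<Sum>a\<in>D. fconst (r a) * fmonom a) = (\<Sum>a\<in>D \<union> E. fconst (r a) * fmonom a)"
    using D assms by (intro sum.mono_neutral_left) auto
  also have "\<dots> = (\<Sum>a\<in>E. fconst (r a) * fmonom a)"
    using D assms by (intro sum.mono_neutral_right) auto
  finally show ?thesis using D by simp
qed

lemma fexp_range: "fexp r w \<Longrightarrow> r a \<noteq> 0 \<Longrightarrow> a \<in> {0..1}"
  unfolding fexp_def by blast

lemma fexpI:
  assumes "finite E" "E \<subseteq> {0..1}" "\<And>a. a \<notin> E \<Longrightarrow> r a = 0" "w = (\<Sum>a\<in>E. fconst (r a) * fmonom a)"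
  shows "fexp r w"
  using assms unfolding fexp_def by blast

lemma fexp_add:
  assumes "fexp r w" "fexp r' w'"
  shows "fexp (\<lambda>a. r a + r' a) (w + w')"
proof (rule fexpI)
  let ?E = "{a. r a \<noteq> 0} \<union> {a. r' a \<noteq> 0}"
  show f: "finite ?E" using assms fexp_finite by auto
  show "?E \<subseteq> {0..1}" using assms fexp_range by blast
  show "r a + r' a = 0" if "a \<notin> ?E" for a using that by auto
  show "w + w' = (\<Sum>a\<in>?E. fconst (r a + r' a) * fmonom a)"
    using fexp_sum[OF assms(1) f] fexp_sum[OF assms(2) f]
    by (simp add: fconst_add distrib_right sum.distrib)
qed

lemma fexp_scale:
  assumes "fexp r w"
  shows "fexp (\<lambda>a. c * r a) (fconst c * w)"
proof (rule fexpI)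
  let ?E = "{a. r a \<noteq> 0}"
  show f: "finite ?E" using assms fexp_finite by auto
  show "?E \<subseteq> {0..1}" using assms fexp_range by blast
  show "c * r a = 0" if "a \<notin> ?E" for a using that by auto
  show "fconst c * w = (\<Sum>a\<in>?E. fconst (c * r a) * fmonom a)"
    using fexp_sum[OF assms(1) f]
    by (simp add: fconst_mult sum_distrib_left mult.assoc)
qed

lemma fexp_0: "fexp (\<lambda>_. 0) 0"
  by (rule fexpI[of "{}"]) auto

lemma fexp_monom:
  assumes "0 \<le> a" "a \<le> 1"
  shows "fexp (\<lambda>b. if b = a then c else 0) (fconst c * fmonom a)"
  by (rule fexpI[of "{a}"]) (use assms in auto)

lemma fmonom_gt_1: "1 < a \<Longrightarrow> fmonom a = 0"
  unfolding fmonom_def zero_fermat_def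
  by (rule fclass_eqI) (auto simp: fsim_def is_o_tpow Ro_tpow)

lemma fclass_monom: "0 \<le> a \<Longrightarrow> fclass (\<lambda>t. c * tpow t a) = fconst c * fmonom a"
  by (simp add: fmonom_def fconst_def fclass_mult Ro_const Ro_tpow)

text \<open>A representative is a finite sum of powers up to o(t); its terms are added one by one,
  and those with exponent above 1 are zero in the quotient.\<close>

lemma fexp_exists: "\<exists>r. fexp r w"
proof -
  have lp: "Ro p \<and> (\<exists>r. fexp r (fclass p))" if "lpol p" for p
    using that
  proof (induction rule: lpol.induct)
    case lpol_0
    then show ?case using fexp_0 by (auto simp: Ro_const zero_fermat_def)
  next
    case (lpol_Cons p a c)
    then obtain r where r: "fexp r (fclass p)" by blast
    have R: "Ro (\<lambda>t. c * tpow t a)" using lpol_Cons by (intro Ro_mult Ro_const Ro_tpow)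
    have eq: "fclass (\<lambda>t. c * tpow t a + p t) = fconst c * fmonom a + fclass p"
      using lpol_Cons R by (simp flip: fclass_monom add: fclass_add)
    have "\<exists>r. fexp r (fconst c * fmonom a + fclass p)"
    proof (cases "a \<le> 1")
      case True
      then show ?thesis using lpol_Cons fexp_add[OF fexp_monom r] by blast
    next
      case False
      then show ?thesis using r by (auto simp: fmonom_gt_1)
    qed
    then show ?case using eq R lpol_Cons by (auto intro: Ro_add)
  qed
  obtain x where x: "Ro x" "w = fclass x" by (rule fclass_cases)
  then obtain p where p: "lpol p" "is_o (\<lambda>t. x t - p t)" unfolding Ro_iff by blast
  then have "w = fclass p" using x by (auto intro: fclass_eqI simp: fsim_def)
  then show ?thesis using lp[OF p(1)] by blast
qed

text \<open>After division by \<open>t^m\<close> the lower exponents are absent and the higher ones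
  tend to 0. The least exponent therefore governs a sum of powers; uniqueness of the expansion and
  totality of the order both rest on this.\<close>

lemma leading_term:
  assumes "finite E" "E \<subseteq> {0..}" "m \<in> E" "\<And>b. b < m \<Longrightarrow> r b = 0"
  shows "((\<lambda>t. (\<Sum>b\<in>E. r b * tpow t b) / tpow t m) \<longlongrightarrow> r m) (at_right 0)"
proof -
  have ev: "eventually (\<lambda>t::real. t > 0) (at_right 0)" by (simp add: eventually_at_right_less)
  have "((\<lambda>t. \<Sum>b\<in>E. r b * (tpow t b / tpow t m)) \<longlongrightarrow> (\<Sum>b\<in>E. if b = m then r m else 0)) (at_right 0)"
  proof (rule tendsto_sum)
    fix b assume b: "b \<in> E"
    consider "b < m" | "b = m" | "b > m" by linarith
    then show "((\<lambda>t. r b * (tpow t b / tpow t m)) \<longlongrightarrow> (if b = m then r m else 0)) (at_right 0)"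
    proof cases
      case 1
      then show ?thesis using assms(4) by simp
    next
      case 2
      have "eventually (\<lambda>t. r m = r b * (tpow t b / tpow t m)) (at_right 0)"
        using ev by eventually_elim (use 2 in \<open>auto simp: tpow_def\<close>)
      then have "((\<lambda>t. r b * (tpow t b / tpow t m)) \<longlongrightarrow> r m) (at_right 0)"
        by (rule Lim_transform_eventually[OF tendsto_const])
      then show ?thesis using 2 by simp
    next
      case 3
      have "eventually (\<lambda>t. r b * tpow t (b - m) = r b * (tpow t b / tpow t m)) (at_right 0)"
        using ev
      proof eventually_elim
        case (elim t)
        have "tpow t b = tpow t (b - m) * tpow t m"
          using tpow_add[of "b - m" m t] 3 assms(2,3) by auto
        moreover have "tpow t m > 0" using elim by (auto simp: tpow_def)
        ultimately show ?case by simp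
      qed
      moreover have "((\<lambda>t. r b * tpow t (b - m)) \<longlongrightarrow> r b * 0) (at_right 0)"
        using 3 by (intro tendsto_mult tendsto_const tpow_tendsto_0) simp
      ultimately show ?thesis using 3 tendsto_cong by fastforce
    qed
  qed
  moreover have "(\<Sum>b\<in>E. if b = m then r m else 0) = r m" using assms by (simp add: sum.delta)
  ultimately show ?thesis by (simp add: sum_divide_distrib)
qed

lemma fexp_pol:
  assumes "fexp r w" "finite E" "E \<subseteq> {0..1}" "\<And>a. a \<notin> E \<Longrightarrow> r a = 0"
  shows "Ro (\<lambda>t. \<Sum>b\<in>E. r b * tpow t b)" "w = fclass (\<lambda>t. \<Sum>b\<in>E. r b * tpow t b)"
proof -
  have R: "Ro (\<lambda>t. r b * tpow t b)" if "b \<in> E" for b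
    using that assms(3) by (intro Ro_mult Ro_const Ro_tpow) auto
  then show "Ro (\<lambda>t. \<Sum>b\<in>E. r b * tpow t b)" by (intro Ro_sum)
  have "w = (\<Sum>a\<in>E. fconst (r a) * fmonom a)" using fexp_sum assms by blast
  also have "\<dots> = (\<Sum>a\<in>E. fclass (\<lambda>t. r a * tpow t a))"
    using assms(3) by (intro sum.cong refl) (auto simp: fclass_monom)
  also have "\<dots> = fclass (\<lambda>t. \<Sum>b\<in>E. r b * tpow t b)" using R by (rule fclass_sum)
  finally show "w = fclass (\<lambda>t. \<Sum>b\<in>E. r b * tpow t b)" .
qed

text \<open>Let \<open>m\<close> be the least exponent with a nonzero coefficient. A sum that is
  o(t) is also o(\<open>t^m\<close>) since \<open>m \<le> 1\<close>, so its leading coefficient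
  would be 0.\<close>

lemma fexp_unique_0:
  assumes "fexp r 0"
  shows "r = (\<lambda>_. 0)"
proof (rule ccontr)
  assume "r \<noteq> (\<lambda>_. 0)"
  then have ne: "{a. r a \<noteq> 0} \<noteq> {}" by auto
  let ?E = "{a. r a \<noteq> 0}"
  define m where "m = Min ?E"
  have fin: "finite ?E" using fexp_finite[OF assms] .
  have sub: "?E \<subseteq> {0..1}" using fexp_range[OF assms] by blast
  have m: "m \<in> ?E" unfolding m_def using fin ne by (rule Min_in)
  have mm: "r b = 0" if "b < m" for b using that fin unfolding m_def by (auto dest: Min_le)
  let ?p = "\<lambda>t. \<Sum>b\<in>?E. r b * tpow t b"
  have "fclass ?p = fclass (\<lambda>t. 0)"
    using fexp_pol(2)[OF assms fin sub] by (simp add: zero_fermat_def)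
  then have o: "is_o ?p"
    using fclass_eq_iff[OF fexp_pol(1)[OF assms fin sub] Ro_const[of 0]] by (simp add: fsim_def)
  have "((\<lambda>t. ?p t / tpow t m) \<longlongrightarrow> r m) (at_right 0)"
    using leading_term[OF fin _ m mm] sub by force
  moreover have "((\<lambda>t. ?p t / tpow t m) \<longlongrightarrow> 0) (at_right 0)"
  proof -
    have l: "((\<lambda>t. ?p t / t) \<longlongrightarrow> 0) (at_right 0)" using o by (simp add: is_o_def)
    \<comment> \<open>The factor \<open>t^(1 - m)\<close> is constantly 1 or tends to 0, according
      to whether \<open>m = 1\<close> or \<open>m < 1\<close>.\<close>
    have "((\<lambda>t. (?p t / t) * tpow t (1 - m)) \<longlongrightarrow> 0) (at_right 0)"
    proof (cases "m = 1")
      case True then show ?thesis using l by (simp add: tpow_0)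
    next
      case False
      then have "((\<lambda>t. tpow t (1 - m)) \<longlongrightarrow> 0) (at_right 0)"
        using m sub by (intro tpow_tendsto_0) auto
      then show ?thesis using tendsto_mult[OF l] by fastforce
    qed
    moreover have "eventually (\<lambda>t. (?p t / t) * tpow t (1 - m) = ?p t / tpow t m) (at_right 0)"
      using eventually_at_right_less[of "0::real"]
    proof eventually_elim
      case (elim t)
      have "t = tpow t (1 - m) * tpow t m"
        using tpow_add[of "1 - m" m t] m sub elim by (auto simp: tpow_1)
      moreover have "tpow t m > 0" using elim by (auto simp: tpow_def)
      ultimately have "tpow t (1 - m) = t / tpow t m" by (simp add: field_simps)
      then show ?case using elim by simp
    qed
    ultimately show ?thesis using tendsto_cong by fastforce
  qed
  ultimately have "r m = 0" by (rule tendsto_unique[rotated]) simp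
  then show False using m by simp
qed

lemma fexp_unique:
  assumes "fexp r w" "fexp r' w"
  shows "r = r'"
proof -
  have "fexp (\<lambda>a. -1 * r' a) (fconst (-1) * w)" using assms(2) by (rule fexp_scale)
  then have "fexp (\<lambda>a. r a + -1 * r' a) (w + fconst (-1) * w)" using assms(1) by (intro fexp_add)
  moreover have "w + fconst (-1) * w = 0" using fconst_diff[of 0 1] by simp
  ultimately have "(\<lambda>a. r a + -1 * r' a) = (\<lambda>_. 0)" by (intro fexp_unique_0) simp
  then have "r a + -1 * r' a = 0" for a by (rule fun_cong)
  then show ?thesis by (intro ext) simp
qed

text \<open>Real-linear in \<open>w\<close>: the device that turns identities between Fermat reals
  into families of identities between reals.\<close>

definition coef :: "fermat \<Rightarrow> real \<Rightarrow> real" where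
  "coef w = (THE r. fexp r w)"

lemma fexp_coef: "fexp (coef w) w"
proof -
  obtain r where r: "fexp r w" using fexp_exists by blast
  have "coef w = r"
    unfolding coef_def using r by (intro the_equality) (auto intro: fexp_unique)
  then show ?thesis using r by simp
qed

lemma coef_eqI: "fexp r w \<Longrightarrow> coef w = r"
  by (rule fexp_unique[OF fexp_coef])

lemma coef_add: "coef (v + w) a = coef v a + coef w a"
  using coef_eqI[OF fexp_add[OF fexp_coef fexp_coef]] by metis

lemma coef_scale: "coef (fconst c * w) a = c * coef w a"
  using coef_eqI[OF fexp_scale[OF fexp_coef]] by metis

lemma coef_0: "coef 0 a = 0"
  using coef_eqI[OF fexp_0] by metis

lemma finite_coef: "finite {a. coef w a \<noteq> 0}"
  using fexp_finite fexp_coef by blast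

lemma coef_expansion: "finite E \<Longrightarrow> (\<And>a. a \<notin> E \<Longrightarrow> coef w a = 0) \<Longrightarrow> w = (\<Sum>a\<in>E. fconst (coef w a) * fmonom a)"
  using fexp_sum[OF fexp_coef] by blast

section \<open>The total order\<close>

lemma fle_fclass:
  assumes "Ro x" "Ro y"
  shows "fle (fclass x) (fclass y) \<longleftrightarrow> (\<exists>z. is_o z \<and> eventually (\<lambda>t. x t \<le> y t + z t) F0)"
proof
  assume "fle (fclass x) (fclass y)"
  then obtain x' y' z where *: "x' \<in> Rep_fermat (fclass x)" "y' \<in> Rep_fermat (fclass y)"
    "fsim z (\<lambda>t. 0)" "eventually (\<lambda>t. x' t \<le> y' t + z t) F0"
    unfolding fle_def eventually_F0 by blast
  then have o: "is_o (\<lambda>t. x t - x' t)" "is_o (\<lambda>t. y t - y' t)" "is_o z"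
    using assms by (auto simp: Rep_fclass fsim_def)
  \<comment> \<open>A change of representatives costs o(t) on both sides and is absorbed into the
    slack \<open>z\<close>.\<close>
  then have "is_o (\<lambda>t. (x t - x' t) - (y t - y' t) + z t)" by (intro is_o_add[of "\<lambda>t. (x t - x' t) - (y t - y' t)"] is_o_diff[of "\<lambda>t. x t - x' t"])
  moreover have "eventually (\<lambda>t. x t \<le> y t + ((x t - x' t) - (y t - y' t) + z t)) F0"
    using *(4) by eventually_elim auto
  ultimately show "\<exists>z. is_o z \<and> eventually (\<lambda>t. x t \<le> y t + z t) F0" by blast
next
  assume "\<exists>z. is_o z \<and> eventually (\<lambda>t. x t \<le> y t + z t) F0"
  then obtain z where z: "is_o z" "eventually (\<lambda>t. x t \<le> y t + z t) F0" by blast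
  then show "fle (fclass x) (fclass y)"
    unfolding fle_def eventually_F0 using assms
    by (intro bexI[of _ x] bexI[of _ y] exI[of _ z]) (auto simp: Rep_fclass fsim_refl Ro_is_o, simp add: fsim_def)
qed

instantiation fermat :: linordered_ab_group_add
begin

definition "(X::fermat) \<le> Y \<longleftrightarrow> fle X Y"
definition "(X::fermat) < Y \<longleftrightarrow> X \<le> Y \<and> \<not> Y \<le> X"

lemma fclass_le_iff:
  "Ro x \<Longrightarrow> Ro y \<Longrightarrow> fclass x \<le> fclass y \<longleftrightarrow> (\<exists>z. is_o z \<and> eventually (\<lambda>t. x t \<le> y t + z t) F0)"
  by (simp add: less_eq_fermat_def fle_fclass)

lemma fermat_add_left_mono: 
  assumes "X \<le> Y" shows "Z + X \<le> Z + (Y::fermat)"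
proof -
  obtain x y z where [simp]: "Ro x" "Ro y" "Ro z" and X: "X = fclass x" "Y = fclass y" "Z = fclass z"
    using fclass_cases by metis
  show ?thesis using assms by (simp add: X fclass_le_iff fclass_add Ro_add add.assoc)
qed

text \<open>Near 0 a sum of powers has the sign of its leading coefficient, so some representative
  of \<open>X\<close> does not change sign.\<close>

lemma fermat_sign: "0 \<le> X \<or> X \<le> (0::fermat)"
proof -
  let ?r = "coef X"
  let ?E = "{a. ?r a \<noteq> 0}"
  let ?p = "\<lambda>t. \<Sum>b\<in>?E. ?r b * tpow t b"
  have fin: "finite ?E" using finite_coef .
  have sub: "?E \<subseteq> {0..1}" using fexp_range[OF fexp_coef] by blast
  have p: "Ro ?p" "X = fclass ?p" using fexp_pol[OF fexp_coef fin sub] by auto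
  have "eventually (\<lambda>t. 0 \<le> ?p t) F0 \<or> eventually (\<lambda>t. ?p t \<le> 0) F0"
  proof (cases "?E = {}")
    case True
    then show ?thesis by simp
  next
    case False
    define m where "m = Min ?E"
    have m: "m \<in> ?E" unfolding m_def using fin False by (rule Min_in)
    have mm: "?r b = 0" if "b < m" for b using that fin unfolding m_def by (auto dest: Min_le)
    have lim: "((\<lambda>t. ?p t / tpow t m) \<longlongrightarrow> ?r m) (at_right 0)"
      using leading_term[OF fin _ m mm] sub by force
    have tpos: "tpow t m > 0" if "t > 0" for t using that by (auto simp: tpow_def)
    \<comment> \<open>The filter \<open>F0\<close> also sees the point 0, which the limit from the
      right does not control. There only the exponent 0 counts, and its coefficient is either 0 or
      the leading one.\<close>
    have at0: "?p 0 = ?r 0"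
      using fin by (simp add: tpow_zero_base if_distrib[of "\<lambda>x. _ * x"] cong: if_cong)
    have at0m: "?r 0 = 0 \<or> m = 0"
      using m sub mm[of 0] by force
    show ?thesis
    proof (cases "?r m > 0")
      case True
      have "eventually (\<lambda>t. ?p t / tpow t m > 0) (at_right 0)"
        using order_tendstoD(1)[OF lim True] .
      moreover have "eventually (\<lambda>t::real. t > 0) (at_right 0)" by (simp add: eventually_at_right_less)
      ultimately have "eventually (\<lambda>t. 0 \<le> ?p t) (at_right 0)"
        by eventually_elim (use tpos in \<open>force simp: divide_simps split: if_splits\<close>)
      moreover have "0 \<le> ?p 0" using at0 at0m True by auto
      ultimately show ?thesis by (simp add: eventually_F0_iff)
    next
      case F: False
      then have neg: "?r m < 0" using m by simp
      have "eventually (\<lambda>t. ?p t / tpow t m < 0) (at_right 0)"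
        using order_tendstoD(2)[OF lim neg] .
      moreover have "eventually (\<lambda>t::real. t > 0) (at_right 0)" by (simp add: eventually_at_right_less)
      ultimately have "eventually (\<lambda>t. ?p t \<le> 0) (at_right 0)"
        by eventually_elim (use tpos in \<open>force simp: divide_simps split: if_splits\<close>)
      moreover have "?p 0 \<le> 0" using at0 at0m neg by auto
      ultimately show ?thesis by (simp add: eventually_F0_iff)
    qed
  qed
  then have "0 \<le> fclass ?p \<or> fclass ?p \<le> 0"
    unfolding zero_fermat_def fclass_le_iff[OF Ro_const p(1)] fclass_le_iff[OF p(1) Ro_const]
    by (intro disj_forward[OF _ exI[of _ "\<lambda>_. 0"] exI[of _ "\<lambda>_. 0"]]) (auto simp: is_o_zero)
  then show ?thesis using p(2) by metis
qed

instance
proof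
  fix X Y Z :: fermat
  obtain x y z where R [simp]: "Ro x" "Ro y" "Ro z" and X: "X = fclass x" "Y = fclass y" "Z = fclass z"
    using fclass_cases by metis
  show "X < Y \<longleftrightarrow> X \<le> Y \<and> \<not> Y \<le> X" by (simp add: less_fermat_def)
  show "X \<le> X" unfolding X fclass_le_iff[OF R(1) R(1)] by (intro exI[of _ "\<lambda>_. 0"]) (simp add: is_o_zero)
  show "X \<le> Z" if XY: "X \<le> Y" and YZ: "Y \<le> Z"
  proof -
    obtain u v where u: "is_o u" "eventually (\<lambda>t. x t \<le> y t + u t) F0"
      and v: "is_o v" "eventually (\<lambda>t. y t \<le> z t + v t) F0"
      using XY YZ by (auto simp: X fclass_le_iff)
    have "eventually (\<lambda>t. x t \<le> z t + (u t + v t)) F0"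
      using u(2) v(2) by eventually_elim auto
    then show ?thesis using u v is_o_add by (auto simp: X fclass_le_iff)
  qed
  show "X = Y" if XY: "X \<le> Y" and YX: "Y \<le> X"
  proof -
    obtain u v where u: "is_o u" "eventually (\<lambda>t. x t \<le> y t + u t) F0"
      and v: "is_o v" "eventually (\<lambda>t. y t \<le> x t + v t) F0"
      using XY YX by (auto simp: X fclass_le_iff)
    \<comment> \<open>The slacks of the two inequalities together bound the distance of the
      representatives.\<close>
    have "is_o (\<lambda>t. \<bar>u t\<bar> + \<bar>v t\<bar>)"
      using u(1) v(1) by (intro is_o_add) (auto intro: is_o_bound[of _ _ 1])
    moreover have "eventually (\<lambda>t. \<bar>x t - y t\<bar> \<le> 1 * \<bar>\<bar>u t\<bar> + \<bar>v t\<bar>\<bar>) F0"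
      using u(2) v(2) by eventually_elim auto
    ultimately have "is_o (\<lambda>t. x t - y t)" by (rule is_o_bound)
    then show ?thesis by (simp add: X fclass_eq_iff fsim_def)
  qed
  show "Z + X \<le> Z + Y" if "X \<le> Y" using that by (rule fermat_add_left_mono)
  show "X \<le> Y \<or> Y \<le> X"
    using fermat_sign[of "Y - X"] fermat_add_left_mono[of 0 "Y - X" X] fermat_add_left_mono[of "Y - X" 0 X]
    by auto
qed

end

lemma fst_part_mono: "X \<le> Y \<Longrightarrow> st X \<le> st Y"
proof -
  assume XY: "X \<le> Y"
  obtain x y where [simp]: "Ro x" "Ro y" and X: "X = fclass x" "Y = fclass y"
    using fclass_cases by metis
  obtain z where z: "is_o z" "eventually (\<lambda>t. x t \<le> y t + z t) F0"
    using XY by (auto simp: X fclass_le_iff)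
  then show ?thesis using eventually_F0_at_0[OF z(2)] by (simp add: X fst_part_fclass is_o_def)
qed

lemma fst_part_less: "st X < st Y \<Longrightarrow> X < Y"
  using fst_part_mono by (meson linorder_not_le)

lemma fconst_mult_mono:
  assumes "0 \<le> c" "X \<le> Y"
  shows "fconst c * X \<le> fconst c * Y"
proof -
  obtain x y where [simp]: "Ro x" "Ro y" and X: "X = fclass x" "Y = fclass y"
    using fclass_cases by metis
  obtain z where z: "is_o z" "eventually (\<lambda>t. x t \<le> y t + z t) F0"
    using assms by (auto simp: X fclass_le_iff)
  have "eventually (\<lambda>t. c * x t \<le> c * y t + c * z t) F0"
    using z(2)
  proof eventually_elim
    case (elim t)
    show ?case using mult_left_mono[OF elim assms(1)] by (simp add: distrib_left)
  qed
  moreover have "is_o (\<lambda>t. c * z t)"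
    by (rule is_o_bound[OF z(1), of _ c]) (simp add: abs_mult assms(1))
  ultimately show ?thesis
    unfolding X fconst_def fclass_mult[OF Ro_const \<open>Ro x\<close>] fclass_mult[OF Ro_const \<open>Ro y\<close>]
      fclass_le_iff[OF Ro_mult[OF Ro_const \<open>Ro x\<close>] Ro_mult[OF Ro_const \<open>Ro y\<close>]]
    by (intro exI[of _ "\<lambda>t. c * z t"] conjI)
qed

text \<open>The midpoint works. Density is what allows the endpoints of a nonempty bounded interval
  to be recovered from the interval as a set.\<close>

lemma fermat_dense: 
  assumes "X < (Y::fermat)" shows "\<exists>Z. X < Z \<and> Z < Y"
proof -
  define D where "D = fconst (1/2) * (Y - X)"
  have DD: "D + D = Y - X" unfolding D_def
    by (simp flip: distrib_right fconst_add)
  have "0 \<le> D" using fconst_mult_mono[of "1/2" 0 "Y - X"] assms by (simp add: D_def)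
  moreover have "D \<noteq> 0" using DD assms by auto
  ultimately have D: "0 < D" by simp
  have "0 + D < D + D" using D by (rule add_strict_right_mono)
  then have "X + D < X + (D + D)" by (simp del: mult_2 add: add_strict_left_mono)
  also have "X + (D + D) = Y" unfolding DD by simp
  finally have "X + D < Y" .
  then show ?thesis using D by (intro exI[of _ "X + D"]) simp
qed

lemma fst_part_fmonom_1: "st (fmonom 1) = 0"
  by (simp add: fmonom_def fst_part_fclass Ro_tpow tpow_zero_base)

text \<open>The class of \<open>t\<close> is a positive infinitesimal. It serves to move away from
  an excluded endpoint without changing the standard part.\<close>

lemma fmonom_1_pos: "0 < fmonom 1"
proof -
  have "fexp (\<lambda>b. if b = 1 then 1 else 0) (fmonom 1)" using fexp_monom[of 1 1] by simp
  then have "fmonom 1 \<noteq> 0" using fun_cong[OF fexp_unique_0[of "\<lambda>b. if b = 1 then 1 else 0"], of 1] by auto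
  moreover have "0 \<le> fmonom 1"
    unfolding fmonom_def zero_fermat_def fclass_le_iff[OF Ro_const Ro_tpow[of 1, simplified]]
    by (intro exI[of _ "\<lambda>_. 0"]) (auto simp: is_o_zero tpow_def)
  ultimately show ?thesis by simp
qed

section \<open>Smooth functions of real variables\<close>

text \<open>The minimum of finitely many radii; the premise speaks of all smaller radii so that the
  minimum is admissible for every index.\<close>

lemma finite_pos_lower_bound:
  assumes "finite A" "\<And>i. i \<in> A \<Longrightarrow> \<exists>e>0::real. \<forall>e'. 0 < e' \<and> e' \<le> e \<longrightarrow> P i e'"
  shows "\<exists>e>0. \<forall>i\<in>A. P i e"
proof -
  have "\<exists>e>0. \<forall>e'. 0 < e' \<and> e' \<le> e \<longrightarrow> (\<forall>i\<in>A. P i e')"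
    using assms
  proof (induction A rule: finite_induct)
    case empty
    then show ?case by (auto intro: exI[of _ 1])
  next
    case (insert x A)
    have "\<exists>e>0. \<forall>e'. 0 < e' \<and> e' \<le> e \<longrightarrow> (\<forall>i\<in>A. P i e')"
      by (rule insert.IH) (rule insert.prems, rule insertI2)
    then obtain e1 where e1: "e1 > 0" "\<forall>e'. 0 < e' \<and> e' \<le> e1 \<longrightarrow> (\<forall>i\<in>A. P i e')"
      by (elim exE conjE)
    from insert.prems[of x] obtain e2 where "e2 > 0" "\<forall>e'. 0 < e' \<and> e' \<le> e2 \<longrightarrow> P x e'"
      by auto
    with e1 show ?case by (intro exI[of _ "min e1 e2"]) auto
  qed
  then show ?thesis by auto
qed

section \<open>Open sets and continuity in finitely many coordinates\<close>

lemma kopen_kvec: "kopen k W \<Longrightarrow> v \<in> W \<Longrightarrow> kvec k v"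
  unfolding kopen_def by blast

lemma kopenE:
  assumes "kopen k W" "v \<in> W"
  obtains e where "e > 0" "\<forall>w. kvec k w \<longrightarrow> (\<forall>i<k. \<bar>w i - v i\<bar> < e) \<longrightarrow> w \<in> W"
  using assms unfolding kopen_def by blast

lemma kvec_upd: "kvec k v \<Longrightarrow> i < k \<Longrightarrow> kvec k (v(i := s))"
  by (simp add: kvec_def)

lemma kopen_Int: 
  assumes "kopen k V" "kopen k W" shows "kopen k (V \<inter> W)"
  unfolding kopen_def
proof safe
  fix v assume v: "v \<in> V" "v \<in> W"
  from assms(1) v(1) obtain e where eX: "e > 0" "\<forall>w. kvec k w \<longrightarrow> (\<forall>i<k. \<bar>w i - v i\<bar> < e) \<longrightarrow> w \<in> V"
      by (rule kopenE)
    note e = eX(1) eX(2)[rule_format]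
  from assms(2) v(2) obtain e' where e'X: "e' > 0" "\<forall>w. kvec k w \<longrightarrow> (\<forall>i<k. \<bar>w i - v i\<bar> < e') \<longrightarrow> w \<in> W"
      by (rule kopenE)
    note e' = e'X(1) e'X(2)[rule_format]
  show "\<exists>e>0. \<forall>w. kvec k w \<and> (\<forall>i<k. \<bar>w i - v i\<bar> < e) \<longrightarrow> w \<in> V \<inter> W"
    by (rule exI[of _ "min e e'"]) (use e e' in auto)
qed (use assms kopen_kvec in auto)

lemma eventually_upd_in:
  assumes "kopen k W" "v \<in> W" "i < k"
  shows "eventually (\<lambda>s. v(i := s) \<in> W) (nhds (v i))"
proof -
  from assms(1,2) obtain e where eX: "e > 0" "\<forall>w. kvec k w \<longrightarrow> (\<forall>i<k. \<bar>w i - v i\<bar> < e) \<longrightarrow> w \<in> W"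
      by (rule kopenE)
    note e = eX(1) eX(2)[rule_format]
  have "v(i := s) \<in> W" if "dist s (v i) < e" for s
    using that e assms(3) kvec_upd kopen_kvec[OF assms(1,2)] by (intro e(2)) (auto simp: dist_real_def)
  then show ?thesis using e(1) unfolding eventually_nhds_metric by blast
qed

lemma kcontE:
  assumes "kcont k W g" "v \<in> W" "e > 0"
  obtains \<delta> where "\<delta> > 0" "\<forall>w. w \<in> W \<longrightarrow> (\<forall>i<k. \<bar>w i - v i\<bar> < \<delta>) \<longrightarrow> \<bar>g w - g v\<bar> < e"
proof -
  from assms have "\<exists>\<delta>>0. \<forall>w\<in>W. (\<forall>i<k. \<bar>w i - v i\<bar> < \<delta>) \<longrightarrow> \<bar>g w - g v\<bar> < e"
    unfolding kcont_def by simp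
  then show thesis using that by (elim exE conjE) simp
qed

lemma kcont_subset: "kcont k W g \<Longrightarrow> V \<subseteq> W \<Longrightarrow> kcont k V g"
  unfolding kcont_def subset_iff by fast

lemma kcont_imp_continuous_on:
  assumes "kcont k W g"
  shows "continuous_on W g"
  unfolding continuous_on_def tendsto_iff
proof safe
  fix v and e :: real assume v: "v \<in> W" and e: "e > 0"
  with assms obtain \<delta> where \<delta>X: "\<delta> > 0" "\<forall>w. w \<in> W \<longrightarrow> (\<forall>i<k. \<bar>w i - v i\<bar> < \<delta>) \<longrightarrow> \<bar>g w - g v\<bar> < e"
      by (rule kcontE)
    note \<delta> = \<delta>X(1) \<delta>X(2)[rule_format]
  let ?S = "\<Inter>i\<in>{..<k}. {w::nat \<Rightarrow> real. \<bar>w i - v i\<bar> < \<delta>}"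
  have "open ?S"
    by (intro open_INT finite_lessThan ballI open_Collect_less continuous_on_rabs continuous_on_diff
        continuous_on_const continuous_on_product_coordinates)
  moreover have "v \<in> ?S" using \<delta> by simp
  ultimately show "\<forall>\<^sub>F w in at v within W. dist (g w) (g v) < e"
    unfolding eventually_at_topological dist_real_def
    by (intro exI[of _ ?S]) (use \<delta>(2) in auto)
qed

text \<open>A basic neighbourhood in the product topology restricts arbitrary coordinates, but
  vectors in \<open>W\<close> agree beyond \<open>k\<close>, so only the finitely many coordinates
  below \<open>k\<close> matter. Together with the converse this gives access to general results on
  continuous functions.\<close>

lemma continuous_on_imp_kcont:
  assumes "continuous_on W g" "W \<subseteq> {v. kvec k v}"
  shows "kcont k W g"
  unfolding kcont_def
proof safe
  fix v and e :: real assume v: "v \<in> W" and e: "e > 0"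
  have "\<forall>\<^sub>F w in at v within W. dist (g w) (g v) < e"
    using assms(1) v e unfolding continuous_on_def tendsto_iff by blast
  then obtain S where S': "open S" "v \<in> S" "\<forall>w\<in>S. w \<noteq> v \<longrightarrow> w \<in> W \<longrightarrow> \<bar>g w - g v\<bar> < e"
    unfolding eventually_at_topological dist_real_def by (elim exE conjE)
  have S: "open S" "v \<in> S" "\<And>w. w \<in> S \<Longrightarrow> w \<in> W \<Longrightarrow> \<bar>g w - g v\<bar> < e"
    subgoal by fact subgoal by fact subgoal for w using S'(3) e by (cases "w = v") auto done
  have "openin (product_topology (\<lambda>i. euclidean) UNIV) S" 
    unfolding euclidean_product_topology open_openin[symmetric] by (rule S(1))
  from product_topology_open_contains_basis[OF this S(2)] obtain X where
    X: "v \<in> (\<Pi>\<^sub>E i\<in>UNIV. X i)" "\<And>i. open (X i)" "(\<Pi>\<^sub>E i\<in>UNIV. X i) \<subseteq> S" by auto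
  have "\<exists>\<delta>>0. \<forall>i\<in>{..<k}. ball (v i) \<delta> \<subseteq> X i"
  proof (rule finite_pos_lower_bound)
    fix i
    have "v i \<in> X i" using X(1) by auto
    then obtain d where "d > 0" "ball (v i) d \<subseteq> X i" using X(2) open_contains_ball by blast
    then show "\<exists>e>0. \<forall>e'. 0 < e' \<and> e' \<le> e \<longrightarrow> ball (v i) e' \<subseteq> X i"
      by (meson order_trans subset_ball)
  qed simp
  then obtain \<delta> where \<delta>: "\<delta> > 0" "\<And>i. i < k \<Longrightarrow> ball (v i) \<delta> \<subseteq> X i" by auto
  have "\<bar>g w - g v\<bar> < e" if w: "w \<in> W" "\<forall>i<k. \<bar>w i - v i\<bar> < \<delta>" for w
  proof -
    have "w i \<in> X i" for i
    proof (cases "i < k")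
      case True
      then have "w i \<in> ball (v i) \<delta>" using w(2) by (auto simp: dist_real_def abs_minus_commute)
      then show ?thesis using \<delta>(2) True by blast
    next
      case False
      then have "w i = v i" using subsetD[OF assms(2) w(1)] subsetD[OF assms(2) v] by (simp add: kvec_def)
      then show ?thesis using X(1) by auto
    qed
    then have "w \<in> S" using X(3) by auto
    then show ?thesis using S(3) w(1) by blast
  qed
  then show "\<exists>\<delta>>0. \<forall>w\<in>W. (\<forall>i<k. \<bar>w i - v i\<bar> < \<delta>) \<longrightarrow> \<bar>g w - g v\<bar> < e"
    using \<delta>(1) by blast
qed

text \<open>Coinduction for smoothness: it suffices to put \<open>g\<close> into a family of
  continuous functions closed under all partial derivatives. Choosing a derivative inside the family
  along each list of indices produces the system \<open>D\<close> demanded by \<open>cinf\<close>.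
  The closure properties below are obtained by naming a suitable family.\<close>

lemma cinf_coinduct:
  assumes "kopen k W" "g \<in> F" "\<And>g. g \<in> F \<Longrightarrow> kcont k W g"
    and step: "\<And>g i. g \<in> F \<Longrightarrow> i < k \<Longrightarrow>
      \<exists>h\<in>F. \<forall>v\<in>W. ((\<lambda>s. g (v(i := s))) has_real_derivative h v) (at (v i))"
  shows "cinf k W g"
proof -
  define nxt where "nxt i g = (SOME h. h \<in> F \<and>
    (\<forall>v\<in>W. ((\<lambda>s. g (v(i := s))) has_real_derivative h v) (at (v i))))" for i g
  have nxt: "nxt i g \<in> F \<and> (\<forall>v\<in>W. ((\<lambda>s. g (v(i := s))) has_real_derivative nxt i g v) (at (v i)))"
    if "g \<in> F" "i < k" for g i
    using someI_ex[OF step[OF that, unfolded Bex_def]] unfolding nxt_def .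
  define D where "D is = foldr nxt is g" for "is"
  have D: "D is \<in> F" if "set is \<subseteq> {..<k}" for "is"
    using that by (induction "is") (use assms(2) nxt in \<open>auto simp: D_def\<close>)
  have Dc: "D (i # is) = nxt i (D is)" for i "is" by (simp add: D_def)
  show ?thesis
    unfolding cinf_def
  proof (intro conjI exI[of _ D] allI impI ballI)
    show "D [] v = g v" for v by (simp add: D_def)
    fix "is" :: "nat list" and v i assume "set is \<subseteq> {..<k}"
    then have m: "D is \<in> F" by (rule D)
    then show "kcont k W (D is)" by (rule assms(3))
    assume "v \<in> W" "i < k"
    then show "((\<lambda>s. D is (v(i := s))) has_real_derivative D (i # is) v) (at (v i))"
      using nxt[OF m] Dc by simp
  qed (use assms in auto)
qed

section \<open>Partial derivatives and algebra of smooth functions\<close>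

lemma cinf_kopen: "cinf k W c \<Longrightarrow> kopen k W"
  by (simp add: cinf_def)

lemma deriv_cong_kopen:
  assumes "kopen k W" "v \<in> W" "i < k" "\<And>w. w \<in> W \<Longrightarrow> c w = c' w"
  shows "((\<lambda>s. c (v(i := s))) has_real_derivative D) (at (v i)) \<longleftrightarrow>
         ((\<lambda>s. c' (v(i := s))) has_real_derivative D) (at (v i))"
  using eventually_upd_in[OF assms(1-3)]
  by (intro DERIV_cong_ev[OF refl]) (auto elim!: eventually_mono simp: assms(4))

lemma pderiv_k_cong:
  assumes "kopen k W" "v \<in> W" "i < k" "\<And>w. w \<in> W \<Longrightarrow> c w = c' w"
  shows "pderiv_k i c v = pderiv_k i c' v"
  unfolding pderiv_k_def deriv_def
  using deriv_cong_kopen[where c = c and c' = c', OF assms] by presburger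

lemma cinfE:
  assumes "cinf k W c"
  obtains D where "\<And>v. v \<in> W \<Longrightarrow> c v = D [] v"
    "\<And>is. set is \<subseteq> {..<k} \<Longrightarrow> cinf k W (D is)"
    "\<And>is. set is \<subseteq> {..<k} \<Longrightarrow> kcont k W (D is)"
    "\<And>is v i. set is \<subseteq> {..<k} \<Longrightarrow> v \<in> W \<Longrightarrow> i < k \<Longrightarrow> ((\<lambda>s. D is (v(i := s))) has_real_derivative D (i # is) v) (at (v i))"
proof -
  from assms obtain D where D: "kopen k W" "\<And>v. v \<in> W \<Longrightarrow> D [] v = c v"
    "\<And>is. set is \<subseteq> {..<k} \<Longrightarrow> kcont k W (D is)"
    "\<And>is v i. set is \<subseteq> {..<k} \<Longrightarrow> v \<in> W \<Longrightarrow> i < k \<Longrightarrow> ((\<lambda>s. D is (v(i := s))) has_real_derivative D (i # is) v) (at (v i))"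
    unfolding cinf_def by blast
  have "cinf k W (D is)" if "set is \<subseteq> {..<k}" for "is"
  proof (rule cinf_coinduct[OF D(1), where F = "D ` {is. set is \<subseteq> {..<k}}"])
    fix g i assume "g \<in> D ` {is. set is \<subseteq> {..<k}}" "i < k"
    then obtain js where js: "g = D js" "set js \<subseteq> {..<k}" by auto
    show "\<exists>h\<in>D ` {is. set is \<subseteq> {..<k}}. \<forall>v\<in>W. ((\<lambda>s. g (v(i := s))) has_real_derivative h v) (at (v i))"
      using js D(4)[OF js(2)] \<open>i < k\<close> by (intro bexI[of _ "D (i # js)"]) auto
  qed (use that D(3) in auto)
  then show thesis using D by (intro that[of D]) auto
qed

lemma kcont_cong: "(\<And>v. v \<in> W \<Longrightarrow> c v = c' v) \<Longrightarrow> kcont k W c \<longleftrightarrow> kcont k W c'"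
  unfolding kcont_def by (intro ball_cong all_cong ex_cong conj_cong refl) auto

lemma cinf_cong:
  assumes "\<And>v. v \<in> W \<Longrightarrow> c v = c' v"
  shows "cinf k W c \<longleftrightarrow> cinf k W c'"
  unfolding cinf_def using assms
  by (intro conj_cong ex_cong ball_cong refl) simp

lemma cinf_kcont: "cinf k W c \<Longrightarrow> kcont k W c"
  by (elim cinfE) (subst kcont_cong[of W c], auto)

lemma cinf_has_deriv:
  assumes "cinf k W c" "v \<in> W" "i < k"
  shows "((\<lambda>s. c (v(i := s))) has_real_derivative pderiv_k i c v) (at (v i))"
proof -
  from assms(1) obtain D where D: "\<And>v. v \<in> W \<Longrightarrow> c v = D [] v"
    "\<And>is v i. set is \<subseteq> {..<k} \<Longrightarrow> v \<in> W \<Longrightarrow> i < k \<Longrightarrow> ((\<lambda>s. D is (v(i := s))) has_real_derivative D (i # is) v) (at (v i))"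
    by (elim cinfE) blast
  have "((\<lambda>s. c (v(i := s))) has_real_derivative D [i] v) (at (v i))"
    using deriv_cong_kopen[where c = c and c' = "D []", OF cinf_kopen[OF assms(1)] assms(2,3) D(1)] D(2)[of "[]"] assms by simp
  then show ?thesis unfolding pderiv_k_def using DERIV_imp_deriv by metis
qed

lemma pderiv_k_eqI: "((\<lambda>s. c (v(i := s))) has_real_derivative D) (at (v i)) \<Longrightarrow> pderiv_k i c v = D"
  unfolding pderiv_k_def by (rule DERIV_imp_deriv)

lemma cinf_pderiv:
  assumes "cinf k W c" "i < k"
  shows "cinf k W (pderiv_k i c)"
proof -
  from assms(1) obtain D where D: "\<And>v. v \<in> W \<Longrightarrow> c v = D [] v"
    "\<And>is. set is \<subseteq> {..<k} \<Longrightarrow> cinf k W (D is)"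
    "\<And>is v i. set is \<subseteq> {..<k} \<Longrightarrow> v \<in> W \<Longrightarrow> i < k \<Longrightarrow> ((\<lambda>s. D is (v(i := s))) has_real_derivative D (i # is) v) (at (v i))"
    by (elim cinfE) blast
  have "D [i] v = pderiv_k i c v" if "v \<in> W" for v
  proof -
    have "((\<lambda>s. c (v(i := s))) has_real_derivative D [i] v) (at (v i))"
      using deriv_cong_kopen[where c = c and c' = "D []", OF cinf_kopen[OF assms(1)] that assms(2) D(1)] D(3)[of "[]"] assms that by simp
    then show ?thesis by (simp add: pderiv_k_eqI)
  qed
  then have "cinf k W (D [i]) = cinf k W (pderiv_k i c)" by (rule cinf_cong)
  then show ?thesis using D(2)[of "[i]"] assms by simp
qed

lemma cinf_pderiv_iter: "cinf k W c \<Longrightarrow> i < k \<Longrightarrow> cinf k W ((pderiv_k i ^^ n) c)"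
  by (induction n) (auto intro: cinf_pderiv)

lemma cinf_subset:
  assumes "cinf k W c" "V \<subseteq> W" "kopen k V"
  shows "cinf k V c"
proof (rule cinf_coinduct[OF assms(3), where F = "{c. cinf k W c}"])
  show "\<exists>h\<in>{c. cinf k W c}. \<forall>v\<in>V. ((\<lambda>s. g (v(i := s))) has_real_derivative h v) (at (v i))"
    if "g \<in> {c. cinf k W c}" "i < k" for g i
    using that cinf_has_deriv cinf_pderiv assms(2) by (intro bexI[of _ "pderiv_k i g"]) auto
qed (use assms kcont_subset[OF cinf_kcont assms(2)] in auto)

text \<open>The family consists of the functions that are smooth near every point of
  \<open>W\<close>. It is closed under derivatives because \<open>pderiv_k\<close> is one operator
  on functions, with no reference to the neighbourhood. The coefficient functions of a smooth map
  will be seen to be smooth in this way.\<close>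

lemma cinf_local:
  assumes "kopen k W" "\<And>v. v \<in> W \<Longrightarrow> \<exists>V. v \<in> V \<and> cinf k V c"
  shows "cinf k W c"
proof (rule cinf_coinduct[OF assms(1), where F = "{c. \<forall>v\<in>W. \<exists>V. v \<in> V \<and> cinf k V c}"])
  show "kcont k W g" if g: "g \<in> {c. \<forall>v\<in>W. \<exists>V. v \<in> V \<and> cinf k V c}" for g
    unfolding kcont_def
  proof safe
    fix v and e :: real assume v: "v \<in> W" and e: "e > 0"
    from g v obtain V where V: "v \<in> V" "cinf k V g" by blast
    from cinf_kopen[OF V(2)] V(1) obtain d where dX: "d > 0" "\<forall>w. kvec k w \<longrightarrow> (\<forall>i<k. \<bar>w i - v i\<bar> < d) \<longrightarrow> w \<in> V"
      by (rule kopenE)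
    note d = dX(1) dX(2)[rule_format]
    from cinf_kcont[OF V(2)] V(1) e obtain d' where d'X: "d' > 0" "\<forall>w. w \<in> V \<longrightarrow> (\<forall>i<k. \<bar>w i - v i\<bar> < d') \<longrightarrow> \<bar>g w - g v\<bar> < e"
      by (rule kcontE)
    note d' = d'X(1) d'X(2)[rule_format]
    show "\<exists>\<delta>>0. \<forall>w\<in>W. (\<forall>i<k. \<bar>w i - v i\<bar> < \<delta>) \<longrightarrow> \<bar>g w - g v\<bar> < e"
      using d d' kopen_kvec[OF assms(1)] by (intro exI[of _ "min d d'"]) auto
  qed
  show "\<exists>h\<in>{c. \<forall>v\<in>W. \<exists>V. v \<in> V \<and> cinf k V c}. \<forall>v\<in>W. ((\<lambda>s. g (v(i := s))) has_real_derivative h v) (at (v i))"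
    if "g \<in> {c. \<forall>v\<in>W. \<exists>V. v \<in> V \<and> cinf k V c}" "i < k" for g i
  proof (rule bexI[of _ "pderiv_k i g"])
    show "\<forall>v\<in>W. ((\<lambda>s. g (v(i := s))) has_real_derivative pderiv_k i g v) (at (v i))"
      using that cinf_has_deriv[where c = g and i = i] by blast
    show "pderiv_k i g \<in> {c. \<forall>v\<in>W. \<exists>V. v \<in> V \<and> cinf k V c}"
      using that cinf_pderiv[where c = g and i = i and k = k] by blast
  qed
qed (use assms in auto)

text \<open>Derivatives of products are sums of products, so products alone are not a family closed
  under differentiation. The sums and products generated by smooth functions are one.\<close>

inductive_set ring_closure :: "((nat \<Rightarrow> real) \<Rightarrow> real) set \<Rightarrow> ((nat \<Rightarrow> real) \<Rightarrow> real) set" for S where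
  rc_base: "c \<in> S \<Longrightarrow> c \<in> ring_closure S"
| rc_add: "c \<in> ring_closure S \<Longrightarrow> d \<in> ring_closure S \<Longrightarrow> (\<lambda>v. c v + d v) \<in> ring_closure S"
| rc_mult: "c \<in> ring_closure S \<Longrightarrow> d \<in> ring_closure S \<Longrightarrow> (\<lambda>v. c v * d v) \<in> ring_closure S"

lemma cinf_ring_closure:
  assumes "kopen k W" "c \<in> ring_closure {c. cinf k W c}"
  shows "cinf k W c"
proof (rule cinf_coinduct[OF assms])
  fix g assume "g \<in> ring_closure {c. cinf k W c}"
  then have "continuous_on W g"
    by (induction rule: ring_closure.induct)
      (auto intro: continuous_on_add continuous_on_mult kcont_imp_continuous_on[OF cinf_kcont])
  then show "kcont k W g"
    using assms(1) by (intro continuous_on_imp_kcont) (auto simp: kopen_def)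
next
  fix g i assume "g \<in> ring_closure {c. cinf k W c}" and i: "i < k"
  then show "\<exists>h\<in>ring_closure {c. cinf k W c}. \<forall>v\<in>W. ((\<lambda>s. g (v(i := s))) has_real_derivative h v) (at (v i))"
  proof (induction rule: ring_closure.induct)
    case (rc_base c)
    then show ?case using i cinf_has_deriv[of k W c _ i] cinf_pderiv[of k W c i]
      by (intro bexI[of _ "pderiv_k i c"]) (auto simp del: fun_upd_apply intro: ring_closure.rc_base)
  next
    case (rc_add c d)
    then obtain h h' where h: "h \<in> ring_closure {c. cinf k W c}"  "h' \<in> ring_closure {c. cinf k W c}"
      "\<forall>v\<in>W. ((\<lambda>s. c (v(i := s))) has_real_derivative h v) (at (v i))"
      "\<forall>v\<in>W. ((\<lambda>s. d (v(i := s))) has_real_derivative h' v) (at (v i))" by blast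
    then show ?case
      by (intro bexI[of _ "\<lambda>v. h v + h' v"]) (auto simp del: fun_upd_apply intro!: DERIV_add intro: ring_closure.intros)
  next
    case (rc_mult c d)
    then obtain h h' where h: "h \<in> ring_closure {c. cinf k W c}"  "h' \<in> ring_closure {c. cinf k W c}"
      "\<forall>v\<in>W. ((\<lambda>s. c (v(i := s))) has_real_derivative h v) (at (v i))"
      "\<forall>v\<in>W. ((\<lambda>s. d (v(i := s))) has_real_derivative h' v) (at (v i))" by blast
    show ?case
    proof (rule bexI[of _ "\<lambda>v. h v * d v + h' v * c v"])
      show "\<forall>v\<in>W. ((\<lambda>s. c (v(i := s)) * d (v(i := s))) has_real_derivative h v * d v + h' v * c v) (at (v i))"
      proof
        fix v assume "v \<in> W"
        then show "((\<lambda>s. c (v(i := s)) * d (v(i := s))) has_real_derivative h v * d v + h' v * c v) (at (v i))"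
          using DERIV_mult[of "\<lambda>s. c (v(i := s))" "h v" "v i" UNIV "\<lambda>s. d (v(i := s))" "h' v"] h by simp
      qed
    qed (use h rc_mult in \<open>auto intro: ring_closure.intros\<close>)
  qed
qed

lemma cinf_add: "cinf k W c \<Longrightarrow> cinf k W d \<Longrightarrow> cinf k W (\<lambda>v. c v + d v)"
  by (rule cinf_ring_closure) (auto intro: ring_closure.intros cinf_kopen)

lemma cinf_mult: "cinf k W c \<Longrightarrow> cinf k W d \<Longrightarrow> cinf k W (\<lambda>v. c v * d v)"
  by (rule cinf_ring_closure) (auto intro: ring_closure.intros cinf_kopen)

lemma kcont_const: "kcont k W (\<lambda>_. r)"
  unfolding kcont_def by (auto intro: exI[of _ 1])

lemma cinf_const: "kopen k W \<Longrightarrow> cinf k W (\<lambda>_. r)"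
  by (rule cinf_coinduct[where F = "range (\<lambda>r _. r)"]) (auto simp: kcont_const intro!: exI[of _ 0])

lemma cinf_cmult: "cinf k W c \<Longrightarrow> cinf k W (\<lambda>v. r * c v)"
  by (intro cinf_mult cinf_const cinf_kopen)

lemma cinf_diff: "cinf k W c \<Longrightarrow> cinf k W d \<Longrightarrow> cinf k W (\<lambda>v. c v - d v)"
  using cinf_add[OF _ cinf_cmult, of k W c d "-1"] by simp

lemma cinf_sum: "kopen k W \<Longrightarrow> (\<And>i. i \<in> A \<Longrightarrow> cinf k W (c i)) \<Longrightarrow> cinf k W (\<lambda>v. \<Sum>i\<in>A. c i v)"
  by (induction A rule: infinite_finite_induct) (auto intro: cinf_add cinf_const)

lemma cinf_proj:
  assumes "kopen k W" "j < k" shows "cinf k W (\<lambda>v. v j)"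
proof (rule cinf_coinduct[OF assms(1), where F = "insert (\<lambda>v. v j) (range (\<lambda>r _. r))"])
  fix g i assume "g \<in> insert (\<lambda>v::nat\<Rightarrow>real. v j) (range (\<lambda>r _. r))"
  then show "\<exists>h\<in>insert (\<lambda>v. v j) (range (\<lambda>r _. r)). \<forall>v\<in>W. ((\<lambda>s. g (v(i := s))) has_real_derivative h v) (at (v i))"
    by (intro bexI[of _ "\<lambda>_. if i = j \<and> g = (\<lambda>v. v j) then 1 else 0"])
      (auto split: if_splits dest: fun_cong)
next
  have "kcont k W (\<lambda>v. v j)" unfolding kcont_def using assms(2) by blast
  then show "kcont k W g" if "g \<in> insert (\<lambda>v::nat\<Rightarrow>real. v j) (range (\<lambda>r _. r))" for g
    using that by (auto simp: kcont_const)
qed simp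

text \<open>One change of variables for several purposes: freezing or discarding the parameters of a
  local representation, restricting to a coordinate line, and fixing a single coordinate. It is
  polymorphic so that it applies to real and to Fermat vectors alike; \<open>z\<close> is the
  padding beyond \<open>k\<close>.\<close>

definition substv :: "nat \<Rightarrow> nat set \<Rightarrow> (nat \<Rightarrow> 'a) \<Rightarrow> (nat \<Rightarrow> nat) \<Rightarrow> 'a \<Rightarrow> (nat \<Rightarrow> 'a) \<Rightarrow> nat \<Rightarrow> 'a" where
  "substv k A r \<rho> z v = (\<lambda>i. if i < k then if i \<in> A then r i else v (\<rho> i) else z)"

lemma substv_upd_notin:
  assumes "\<And>i. i < k \<Longrightarrow> i \<notin> A \<Longrightarrow> \<rho> i \<noteq> l"
  shows "substv k A r \<rho> z (v(l := s)) = substv k A r \<rho> z v"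
  using assms by (auto simp: substv_def fun_eq_iff)

lemma substv_upd_in:
  assumes "inj_on \<rho> ({..<k} - A)" "i < k" "i \<notin> A"
  shows "substv k A r \<rho> z (v(\<rho> i := s)) = (substv k A r \<rho> z v)(i := s)"
  using assms by (auto simp: substv_def fun_eq_iff inj_on_def)

lemma substv_deriv:
  assumes "cinf k W d" "inj_on \<rho> ({..<k} - A)" "i < k" "i \<notin> A" "substv k A r \<rho> 0 v \<in> W"
  shows "((\<lambda>s. d (substv k A r \<rho> 0 (v(\<rho> i := s)))) has_real_derivative pderiv_k i d (substv k A r \<rho> 0 v)) (at (v (\<rho> i)))"
  using cinf_has_deriv[OF assms(1,5,3)] assms by (simp add: substv_upd_in) (simp add: substv_def)

text \<open>Injectivity of \<open>\<rho>\<close> lets each variable enter at most one coordinate, so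
  the chain rule has at most one term: a partial derivative of the outer function, or 0. The
  composites with smooth functions thus form a family closed under derivatives.\<close>

lemma cinf_substv:
  assumes "cinf k W c" "inj_on \<rho> ({..<k} - A)" "\<rho> ` ({..<k} - A) \<subseteq> {..<n}" "kopen n W'"
    "\<And>v. v \<in> W' \<Longrightarrow> substv k A r \<rho> 0 v \<in> W"
  shows "cinf n W' (\<lambda>v. c (substv k A r \<rho> 0 v))"
proof (rule cinf_coinduct[OF assms(4), where F = "{\<lambda>v. d (substv k A r \<rho> 0 v) |d. cinf k W d}"])
  fix g assume "g \<in> {\<lambda>v. d (substv k A r \<rho> 0 v) |d. cinf k W d}"
  then obtain d where d: "g = (\<lambda>v. d (substv k A r \<rho> 0 v))" "cinf k W d" by blast
  show "kcont n W' g"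
    unfolding kcont_def d
  proof safe
    fix v and e :: real assume v: "v \<in> W'" and e: "e > 0"
    from cinf_kcont[OF d(2)] assms(5)[OF v] e obtain d' where d'X: "d' > 0" "\<forall>w. w \<in> W \<longrightarrow> (\<forall>i<k. \<bar>w i - substv k A r \<rho> 0 v i\<bar> < d') \<longrightarrow> \<bar>d w - d (substv k A r \<rho> 0 v)\<bar> < e"
      by (rule kcontE)
    note d' = d'X(1) d'X(2)[rule_format]
    have "\<bar>d (substv k A r \<rho> 0 w) - d (substv k A r \<rho> 0 v)\<bar> < e" if "w \<in> W'" "\<forall>i<n. \<bar>w i - v i\<bar> < d'" for w
      using that assms(3,5) d'(1) by (intro d'(2)) (auto simp: substv_def)
    then show "\<exists>\<delta>>0. \<forall>w\<in>W'. (\<forall>i<n. \<bar>w i - v i\<bar> < \<delta>) \<longrightarrow> \<bar>d (substv k A r \<rho> 0 w) - d (substv k A r \<rho> 0 v)\<bar> < e"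
      using d'(1) by blast
  qed
  fix l assume l: "l < n"
  show "\<exists>h\<in>{\<lambda>v. d (substv k A r \<rho> 0 v) |d. cinf k W d}. \<forall>v\<in>W'. ((\<lambda>s. g (v(l := s))) has_real_derivative h v) (at (v l))"
  proof (cases "\<exists>i<k. i \<notin> A \<and> \<rho> i = l")
    case True
    then obtain i where i: "i < k" "i \<notin> A" "\<rho> i = l" by blast
    then show ?thesis using substv_deriv[OF d(2) assms(2) i(1,2)] cinf_pderiv[OF d(2) i(1)] assms(5) d
      by (intro bexI[of _ "\<lambda>v. pderiv_k i d (substv k A r \<rho> 0 v)"]) auto
  next
    case False
    then have "substv k A r \<rho> 0 (v(l := s)) = substv k A r \<rho> 0 v" for v s
      by (intro substv_upd_notin) auto
    then show ?thesis using cinf_const[OF cinf_kopen[OF d(2)], of 0] d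
      by (intro bexI[of _ "\<lambda>v. 0"]) auto
  qed
qed (use assms in auto)

lemma pderiv_substv:
  assumes "cinf k W d" "inj_on \<rho> ({..<k} - A)" "i < k" "i \<notin> A" "substv k A r \<rho> 0 v \<in> W"
  shows "pderiv_k (\<rho> i) (\<lambda>v. d (substv k A r \<rho> 0 v)) v = pderiv_k i d (substv k A r \<rho> 0 v)"
  using substv_deriv[OF assms] by (rule pderiv_k_eqI)

section \<open>Open boxes and primitives in one coordinate\<close>

definition obox :: "nat \<Rightarrow> (nat \<Rightarrow> real) \<Rightarrow> (nat \<Rightarrow> real) \<Rightarrow> (nat \<Rightarrow> real) set" where
  "obox k l u = {v. kvec k v \<and> (\<forall>i<k. l i < v i \<and> v i < u i)}"

lemma kopen_obox: "kopen k (obox k l u)"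
  unfolding kopen_def
proof safe
  fix v assume v: "v \<in> obox k l u"
  have "\<exists>e>0. \<forall>i\<in>{..<k}. e \<le> v i - l i \<and> e \<le> u i - v i"
    by (rule finite_pos_lower_bound) (use v in \<open>auto simp: obox_def intro!: exI[of _ "min (v _ - l _) (u _ - v _)"]\<close>)
  then obtain e where "e > 0" "\<And>i. i < k \<Longrightarrow> e \<le> v i - l i \<and> e \<le> u i - v i" by auto
  then show "\<exists>e>0. \<forall>w. kvec k w \<and> (\<forall>i<k. \<bar>w i - v i\<bar> < e) \<longrightarrow> w \<in> obox k l u"
    by (intro exI[of _ e]) (fastforce simp: obox_def abs_less_iff)
qed (simp add: obox_def)

lemma obox_upd: "v \<in> obox k l u \<Longrightarrow> j < k \<Longrightarrow> l j < s \<Longrightarrow> s < u j \<Longrightarrow> v(j := s) \<in> obox k l u"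
  by (auto simp: obox_def kvec_def)

text \<open>Rescaling to the unit interval avoids oriented integrals and a variable limit of integration.\<close>

definition primitive :: "nat \<Rightarrow> real \<Rightarrow> ((nat \<Rightarrow> real) \<Rightarrow> real) \<Rightarrow> (nat \<Rightarrow> real) \<Rightarrow> real" where
  "primitive j r c v = (v j - r) * integral {0..1} (\<lambda>\<theta>. c (v(j := r + \<theta> * (v j - r))))"

lemma segment_between:
  fixes a b r s \<theta> :: real
  assumes "a < r" "r < b" "a < s" "s < b" "\<theta> \<in> {0..1}"
  shows "a < r + \<theta> * (s - r)" "r + \<theta> * (s - r) < b"
proof -
  have "(1 - \<theta>) *\<^sub>R r + \<theta> *\<^sub>R s \<in> {a<..<b}"
    using assms convexD_alt[OF convex_real_interval(8)[of a b], of r s \<theta>] by auto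
  then show "a < r + \<theta> * (s - r)" "r + \<theta> * (s - r) < b" by (auto simp: algebra_simps)
qed

lemma segment_in_obox:
  assumes "v \<in> obox k l u" "j < k" "l j < r" "r < u j" "\<theta> \<in> {0..1}"
  shows "v(j := r + \<theta> * (v j - r)) \<in> obox k l u"
  using assms segment_between[of "l j" r "u j" "v j" \<theta>] by (intro obox_upd) (auto simp: obox_def)

lemma primitive_continuous:
  assumes "continuous_on (obox k l u) c" "j < k" "l j < r" "r < u j"
  shows "continuous_on (obox k l u) (primitive j r c)"
proof -
  have "continuous_on (obox k l u \<times> cbox 0 1) (\<lambda>x. (fst x)(j := r + snd x * (fst x j - r)))"
    apply (rule continuous_on_coordinatewise_then_product)
    subgoal for i by (cases "i = j")
      (auto intro!: continuous_on_add continuous_on_mult continuous_on_diff continuous_on_const continuous_on_snd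
        continuous_on_id continuous_on_product_then_coordinatewise[OF continuous_on_fst[OF continuous_on_id]])
    done
  then have "continuous_on (obox k l u \<times> cbox 0 1) (\<lambda>x. c ((fst x)(j := r + snd x * (fst x j - r))))"
    using assms segment_in_obox by (intro continuous_on_compose2[OF assms(1)]) auto
  then have "continuous_on (obox k l u) (\<lambda>v. integral (cbox 0 1) (\<lambda>\<theta>. c (v(j := r + \<theta> * (v j - r)))))"
    by (intro integral_continuous_on_param) (simp add: split_beta)
  then show ?thesis unfolding primitive_def[abs_def]
    by (intro continuous_intros continuous_on_subset[OF continuous_on_product_coordinates]) auto
qed

lemma kvec_obox: "obox k l u \<subseteq> {v. kvec k v}"
  by (auto simp: obox_def)

lemma continuous_line:
  assumes "continuous_on (obox k l u) c" "v \<in> obox k l u" "j < k" "S \<subseteq> {l j<..<u j}"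
  shows "continuous_on S (\<lambda>s. c (v(j := s)))"
proof (rule continuous_on_compose2[OF assms(1)])
  show "continuous_on S (\<lambda>s. v(j := s))"
    apply (rule continuous_on_coordinatewise_then_product)
    subgoal for i by (cases "i = j") (auto intro!: continuous_intros)
    done
qed (use assms in \<open>auto intro!: obox_upd\<close>)

lemma primitive_deriv_same:
  assumes "continuous_on (obox k l u) c" "j < k" "l j < r" "r < u j" "v \<in> obox k l u"
  shows "((\<lambda>s. primitive j r c (v(j := s))) has_real_derivative c v) (at (v j))"
proof -
  have vj: "l j < v j" "v j < u j" using assms by (auto simp: obox_def)
  \<comment> \<open>\<open>m\<close> and \<open>M\<close> enclose both the base point
    \<open>r\<close> and the point \<open>v j\<close> in the interior of a compact interval, where
    the continuous integrand has an antiderivative.\<close>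
  obtain m where m: "l j < m" "m < min r (v j)" using vj assms dense[of "l j" "min r (v j)"] by auto
  obtain M where M: "max r (v j) < M" "M < u j" using vj assms dense[of "max r (v j)" "u j"] by auto
  have sub: "{m..M} \<subseteq> {l j<..<u j}" using m M by auto
  let ?f = "\<lambda>s. c (v(j := s))"
  have "continuous_on {m..M} ?f"
    using continuous_line[OF assms(1,5,2) sub] .
  then obtain g where g: "\<And>x. x \<in> {m..M} \<Longrightarrow> (g has_vector_derivative ?f x) (at x within {m..M})"
    by (rule antiderivative_continuous) blast
  have gd: "(g has_real_derivative ?f x) (at x)" if "x \<in> {m<..<M}" for x
  proof -
    have "at x within {m..M} = at x"
      using that by (intro at_within_interior) auto
    then show ?thesis using g[of x] that by (simp add: has_real_derivative_iff_has_vector_derivative)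
  qed
  have eq: "primitive j r c (v(j := x)) = g x - g r" if x: "x \<in> {m<..<M}" for x
  proof -
    \<comment> \<open>The fundamental theorem for \<open>g\<close> composed with the parametrisation
      of the segment from \<open>r\<close> to \<open>x\<close>; the factor \<open>x - r\<close> is
      its derivative, and the formula holds for either order of \<open>r\<close> and
      \<open>x\<close>.\<close>
    have "((\<lambda>\<theta>. (x - r) * ?f (r + \<theta> * (x - r))) has_integral g (r + 1 * (x - r)) - g (r + 0 * (x - r))) {0..1}"
    proof (rule fundamental_theorem_of_calculus)
      fix \<theta> :: real assume \<theta>: "\<theta> \<in> {0..1}"
      have "r + \<theta> * (x - r) \<in> {m<..<M}"
        using segment_between[of m r M x \<theta>] x m M \<theta> by auto
      then have "((\<lambda>\<theta>. g (r + \<theta> * (x - r))) has_real_derivative ?f (r + \<theta> * (x - r)) * (x - r)) (at \<theta>)"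
        by (intro DERIV_chain2[OF gd]) (auto intro!: derivative_eq_intros)
      then show "((\<lambda>\<theta>. g (r + \<theta> * (x - r))) has_vector_derivative (x - r) * ?f (r + \<theta> * (x - r))) (at \<theta> within {0..1})"
        by (simp add: has_real_derivative_iff_has_vector_derivative mult.commute has_vector_derivative_at_within)
    qed simp
    then have "integral {0..1} (\<lambda>\<theta>. (x - r) * ?f (r + \<theta> * (x - r))) = g x - g r"
      by (intro integral_unique) simp
    then show ?thesis by (simp add: primitive_def)
  qed
  have "((\<lambda>x. g x - g r) has_real_derivative ?f (v j)) (at (v j))"
    using gd[of "v j"] m M by (auto intro!: derivative_eq_intros)
  moreover have "eventually (\<lambda>x. x \<in> {m<..<M}) (nhds (v j))"
    using m M by (intro eventually_nhds_in_open) auto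
  then have "eventually (\<lambda>x. g x - g r = primitive j r c (v(j := x))) (nhds (v j))"
    by eventually_elim (simp add: eq)
  ultimately show ?thesis
    using DERIV_cong_ev[OF refl, of "\<lambda>x. g x - g r" "\<lambda>x. primitive j r c (v(j := x))" "v j" "c v" "c v"] by simp
qed

text \<open>Differentiation under the integral sign. The interval of integration is fixed and the
  factor \<open>v j - r\<close> does not involve the coordinate \<open>i\<close>, so nothing else
  contributes.\<close>

lemma primitive_deriv_other:
  assumes "cinf k (obox k l u) c" "j < k" "l j < r" "r < u j" "v \<in> obox k l u" "i < k" "i \<noteq> j"
  shows "((\<lambda>s. primitive j r c (v(i := s))) has_real_derivative primitive j r (pderiv_k i c) v) (at (v i))"
proof -
  let ?Q = "obox k l u"
  let ?U = "{l i<..<u i}"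
  let ?p = "\<lambda>x t. v(i := x, j := r + t * (v j - r))"
  have vi: "v i \<in> ?U" using assms by (auto simp: obox_def)
  have inQ: "?p x t \<in> ?Q" if "x \<in> ?U" "t \<in> cbox 0 1" for x t
  proof -
    have "v(i := x) \<in> ?Q" using assms that by (auto intro: obox_upd)
    from segment_in_obox[OF this assms(2-4), of t] show ?thesis using that assms(7) by simp
  qed
  have c: "continuous_on ?Q c" "continuous_on ?Q (pderiv_k i c)"
    using assms(1) cinf_pderiv[OF assms(1,6)] by (auto intro: kcont_imp_continuous_on cinf_kcont)
  have cp: "continuous_on (?U \<times> cbox 0 1) (\<lambda>x. ?p (fst x) (snd x))"
    apply (rule continuous_on_coordinatewise_then_product)
    subgoal for i' by (cases "i' = j"; cases "i' = i") (auto intro!: continuous_intros)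
    done
  have cp2: "continuous_on (cbox 0 1) (\<lambda>t. ?p x t)" for x
    apply (rule continuous_on_coordinatewise_then_product)
    subgoal for i' by (cases "i' = j"; cases "i' = i") (auto intro!: continuous_intros)
    done
  have "((\<lambda>x. integral (cbox 0 1) (\<lambda>t. c (?p x t))) has_real_derivative
      integral (cbox 0 1) (\<lambda>t. pderiv_k i c (?p (v i) t))) (at (v i) within ?U)"
  proof (rule leibniz_rule_field_derivative)
    fix x t :: real assume x: "x \<in> ?U" and t: "t \<in> cbox 0 1"
    have "((\<lambda>s. c ((?p x t)(i := s))) has_real_derivative pderiv_k i c (?p x t)) (at (?p x t i))"
      by (rule cinf_has_deriv[OF assms(1) inQ[OF x t] assms(6)])
    moreover have "(?p x t)(i := s) = ?p s t" for s using assms(7) by auto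
    ultimately show "((\<lambda>x. c (?p x t)) has_real_derivative pderiv_k i c (?p x t)) (at x within ?U)"
      using assms(7) by (simp add: has_field_derivative_at_within)
  next
    fix x assume x: "x \<in> ?U"
    show "(\<lambda>t. c (?p x t)) integrable_on cbox 0 1"
      by (intro integrable_continuous continuous_on_compose2[OF c(1) cp2]) (use inQ[OF x] in auto)
  next
    have "continuous_on (?U \<times> cbox 0 1) (\<lambda>x. pderiv_k i c (?p (fst x) (snd x)))"
      by (intro continuous_on_compose2[OF c(2) cp]) (use inQ in auto)
    then show "continuous_on (?U \<times> cbox 0 1) (\<lambda>(x, t). pderiv_k i c (?p x t))"
      by (simp add: split_beta)
  qed (use vi in auto)
  then have "((\<lambda>x. integral {0..1} (\<lambda>t. c (?p x t))) has_real_derivative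
      integral {0..1} (\<lambda>t. pderiv_k i c (?p (v i) t))) (at (v i))"
    unfolding at_within_open[OF vi open_greaterThanLessThan] by simp
  then have "((\<lambda>x. (v j - r) * integral {0..1} (\<lambda>t. c (?p x t))) has_real_derivative
     (v j - r) * integral {0..1} (\<lambda>t. pderiv_k i c (?p (v i) t))) (at (v i))"
    by (rule DERIV_cmult)
  then show ?thesis using assms(7) by (simp add: primitive_def)
qed

text \<open>Smooth functions together with their primitives form a family closed under derivatives:
  in direction \<open>j\<close> a primitive returns its integrand, in any other direction it becomes
  the primitive of a derivative.\<close>

lemma cinf_primitive:
  assumes "cinf k (obox k l u) c" "j < k" "l j < r" "r < u j"
  shows "cinf k (obox k l u) (primitive j r c)"
proof (rule cinf_coinduct[OF kopen_obox, where F = "{c. cinf k (obox k l u) c} \<union> primitive j r ` {c. cinf k (obox k l u) c}"])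
  fix g assume g: "g \<in> {c. cinf k (obox k l u) c} \<union> primitive j r ` {c. cinf k (obox k l u) c}"
  then show "kcont k (obox k l u) g"
    using primitive_continuous[of k l u _ j r, OF _ assms(2-4)] continuous_on_imp_kcont[OF _ kvec_obox]
      kcont_imp_continuous_on[OF cinf_kcont] cinf_kcont by blast
  fix i assume i: "i < k"
  show "\<exists>h\<in>{c. cinf k (obox k l u) c} \<union> primitive j r ` {c. cinf k (obox k l u) c}.
      \<forall>v\<in>obox k l u. ((\<lambda>s. g (v(i := s))) has_real_derivative h v) (at (v i))"
  proof (cases "cinf k (obox k l u) g")
    case True
    then show ?thesis using i cinf_has_deriv cinf_pderiv by (intro bexI[of _ "pderiv_k i g"]) auto
  next
    case False
    then obtain d where d: "g = primitive j r d" "cinf k (obox k l u) d" using g by blast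
    show ?thesis
    proof (cases "i = j")
      case True
      then show ?thesis
        using primitive_deriv_same[OF kcont_imp_continuous_on[OF cinf_kcont[OF d(2)]] assms(2-4)] d
        by (intro bexI[of _ d]) auto
    next
      case False
      then show ?thesis using primitive_deriv_other[OF d(2) assms(2-4) _ i] cinf_pderiv[OF d(2) i] d
        by (intro bexI[of _ "primitive j r (pderiv_k i d)"]) auto
    qed
  qed
qed (use assms in auto)

lemma pderiv_primitive_same:
  assumes "cinf k (obox k l u) c" "j < k" "l j < r" "r < u j" "v \<in> obox k l u"
  shows "pderiv_k j (primitive j r c) v = c v"
  using primitive_deriv_same[OF kcont_imp_continuous_on[OF cinf_kcont[OF assms(1)]] assms(2-5)] by (rule pderiv_k_eqI)

lemma pderiv_primitive_other:
  assumes "cinf k (obox k l u) c" "j < k" "l j < r" "r < u j" "v \<in> obox k l u" "i < k" "i \<noteq> j"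
  shows "pderiv_k i (primitive j r c) v = primitive j r (pderiv_k i c) v"
  using primitive_deriv_other[OF assms] by (rule pderiv_k_eqI)

lemma pderiv_add:
  assumes "cinf k W c" "cinf k W d" "v \<in> W" "i < k"
  shows "pderiv_k i (\<lambda>v. c v + d v) v = pderiv_k i c v + pderiv_k i d v"
  using cinf_has_deriv[OF assms(1,3,4)] cinf_has_deriv[OF assms(2,3,4)]
  by (intro pderiv_k_eqI DERIV_add)

lemma pderiv_cmult:
  assumes "cinf k W c" "v \<in> W" "i < k"
  shows "pderiv_k i (\<lambda>v. r * c v) v = r * pderiv_k i c v"
  using cinf_has_deriv[OF assms] by (intro pderiv_k_eqI DERIV_cmult)

lemma pderiv_const: "pderiv_k i (\<lambda>v. r) v = 0"
  by (intro pderiv_k_eqI) simp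

lemma pderiv_diff:
  assumes "cinf k W c" "cinf k W d" "v \<in> W" "i < k"
  shows "pderiv_k i (\<lambda>v. c v - d v) v = pderiv_k i c v - pderiv_k i d v"
  using cinf_has_deriv[OF assms(1,3,4)] cinf_has_deriv[OF assms(2,3,4)]
  by (intro pderiv_k_eqI DERIV_diff)

lemma pderiv_zero_imp_const:
  assumes "cinf k (obox k l u) c" "j < k" "\<And>v. v \<in> obox k l u \<Longrightarrow> pderiv_k j c v = 0"
    "v \<in> obox k l u" "l j < s" "s < u j"
  shows "c (v(j := s)) = c v"
proof -
  have "\<exists>K. \<forall>s\<in>{l j<..<u j}. c (v(j := s)) = K"
  proof (rule has_field_derivative_zero_constant)
    fix s assume s: "s \<in> {l j<..<u j}"
    then have m: "v(j := s) \<in> obox k l u" using assms by (auto intro: obox_upd)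
    from cinf_has_deriv[OF assms(1) m assms(2)] assms(3)[OF m]
    show "((\<lambda>s. c (v(j := s))) has_real_derivative 0) (at s within {l j<..<u j})"
      by (simp add: has_field_derivative_at_within)
  qed simp
  then obtain K where K: "\<And>s. s \<in> {l j<..<u j} \<Longrightarrow> c (v(j := s)) = K" by blast
  have "v j \<in> {l j<..<u j}" using assms by (auto simp: obox_def)
  from K[OF this] K[of s] assms show ?thesis by simp
qed

lemma obox_inside:
  assumes "kopen k W" "v \<in> W"
  obtains l u where "v \<in> obox k l u" "obox k l u \<subseteq> W"
proof -
  from assms obtain e where eX: "e > 0" "\<forall>w. kvec k w \<longrightarrow> (\<forall>i<k. \<bar>w i - v i\<bar> < e) \<longrightarrow> w \<in> W"
      by (rule kopenE)
    note e = eX(1) eX(2)[rule_format]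
  show thesis
  proof (rule that)
    show "v \<in> obox k (\<lambda>i. v i - e) (\<lambda>i. v i + e)"
      using kopen_kvec[OF assms] e(1) by (simp add: obox_def)
    show "obox k (\<lambda>i. v i - e) (\<lambda>i. v i + e) \<subseteq> W"
      by (rule subsetI, rule e(2)) (auto simp: obox_def abs_less_iff)
  qed
qed

text \<open>For a primitive in direction \<open>j\<close> the symmetry amounts to differentiation
  under the integral sign. Subtracting from \<open>c\<close> the primitive of its own
  \<open>j\<close>-derivative leaves a function independent of the coordinate \<open>j\<close>, both
  of whose mixed derivatives vanish.\<close>

lemma pderiv_commute:
  assumes "cinf k W c" "i < k" "j < k" "v \<in> W"
  shows "pderiv_k i (pderiv_k j c) v = pderiv_k j (pderiv_k i c) v"
proof (cases "i = j")
  case False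
  from cinf_kopen[OF assms(1)] assms(4) obtain l u where Q: "v \<in> obox k l u" "obox k l u \<subseteq> W"
    by (rule obox_inside)
  let ?Q = "obox k l u"
  have c: "cinf k ?Q c" using assms(1) Q(2) kopen_obox by (rule cinf_subset)
  define r where "r = v j"
  have r: "l j < r" "r < u j" using Q(1) assms(3) by (auto simp: obox_def r_def)
  note cj = cinf_pderiv[OF c assms(3)] and ci = cinf_pderiv[OF c assms(2)]
  note p = cinf_primitive[OF cj assms(3) r]
  \<comment> \<open>\<open>h\<close> represents the value of \<open>c\<close> on the hyperplane
    where the coordinate \<open>j\<close> equals \<open>r\<close>.\<close>
  define h where "h w = c w - primitive j r (pderiv_k j c) w" for w
  have h: "cinf k ?Q h" unfolding h_def[abs_def] using c p by (rule cinf_diff)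
  have hj: "pderiv_k j h w = 0" if "w \<in> ?Q" for w
    unfolding h_def[abs_def] using pderiv_diff[OF c p that assms(3)] pderiv_primitive_same[OF cj assms(3) r that] by simp
  have hc: "h (w(j := s)) = h w" if "w \<in> ?Q" "l j < s" "s < u j" for w s
    using pderiv_zero_imp_const[OF h assms(3) hj that] .
  have hi: "pderiv_k i h (v(j := s)) = pderiv_k i h v" if s: "l j < s" "s < u j" for s
  proof -
    have "eventually (\<lambda>x. h ((v(j := s))(i := x)) = h (v(i := x))) (nhds (v i))"
      using eventually_upd_in[OF kopen_obox Q(1) assms(2)]
    proof eventually_elim
      case (elim x)
      then show ?case using hc[of "v(i := x)" s] s False by (simp add: fun_upd_twist)
    qed
    then have "deriv (\<lambda>x. h ((v(j := s))(i := x))) (v i) = deriv (\<lambda>x. h (v(i := x))) (v i)"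
      by (rule deriv_cong_ev) simp
    then show ?thesis using False by (simp add: pderiv_k_def)
  qed
  have "pderiv_k j (pderiv_k i h) v = 0"
  proof (rule pderiv_k_eqI)
    have "eventually (\<lambda>s. s \<in> {l j<..<u j}) (nhds (v j))"
      using r r_def by (intro eventually_nhds_in_open) auto
    then have "eventually (\<lambda>s. pderiv_k i h (v(j := s)) = pderiv_k i h v) (nhds (v j))"
      by eventually_elim (simp add: hi)
    then show "((\<lambda>s. pderiv_k i h (v(j := s))) has_real_derivative 0) (at (v j))"
      using DERIV_cong_ev[OF refl, of "\<lambda>s. pderiv_k i h (v(j := s))" "\<lambda>s. pderiv_k i h v" "v j" 0 0] by simp
  qed
  moreover have "pderiv_k j (pderiv_k i h) v = pderiv_k j (\<lambda>w. pderiv_k i c w - primitive j r (pderiv_k i (pderiv_k j c)) w) v"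
  proof (rule pderiv_k_cong[OF kopen_obox Q(1) assms(3)])
    fix w assume w: "w \<in> ?Q"
    show "pderiv_k i h w = pderiv_k i c w - primitive j r (pderiv_k i (pderiv_k j c)) w"
      unfolding h_def[abs_def]
      using pderiv_diff[OF c p w assms(2)] pderiv_primitive_other[OF cj assms(3) r w assms(2) False] by simp
  qed
  moreover have "\<dots> = pderiv_k j (pderiv_k i c) v - pderiv_k i (pderiv_k j c) v"
    using pderiv_diff[OF ci cinf_primitive[OF cinf_pderiv[OF cj assms(2)] assms(3) r] Q(1) assms(3)]
      pderiv_primitive_same[OF cinf_pderiv[OF cj assms(2)] assms(3) r Q(1)] by simp
  ultimately show ?thesis by simp
qed simp

lemma pderiv_commute_iter:
  assumes "cinf k W c" "i < k" "j < k" "v \<in> W"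
  shows "pderiv_k i ((pderiv_k j ^^ n) c) v = (pderiv_k j ^^ n) (pderiv_k i c) v"
  using assms(4)
proof (induction n arbitrary: v)
  case (Suc n)
  have "pderiv_k i ((pderiv_k j ^^ Suc n) c) v = pderiv_k j (pderiv_k i ((pderiv_k j ^^ n) c)) v"
    using pderiv_commute[OF cinf_pderiv_iter[OF assms(1,3)] assms(2,3) Suc(2)] by simp
  also have "\<dots> = pderiv_k j ((pderiv_k j ^^ n) (pderiv_k i c)) v"
    using Suc.IH by (intro pderiv_k_cong[OF cinf_kopen[OF assms(1)] Suc(2) assms(3)]) auto
  finally show ?case by simp
qed simp

section \<open>Extension of smooth functions to Fermat reals\<close>

lemma tendsto_F0:
  assumes "(f \<longlongrightarrow> f 0) (at_right 0)"
  shows "((f::real \<Rightarrow> real) \<longlongrightarrow> f 0) F0"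
  using assms unfolding tendsto_iff eventually_F0_iff by simp

lemma lpol_tendsto: "lpol p \<Longrightarrow> (p \<longlongrightarrow> p 0) F0"
proof (induction rule: lpol.induct)
  case (lpol_Cons p a c)
  have "((\<lambda>t. tpow t a) \<longlongrightarrow> tpow 0 a) F0"
  proof (cases "a = 0")
    case False
    then show ?thesis using lpol_Cons tpow_tendsto_0[of a]
      by (intro tendsto_F0) (simp add: tpow_zero_base)
  qed (simp add: tpow_0)
  then show ?case using lpol_Cons by (intro tendsto_add tendsto_mult tendsto_const)
qed simp

lemma is_o_tendsto: "is_o z \<Longrightarrow> (z \<longlongrightarrow> z 0) F0"
proof -
  assume z: "is_o z"
  have "((\<lambda>t::real. t) \<longlongrightarrow> 0) F0" by (rule tendsto_F0) (simp add: tendsto_ident_at)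
  moreover have "eventually (\<lambda>t. \<bar>z t\<bar> \<le> \<bar>t\<bar>) F0"
    using landau_o.smallD[OF z[unfolded is_o_iff], of 1] by simp
  ultimately have "(z \<longlongrightarrow> 0) F0"
    by (intro Lim_null_comparison[of z "\<lambda>t. \<bar>t\<bar>"]) (auto intro: tendsto_rabs_zero)
  then show ?thesis using z by (simp add: is_o_def)
qed

lemma Ro_tendsto: "Ro x \<Longrightarrow> (x \<longlongrightarrow> x 0) F0"
proof -
  assume "Ro x"
  then obtain p where "lpol p" "is_o (\<lambda>t. x t - p t)" unfolding Ro_iff by blast
  then have "((\<lambda>t. (x t - p t) + p t) \<longlongrightarrow> (x 0 - p 0) + p 0) F0"
    using tendsto_add[OF is_o_tendsto[of "\<lambda>t. x t - p t"] lpol_tendsto[of p]] by simp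
  then show ?thesis by simp
qed

lemma tpow_bigo_tpow: "0 \<le> a \<Longrightarrow> a \<le> b \<Longrightarrow> (\<lambda>t. tpow t b) \<in> O[F0](\<lambda>t. tpow t a)"
proof -
  assume ab: "0 \<le> a" "a \<le> b"
  then have "(\<lambda>t. tpow t (b - a) * tpow t a) \<in> O[F0](\<lambda>t. 1 * tpow t a)"
    by (intro landau_o.big.mult_right tpow_bigo) simp
  moreover have "tpow t (b - a) * tpow t a = tpow t b" for t using ab tpow_add[of "b - a" a t] by simp
  ultimately show ?thesis by simp
qed

text \<open>Only positive exponents survive in an increment, and a smallest one dominates. It is
  capped at 1, since the remainder o(t) is not known to be smaller than a multiple of
  \<open>t\<close>.\<close>

lemma Ro_increment_bigo: "Ro x \<Longrightarrow> \<exists>a>0. (\<lambda>t. x t - x 0) \<in> O[F0](\<lambda>t. tpow t a)"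
proof -
  assume "Ro x"
  then obtain p where p: "lpol p" "is_o (\<lambda>t. x t - p t)" unfolding Ro_iff by blast
  have "\<exists>a>0. a \<le> 1 \<and> (\<lambda>t. p t - p 0) \<in> O[F0](\<lambda>t. tpow t a)" using p(1)
  proof (induction rule: lpol.induct)
    case lpol_0
    show ?case by (intro exI[of _ 1]) auto
  next
    case (lpol_Cons p b c)
    then obtain a where a: "a > 0" "a \<le> 1" "(\<lambda>t. p t - p 0) \<in> O[F0](\<lambda>t. tpow t a)" by blast
    define a' where "a' = (if b = 0 then a else min a b)"
    have a': "0 < a'" "a' \<le> a" using a lpol_Cons by (auto simp: a'_def)
    have "(\<lambda>t. c * (tpow t b - tpow 0 b)) \<in> O[F0](\<lambda>t. tpow t a')"
    proof (cases "b = 0")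
      case False
      then have "(\<lambda>t. tpow t b) \<in> O[F0](\<lambda>t. tpow t a')"
        using a' by (intro tpow_bigo_tpow) (auto simp: a'_def)
      then show ?thesis using False by (cases "c = 0") (auto simp: tpow_zero_base)
    qed (simp add: tpow_0)
    moreover have "(\<lambda>t. p t - p 0) \<in> O[F0](\<lambda>t. tpow t a')"
      using a(3) tpow_bigo_tpow[of a' a] a' by (auto intro: landau_o.big_trans)
    ultimately have "(\<lambda>t. c * (tpow t b - tpow 0 b) + (p t - p 0)) \<in> O[F0](\<lambda>t. tpow t a')"
      by (rule sum_in_bigo)
    then show ?case using a a' by (intro exI[of _ a']) (auto simp: algebra_simps)
  qed
  then obtain a where a: "a > 0" "a \<le> 1" "(\<lambda>t. p t - p 0) \<in> O[F0](\<lambda>t. tpow t a)" by blast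
  have "(\<lambda>t. x t - p t) \<in> O[F0](\<lambda>t. t)" using p(2) unfolding is_o_iff by (rule landau_o.small_imp_big)
  also have "(\<lambda>t. t) \<in> O[F0](\<lambda>t. tpow t 1)"
    using eventually_F0_nonneg by (intro bigoI[of _ 1]) (auto elim!: eventually_mono simp: tpow_1)
  also have "(\<lambda>t. tpow t 1) \<in> O[F0](\<lambda>t. tpow t a)" using a by (intro tpow_bigo_tpow) auto
  finally have "(\<lambda>t. (x t - p t) + (p t - p 0)) \<in> O[F0](\<lambda>t. tpow t a)" using a(3) by (rule sum_in_bigo)
  moreover have "x 0 = p 0" using p(2) by (simp add: is_o_def)
  ultimately show ?thesis using a by auto
qed

lemma tpow_power: "0 < a \<Longrightarrow> tpow t a ^ Suc n = tpow t (real (Suc n) * a)"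
proof (induction n)
  case (Suc n)
  then have "tpow t a ^ Suc (Suc n) = tpow t a * tpow t (real (Suc n) * a)" by simp
  also have "\<dots> = tpow t (a + real (Suc n) * a)" using Suc by (subst tpow_add) auto
  finally show ?case by (simp add: algebra_simps)
qed simp

text \<open>If the increment is O(\<open>t^a\<close>) with \<open>a > 0\<close>, a power high enough
  to push the exponent beyond 1 is o(t).\<close>

lemma Ro_increment_nilpotent: "Ro x \<Longrightarrow> \<exists>N. is_o (\<lambda>t. (x t - x 0) ^ Suc N)"
proof -
  assume "Ro x"
  then obtain a where a: "a > 0" "(\<lambda>t. x t - x 0) \<in> O[F0](\<lambda>t. tpow t a)" using Ro_increment_bigo by blast
  obtain N where N: "1 < real N * a" using a(1) reals_Archimedean3 by blast
  have "(\<lambda>t. (x t - x 0) ^ Suc N) \<in> O[F0](\<lambda>t. tpow t a ^ Suc N)" using a(2) by (rule landau_o.big_power)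
  also have "(\<lambda>t. tpow t a ^ Suc N) = (\<lambda>t. tpow t (real (Suc N) * a))" using a(1) tpow_power by blast
  also have "\<dots> \<in> o[F0](\<lambda>t. t)"
    using is_o_tpow[of "real (Suc N) * a"] N a(1) unfolding is_o_iff by (auto simp: algebra_simps)
  finally show ?thesis unfolding is_o_iff by blast
qed

definition nil_part :: "fermat \<Rightarrow> fermat" where
  "nil_part w = w - fconst (st w)"

lemma nil_part_fclass: "Ro x \<Longrightarrow> nil_part (fclass x) ^ n = fclass (\<lambda>t. (x t - x 0) ^ n)"
  by (simp add: nil_part_def fst_part_fclass fconst_def fclass_diff Ro_const fclass_power Ro_diff)

lemma fclass_eq_0_iff: "Ro x \<Longrightarrow> fclass x = 0 \<longleftrightarrow> is_o x"
  unfolding zero_fermat_def by (subst fclass_eq_iff) (auto simp: Ro_const fsim_def)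

lemma nil_part_nilpotent: "\<exists>N. nil_part w ^ Suc N = 0"
proof -
  obtain x where x: "Ro x" "w = fclass x" by (rule fclass_cases)
  obtain N where "is_o (\<lambda>t. (x t - x 0) ^ Suc N)" using Ro_increment_nilpotent[OF x(1)] by blast
  then have "nil_part w ^ Suc N = 0"
    using x Ro_power[OF Ro_diff[OF x(1) Ro_const]] by (simp only: nil_part_fclass fclass_eq_0_iff)
  then show ?thesis by blast
qed

section \<open>Smooth functions along representatives of Fermat points\<close>

definition curve :: "nat \<Rightarrow> (nat \<Rightarrow> real \<Rightarrow> real) \<Rightarrow> real \<Rightarrow> nat \<Rightarrow> real" where
  "curve k xs t = (\<lambda>i. if i < k then xs i t else 0)"

lemma kvec_curve: "kvec k (curve k xs t)"
  by (simp add: kvec_def curve_def)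

lemma curve_near:
  fixes k :: nat
  assumes "\<And>i. i < k \<Longrightarrow> Ro (xs i)" "e > 0"
  shows "eventually (\<lambda>t. \<forall>i<k. \<bar>xs i t - xs i 0\<bar> < e) F0"
proof -
  have "eventually (\<lambda>t. \<forall>i\<in>{..<k}. \<bar>xs i t - xs i 0\<bar> < e) F0"
  proof (rule eventually_ball_finite)
    show "\<forall>i\<in>{..<k}. \<forall>\<^sub>F t in F0. \<bar>xs i t - xs i 0\<bar> < e"
      using assms Ro_tendsto[unfolded tendsto_iff dist_real_def] by auto
  qed simp
  then show ?thesis by (simp add: lessThan_iff Ball_def)
qed

text \<open>Lagrange's form of the remainder in the single coordinate \<open>j\<close>, the others
  moving along with \<open>t\<close>. The derivative of order \<open>N\<close> is bounded near the
  base point, and the power multiplying it is o(t) by assumption.\<close>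

lemma taylor_is_o:
  assumes c: "cinf k W c" and Ro: "\<And>i. i < k \<Longrightarrow> Ro (xs i)" and W: "curve k xs 0 \<in> W" and j: "j < k"
    and N: "is_o (\<lambda>t. (xs j t - xs j 0) ^ N)" "N > 0"
  shows "is_o (\<lambda>t. c (curve k xs t) -
    (\<Sum>n<N. (pderiv_k j ^^ n) c ((curve k xs t)(j := xs j 0)) / fact n * (xs j t - xs j 0) ^ n))"
proof -
  let ?v = "curve k xs 0"
  let ?D = "\<lambda>n. (pderiv_k j ^^ n) c"
  from cinf_kopen[OF c] W obtain e where eX: "e > 0" "\<forall>w. kvec k w \<longrightarrow> (\<forall>i<k. \<bar>w i - ?v i\<bar> < e) \<longrightarrow> w \<in> W"
    by (rule kopenE)
  from cinf_kcont[OF cinf_pderiv_iter[OF c j, of N]] W zero_less_one[where 'a=real] obtain e'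
    where e'X: "e' > 0" "\<forall>w. w \<in> W \<longrightarrow> (\<forall>i<k. \<bar>w i - ?v i\<bar> < e') \<longrightarrow> \<bar>?D N w - ?D N ?v\<bar> < 1"
    by (rule kcontE)
  \<comment> \<open>By continuity with tolerance 1, this bounds the derivative of order
    \<open>N\<close> on the whole segment between the two values of the coordinate.\<close>
  define M where "M = \<bar>?D N ?v\<bar> + 1"
  show ?thesis
  proof (rule is_o_bound[OF N(1)])
    have "eventually (\<lambda>t. \<forall>i<k. \<bar>xs i t - xs i 0\<bar> < min e e') F0"
      using eX(1) e'X(1) by (intro curve_near Ro) auto
    then show "eventually (\<lambda>t. \<bar>c (curve k xs t) - (\<Sum>n<N. ?D n ((curve k xs t)(j := xs j 0)) / fact n * (xs j t - xs j 0) ^ n)\<bar>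
        \<le> M * \<bar>(xs j t - xs j 0) ^ N\<bar>) F0"
    proof eventually_elim
      case (elim t)
      let ?p = "curve k xs t"
      let ?a = "min (xs j 0) (xs j t)" and ?b = "max (xs j 0) (xs j t)"
      have near: "\<bar>(?p(j := s)) i - ?v i\<bar> < min e e'" if "s \<in> {?a..?b}" "i < k" for s i
        using elim[rule_format, OF that(2)] elim[rule_format, OF j] that by (auto simp: curve_def)
      have inW: "?p(j := s) \<in> W" if "s \<in> {?a..?b}" for s
        using near[OF that] eX(2) kvec_upd[OF kvec_curve j] by (metis min_less_iff_conj)
      have bd: "\<bar>?D N (?p(j := s))\<bar> \<le> M" if "s \<in> {?a..?b}" for s
        using near[OF that] inW[OF that] e'X(2) unfolding M_def by (smt (verit, best) min_less_iff_conj)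
      have pj: "?p = ?p(j := xs j t)" using j by (auto simp: curve_def)
      have D: "\<forall>m s. m < N \<and> ?a \<le> s \<and> s \<le> ?b \<longrightarrow>
          ((\<lambda>s. ?D m (?p(j := s))) has_real_derivative ?D (Suc m) (?p(j := s))) (at s)"
        using cinf_has_deriv[OF cinf_pderiv_iter[OF c j] inW j] by auto
      show ?case
      proof (cases "xs j t = xs j 0")
        \<comment> \<open>Taylor's formula needs two distinct points; for equal ones the sum
          collapses to its term of index 0.\<close>
        case True
        then have "(\<Sum>n<N. ?D n (?p(j := xs j 0)) / fact n * (xs j t - xs j 0) ^ n) = (\<Sum>n<N. if n = 0 then c ?p else 0)"
          using pj by (intro sum.cong) auto
        then show ?thesis using N(2) by (simp add: M_def)
      next
        case False
        obtain s where s: "if xs j t < xs j 0 then xs j t < s \<and> s < xs j 0 else xs j 0 < s \<and> s < xs j t"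
          "c (?p(j := xs j t)) = (\<Sum>m<N. ?D m (?p(j := xs j 0)) / fact m * (xs j t - xs j 0) ^ m) +
              ?D N (?p(j := s)) / fact N * (xs j t - xs j 0) ^ N"
          using Taylor[of N "\<lambda>n s. ?D n (?p(j := s))" "\<lambda>s. c (?p(j := s))" ?a ?b "xs j 0" "xs j t", OF N(2) _ D] False
          by auto
        have sab: "s \<in> {?a..?b}" using s(1) by (auto split: if_splits)
        have "\<bar>?D N (?p(j := s)) / fact N\<bar> \<le> \<bar>?D N (?p(j := s))\<bar>"
          by (simp add: divide_le_eq fact_ge_1 mult_left_le_one_le abs_mult mult_ge1_I mult_le_cancel_left1)
        also have "\<dots> \<le> M" using bd[OF sab] .
        finally have "\<bar>?D N (?p(j := s)) / fact N * (xs j t - xs j 0) ^ N\<bar> \<le> M * \<bar>(xs j t - xs j 0) ^ N\<bar>"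
          unfolding abs_mult by (rule mult_right_mono) simp
        then show ?thesis using s(2) pj by simp
      qed
    qed
  qed
qed

lemma curve_upd: "j < k \<Longrightarrow> (curve k xs t)(j := r) = curve k (xs(j := (\<lambda>_. r))) t"
  by (auto simp: curve_def)

text \<open>Coordinates are released one at a time: in \<open>ys m\<close> those below
  \<open>m\<close> follow their curves and the rest stay at their values at 0. Releasing one more is
  a Taylor expansion whose coefficients are derivatives of \<open>c\<close> along the previous
  curve.\<close>

lemma Ro_cinf:
  assumes c: "cinf k W c" and Ro: "\<And>i. i < k \<Longrightarrow> Ro (xs i)" and W: "curve k xs 0 \<in> W"
  shows "Ro (\<lambda>t. c (curve k xs t))"
proof -
  define ys where "ys m i = (if i < m then xs i else (\<lambda>_. xs i 0))" for m i
  have Rys: "Ro (ys m i)" if "i < k" for m i using Ro[OF that] by (simp add: ys_def Ro_const)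
  have W': "curve k (ys m) 0 \<in> W" for m
    using W by (simp add: ys_def curve_def if_distrib[of "\<lambda>f. f 0"] cong: if_cong)
  \<comment> \<open>Quantified over all smooth \<open>c\<close>, because the step applies the
    hypothesis to derivatives of \<open>c\<close>.\<close>
  have "\<forall>c. cinf k W c \<longrightarrow> Ro (\<lambda>t. c (curve k (ys m) t))" if "m \<le> k" for m
    using that
  proof (induction m)
    case 0
    then show ?case by (auto simp: ys_def curve_def Ro_const)
  next
    case (Suc m)
    show ?case
    proof safe
      fix c assume c: "cinf k W c"
      have m: "m < k" using Suc by simp
      obtain N where N: "is_o (\<lambda>t. (ys (Suc m) m t - ys (Suc m) m 0) ^ Suc N)"
        using Ro_increment_nilpotent[OF Rys[OF m]] by blast
      let ?S = "\<lambda>t. \<Sum>n<Suc N. (pderiv_k m ^^ n) c ((curve k (ys (Suc m)) t)(m := ys (Suc m) m 0)) / fact n *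
           (ys (Suc m) m t - ys (Suc m) m 0) ^ n"
      have o: "is_o (\<lambda>t. c (curve k (ys (Suc m)) t) - ?S t)"
        using N by (intro taylor_is_o[OF c Rys W' m]) auto
      have eq: "(curve k (ys (Suc m)) t)(m := ys (Suc m) m 0) = curve k (ys m) t" for t
        using m by (auto simp: curve_def ys_def fun_eq_iff)
      have "Ro ?S"
      proof (rule Ro_sum)
        fix n
        have "Ro (\<lambda>t. (pderiv_k m ^^ n) c (curve k (ys m) t))"
          using Suc cinf_pderiv_iter[OF c m] by simp
        then show "Ro (\<lambda>t. (pderiv_k m ^^ n) c ((curve k (ys (Suc m)) t)(m := ys (Suc m) m 0)) / fact n * (ys (Suc m) m t - ys (Suc m) m 0) ^ n)"
          unfolding eq using Ro_mult[OF Ro_const[of "1 / fact n"]]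
          by (intro Ro_mult Ro_power Ro_diff Rys[OF m] Ro_const) simp
      qed
      then show "Ro (\<lambda>t. c (curve k (ys (Suc m)) t))"
        using Ro_add[OF Ro_is_o[OF o]] by fastforce
    qed
  qed
  moreover have "curve k (ys k) t = curve k xs t" for t by (auto simp: curve_def ys_def)
  ultimately show ?thesis using c by fastforce
qed

lemma fsim_power:
  assumes "fsim x y" "Ro x" "Ro y"
  shows "fsim (\<lambda>t. x t ^ n) (\<lambda>t. y t ^ n)"
proof (induction n)
  case (Suc n)
  then show ?case using fsim_mult[OF assms(1) Suc assms(2) Ro_power[OF assms(3)]] by simp
qed (simp add: fsim_refl)

text \<open>Equivalent representatives have the same value at 0, so both Taylor expansions have the
  same base point and identical coefficients. Only the powers of the increments differ, and these
  are equivalent.\<close>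

lemma cinf_fsim_coord:
  assumes c: "cinf k W c" and Ro: "\<And>i. i < k \<Longrightarrow> Ro (xs i)" and W: "curve k xs 0 \<in> W" and j: "j < k"
    and y: "fsim (xs j) y"
  shows "fsim (\<lambda>t. c (curve k xs t)) (\<lambda>t. c (curve k (xs(j := y)) t))"
proof -
  let ?x = "xs j" and ?ys = "xs(j := y)"
  have Ry: "Ro y" using Ro_fsim[OF Ro[OF j] y] .
  have Rys: "Ro (?ys i)" if "i < k" for i using Ro[OF that] Ry by simp
  have xy0: "?x 0 = y 0" using y by (simp add: fsim_def is_o_def)
  have "curve k ?ys 0 = curve k xs 0" using xy0 by (auto simp: curve_def)
  then have W': "curve k ?ys 0 \<in> W" using W by simp
  obtain N where N: "is_o (\<lambda>t. (?x t - ?x 0) ^ Suc N)" using Ro_increment_nilpotent[OF Ro[OF j]] by blast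
  have pw: "fsim (\<lambda>t. (?x t - ?x 0) ^ n) (\<lambda>t. (y t - y 0) ^ n)" for n
    using y xy0 by (intro fsim_power Ro_diff Ro[OF j] Ry Ro_const) (simp add: fsim_def)
  have N': "is_o (\<lambda>t. (y t - y 0) ^ Suc N)"
    by (rule iffD2[OF is_o_cong is_o_diff[OF N pw[of "Suc N", unfolded fsim_def]]]) simp
  let ?B = "\<lambda>n t. (pderiv_k j ^^ n) c ((curve k xs t)(j := ?x 0)) / fact n"
  have B: "Ro (?B n)" for n
  proof -
    have "curve k (xs(j := (\<lambda>_. ?x 0))) 0 = curve k xs 0" by (auto simp: curve_def)
    then have "Ro (\<lambda>t. (pderiv_k j ^^ n) c (curve k (xs(j := (\<lambda>_. ?x 0))) t))"
      using Ro W by (intro Ro_cinf[OF cinf_pderiv_iter[OF c j]]) (auto simp: Ro_const)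
    then show ?thesis using j Ro_mult[OF Ro_const[of "1 / fact n"]] by (simp add: curve_upd)
  qed
  have eq: "(curve k ?ys t)(j := ?ys j 0) = (curve k xs t)(j := ?x 0)" for t using xy0 by (auto simp: curve_def)
  have 1: "is_o (\<lambda>t. c (curve k xs t) - (\<Sum>n<Suc N. ?B n t * (?x t - ?x 0) ^ n))"
    using N by (intro taylor_is_o[OF c Ro W j]) auto
  have 2: "is_o (\<lambda>t. c (curve k ?ys t) - (\<Sum>n<Suc N. ?B n t * (y t - y 0) ^ n))"
    using taylor_is_o[OF c Rys W' j, of "Suc N"] N' unfolding eq by simp
  have 3: "is_o (\<lambda>t. \<Sum>n<Suc N. ?B n t * ((?x t - ?x 0) ^ n - (y t - y 0) ^ n))"
    using pw[unfolded fsim_def] B by (intro is_o_sum is_o_mult Ro_bigo)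
  show ?thesis
    unfolding fsim_def
    by (rule iffD1[OF is_o_cong is_o_add[OF is_o_diff[OF 1 2] 3]]) (simp only: right_diff_distrib sum_subtractf, simp)
qed

lemma cinf_fsim:
  assumes c: "cinf k W c" and Ro: "\<And>i. i < k \<Longrightarrow> Ro (xs i)" and W: "curve k xs 0 \<in> W"
    and y: "\<And>i. i < k \<Longrightarrow> fsim (xs i) (ys i)"
  shows "fsim (\<lambda>t. c (curve k xs t)) (\<lambda>t. c (curve k ys t))"
proof -
  define zs where "zs m i = (if i < m then ys i else xs i)" for m i
  have Rz: "Ro (zs m i)" if "i < k" for m i using Ro_fsim[OF Ro[OF that] y[OF that]] Ro[OF that] by (simp add: zs_def)
  have xy0: "xs i 0 = ys i 0" if "i < k" for i using y[OF that] by (simp add: fsim_def is_o_def)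
  have "curve k (zs m) 0 = curve k xs 0" for m
    using xy0 by (auto simp: curve_def zs_def)
  then have W': "curve k (zs m) 0 \<in> W" for m using W by simp
  have "fsim (\<lambda>t. c (curve k xs t)) (\<lambda>t. c (curve k (zs m) t))" if "m \<le> k" for m
    using that
  proof (induction m)
    case 0
    then show ?case by (simp add: zs_def fsim_refl)
  next
    case (Suc m)
    have zs: "zs (Suc m) = (zs m)(m := ys m)" by (auto simp: zs_def fun_eq_iff)
    have "fsim (zs m m) (ys m)" using y Suc by (simp add: zs_def)
    then have "fsim (\<lambda>t. c (curve k (zs m) t)) (\<lambda>t. c (curve k (zs (Suc m)) t))"
      unfolding zs using Suc by (intro cinf_fsim_coord[OF c Rz W']) auto
    then show ?case using Suc by (auto intro: fsim_trans)
  qed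
  from this[of k] have "fsim (\<lambda>t. c (curve k xs t)) (\<lambda>t. c (curve k (zs k) t))" by simp
  moreover have "curve k (zs k) t = curve k ys t" for t by (auto simp: curve_def zs_def)
  ultimately show ?thesis by simp
qed

section \<open>The extension of a smooth function to Fermat points\<close>

lemma stv_upd: "j < k \<Longrightarrow> stv k (X(j := w)) = (stv k X)(j := st w)"
  by (auto simp: stv_def)

lemma kvec_stv: "kvec k (stv k X)"
  by (simp add: stv_def kvec_def)

text \<open>Frees \<open>fext\<close> from the representatives chosen in its definition: any others
  yield the same class.\<close>

lemma fext_fclass:
  assumes c: "cinf k W c" and Ro: "\<And>i. i < k \<Longrightarrow> Ro (xs i)" and X: "\<And>i. i < k \<Longrightarrow> X i = fclass (xs i)"
    and W: "stv k X \<in> W"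
  shows "fext k c X = fclass (\<lambda>t. c (curve k xs t))"
proof -
  have s: "fsim (xs i) (frep (X i))" if "i < k" for i
    using frep_fclass[OF Ro[OF that]] X[OF that] by (simp add: fsim_sym)
  have W': "curve k xs 0 \<in> W"
    using W X Ro by (simp add: curve_def stv_def fst_part_fclass cong: if_cong)
  have "fext k c X = fclass (\<lambda>t. c (curve k (\<lambda>i. frep (X i)) t))"
    by (simp add: fext_def curve_def)
  also have "\<dots> = fclass (\<lambda>t. c (curve k xs t))"
    using cinf_fsim[OF c Ro W' s] Ro_cinf[OF c Ro W'] by (intro fclass_eqI[symmetric])
  finally show ?thesis .
qed

lemma fext_frep: "fext k c X = fclass (\<lambda>t. c (curve k (\<lambda>i. frep (X i)) t))"
  by (simp add: fext_def curve_def)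

lemma stv_curve: "stv k X = curve k (\<lambda>i. frep (X i)) 0"
  by (simp add: stv_def curve_def fst_part_def fun_eq_iff)

lemma Ro_fext: "cinf k W c \<Longrightarrow> stv k X \<in> W \<Longrightarrow> Ro (\<lambda>t. c (curve k (\<lambda>i. frep (X i)) t))"
  unfolding stv_curve by (rule Ro_cinf) (auto simp: Ro_frep)

lemma fext_add:
  assumes "cinf k W c" "cinf k W d" "stv k X \<in> W"
  shows "fext k (\<lambda>v. c v + d v) X = fext k c X + fext k d X"
  unfolding fext_frep using Ro_fext[OF assms(1,3)] Ro_fext[OF assms(2,3)] by (simp add: fclass_add)

lemma fext_mult:
  assumes "cinf k W c" "cinf k W d" "stv k X \<in> W"
  shows "fext k (\<lambda>v. c v * d v) X = fext k c X * fext k d X"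
  unfolding fext_frep using Ro_fext[OF assms(1,3)] Ro_fext[OF assms(2,3)] by (simp add: fclass_mult)

lemma fext_const: "fext k (\<lambda>_. r) X = fconst r"
  by (simp add: fext_frep fconst_def)

lemma fext_cmult:
  assumes "cinf k W c" "stv k X \<in> W"
  shows "fext k (\<lambda>v. r * c v) X = fconst r * fext k c X"
  using fext_mult[OF cinf_const[OF cinf_kopen[OF assms(1)]] assms] by (simp add: fext_const)

lemma fext_proj: "j < k \<Longrightarrow> fext k (\<lambda>v. v j) X = X j"
  by (simp add: fext_frep curve_def fclass_frep)

lemma fext_sum:
  assumes "kopen k W" "\<And>l. l \<in> A \<Longrightarrow> cinf k W (c l)" "stv k X \<in> W"
  shows "fext k (\<lambda>v. \<Sum>l\<in>A. c l v) X = (\<Sum>l\<in>A. fext k (c l) X)"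
  using assms(2)
proof (induction A rule: infinite_finite_induct)
  case (insert l A)
  then have "fext k (\<lambda>v. c l v + (\<Sum>l\<in>A. c l v)) X = fext k (c l) X + fext k (\<lambda>v. \<Sum>l\<in>A. c l v) X"
    using assms by (intro fext_add[of k W] cinf_sum) auto
  then show ?case using insert by simp
qed (auto simp: fext_const)

lemma fclass_cong_F0:
  assumes "Ro x" "eventually (\<lambda>t. x t = y t) F0"
  shows "fclass x = fclass y"
proof (rule fclass_eqI[OF assms(1)])
  have "is_o (\<lambda>t. x t - y t) \<longleftrightarrow> is_o (\<lambda>t. 0)"
    using assms(2) by (intro is_o_cong) (auto elim!: eventually_mono)
  then show "fsim x y" by (simp add: fsim_def is_o_zero)
qed

text \<open>For small \<open>t\<close> the representing curve stays in the open set
  \<open>W\<close>, so values of the functions elsewhere are irrelevant to the germ.\<close>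

lemma fext_cong:
  assumes "cinf k W c" "\<And>v. v \<in> W \<Longrightarrow> c v = d v" "stv k X \<in> W"
  shows "fext k c X = fext k d X"
  unfolding fext_frep
proof (rule fclass_cong_F0[OF Ro_fext[OF assms(1,3)]])
  let ?xs = "\<lambda>i. frep (X i)"
  from cinf_kopen[OF assms(1)] assms(3)[unfolded stv_curve] obtain e
    where e: "e > 0" "\<forall>w. kvec k w \<longrightarrow> (\<forall>i<k. \<bar>w i - curve k ?xs 0 i\<bar> < e) \<longrightarrow> w \<in> W"
    by (rule kopenE)
  have "eventually (\<lambda>t. \<forall>i<k. \<bar>?xs i t - ?xs i 0\<bar> < e) F0"
    using e(1) by (intro curve_near Ro_frep)
  then show "\<forall>\<^sub>F t in F0. c (curve k ?xs t) = d (curve k ?xs t)"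
  proof eventually_elim
    case (elim t)
    then have "curve k ?xs t \<in> W" by (intro e(2)[rule_format] kvec_curve) (simp add: curve_def)
    then show ?case using assms(2) by blast
  qed
qed

lemma fext_standardize:
  assumes "cinf k W c" "v \<in> W" "\<And>i. i < k \<Longrightarrow> X i = fconst (v i)"
  shows "fext k c X = fconst (c v)"
proof -
  have v: "kvec k v" using kopen_kvec[OF cinf_kopen[OF assms(1)] assms(2)] .
  then have "stv k X = v" using assms(3) by (auto simp: stv_def kvec_def)
  then have "fext k c X = fclass (\<lambda>t. c (curve k (\<lambda>i t. v i) t))"
    using assms by (intro fext_fclass[OF assms(1)]) (auto simp: Ro_const fconst_def)
  also have "curve k (\<lambda>i t. v i) = (\<lambda>t. v)" using v by (auto simp: curve_def kvec_def fun_eq_iff)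
  finally show ?thesis by (simp add: fconst_def)
qed

lemma fext_arg_cong: "(\<And>i. i < k \<Longrightarrow> X i = Y i) \<Longrightarrow> fext k c X = fext k c Y"
  unfolding fext_def by (intro arg_cong[of _ _ fclass] ext arg_cong[of _ _ c]) auto

text \<open>The o(t) remainder disappears in the quotient, so Taylor's formula becomes an exact
  finite identity. On the right the coordinate \<open>j\<close> occurs only through its standard
  part and through powers of its nilpotent part.\<close>

lemma fext_taylor:
  assumes c: "cinf k W c" and W: "stv k X \<in> W" and j: "j < k" and N: "nil_part (X j) ^ Suc N = 0"
  shows "fext k c X = (\<Sum>n<Suc N. fconst (1 / fact n) * nil_part (X j) ^ n *
     fext k ((pderiv_k j ^^ n) c) (X(j := fconst (st (X j)))))"
proof -
  let ?xs = "\<lambda>i. frep (X i)"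
  let ?ys = "?xs(j := (\<lambda>_. ?xs j 0))"
  let ?X = "X(j := fconst (st (X j)))"
  have Xj: "X j = fclass (?xs j)" by (simp add: fclass_frep)
  have N': "is_o (\<lambda>t. (?xs j t - ?xs j 0) ^ Suc N)"
    using N Ro_power[OF Ro_diff[OF Ro_frep Ro_const]] by (subst (asm) Xj) (simp only: nil_part_fclass fclass_eq_0_iff Ro_frep)
  have 1: "is_o (\<lambda>t. c (curve k ?xs t) - (\<Sum>n<Suc N. (pderiv_k j ^^ n) c ((curve k ?xs t)(j := ?xs j 0)) / fact n * (?xs j t - ?xs j 0) ^ n))"
    using W N' unfolding stv_curve by (intro taylor_is_o[OF c _ _ j]) (auto simp: Ro_frep)
  have W': "stv k ?X \<in> W" using W j by (simp add: stv_upd) (simp add: stv_def fun_upd_idem)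
  have D: "fext k ((pderiv_k j ^^ n) c) ?X = fclass (\<lambda>t. (pderiv_k j ^^ n) c (curve k ?ys t))" for n
    using W' by (intro fext_fclass[OF cinf_pderiv_iter[OF c j]]) (auto simp: Ro_frep Ro_const fclass_frep fconst_def fst_part_def)
  have RD: "Ro (\<lambda>t. (pderiv_k j ^^ n) c (curve k ?ys t))" for n
  proof (rule Ro_cinf[OF cinf_pderiv_iter[OF c j]])
    have "curve k ?ys 0 = curve k ?xs 0" by (auto simp: curve_def)
    then show "curve k ?ys 0 \<in> W" using W unfolding stv_curve by simp
  qed (auto simp: Ro_frep Ro_const)
  have Rd: "Ro (\<lambda>t. (?xs j t - ?xs j 0) ^ n)" for n by (intro Ro_power Ro_diff Ro_frep Ro_const)
  have tm: "fconst (1 / fact n) * nil_part (X j) ^ n * fext k ((pderiv_k j ^^ n) c) ?X =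
     fclass (\<lambda>t. (pderiv_k j ^^ n) c ((curve k ?xs t)(j := ?xs j 0)) / fact n * (?xs j t - ?xs j 0) ^ n)"
    and Rterm: "Ro (\<lambda>t. (pderiv_k j ^^ n) c ((curve k ?xs t)(j := ?xs j 0)) / fact n * (?xs j t - ?xs j 0) ^ n)" for n
  proof -
    have *: "(1 / fact n) * (?xs j t - ?xs j 0) ^ n * (pderiv_k j ^^ n) c (curve k ?ys t) =
       (pderiv_k j ^^ n) c ((curve k ?xs t)(j := ?xs j 0)) / fact n * (?xs j t - ?xs j 0) ^ n" for t
      using j by (simp add: curve_upd)
    have "fconst (1 / fact n) * nil_part (X j) ^ n * fext k ((pderiv_k j ^^ n) c) ?X =
      fclass (\<lambda>t. (1 / fact n) * (?xs j t - ?xs j 0) ^ n * (pderiv_k j ^^ n) c (curve k ?ys t))"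
      unfolding D fconst_def[of "1 / fact n"] nil_part_fclass[OF Ro_frep, of "X j" n, unfolded fclass_frep]
        fclass_mult[OF Ro_const Rd] fclass_mult[OF Ro_mult[OF Ro_const Rd] RD] ..
    then show "fconst (1 / fact n) * nil_part (X j) ^ n * fext k ((pderiv_k j ^^ n) c) ?X =
     fclass (\<lambda>t. (pderiv_k j ^^ n) c ((curve k ?xs t)(j := ?xs j 0)) / fact n * (?xs j t - ?xs j 0) ^ n)"
      unfolding * .
    show "Ro (\<lambda>t. (pderiv_k j ^^ n) c ((curve k ?xs t)(j := ?xs j 0)) / fact n * (?xs j t - ?xs j 0) ^ n)"
      using Ro_mult[OF Ro_mult[OF Ro_const[of "1 / fact n"] Rd[of n]] RD[of n]] unfolding * .
  qed
  have "fext k c X = fclass (\<lambda>t. \<Sum>n<Suc N. (pderiv_k j ^^ n) c ((curve k ?xs t)(j := ?xs j 0)) / fact n * (?xs j t - ?xs j 0) ^ n)"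
    unfolding fext_frep using Ro_fext[OF c W] 1 by (intro fclass_eqI) (auto simp: fsim_def)
  also have "\<dots> = (\<Sum>n<Suc N. fclass (\<lambda>t. (pderiv_k j ^^ n) c ((curve k ?xs t)(j := ?xs j 0)) / fact n * (?xs j t - ?xs j 0) ^ n))"
    by (intro fclass_sum[symmetric] Rterm)
  finally show ?thesis by (simp only: tm)
qed

lemma stv_substv:
  "stv k (substv k A (\<lambda>i. fconst (r i)) \<rho> 0 X) = substv k A r \<rho> 0 (stv n X)"
  if "\<rho> ` ({..<k} - A) \<subseteq> {..<n}"
  using that by (auto simp: stv_def substv_def fun_eq_iff)

lemma fext_substv:
  assumes "cinf k W c" "\<rho> ` ({..<k} - A) \<subseteq> {..<n}" "substv k A r \<rho> 0 (stv n X) \<in> W"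
  shows "fext k c (substv k A (\<lambda>i. fconst (r i)) \<rho> z X) = fext n (\<lambda>v. c (substv k A r \<rho> 0 v)) X"
proof -
  let ?xs = "\<lambda>i. if i \<in> A then (\<lambda>_. r i) else frep (X (\<rho> i))"
  have "fext k c (substv k A (\<lambda>i. fconst (r i)) \<rho> z X) = fext k c (substv k A (\<lambda>i. fconst (r i)) \<rho> 0 X)"
    by (rule fext_arg_cong) (simp add: substv_def)
  also have "\<dots> = fclass (\<lambda>t. c (curve k ?xs t))"
    using assms(3) stv_substv[OF assms(2)]
    by (intro fext_fclass[OF assms(1)]) (auto simp: substv_def Ro_const Ro_frep fclass_frep fconst_def)
  also have "curve k ?xs = (\<lambda>t. substv k A r \<rho> 0 (curve n (\<lambda>i. frep (X i)) t))"
    using assms(2) by (auto simp: curve_def substv_def fun_eq_iff)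
  finally show ?thesis by (simp add: fext_frep)
qed

section \<open>Combinations of smooth functions with Fermat coefficients\<close>

text \<open>A list of pairs \<^term>\<open>(w, c)\<close> represents the function that is the sum of the \<open>w\<close>-multiples of the
  extensions of the smooth functions \<open>c\<close>.\<close>

type_synonym comb = "(fermat \<times> ((nat \<Rightarrow> real) \<Rightarrow> real)) list"

definition ceval :: "nat \<Rightarrow> comb \<Rightarrow> (nat \<Rightarrow> fermat) \<Rightarrow> fermat" where
  "ceval k L X = sum_list (map (\<lambda>(w, c). w * fext k c X) L)"

definition csmooth :: "nat \<Rightarrow> (nat \<Rightarrow> real) set \<Rightarrow> comb \<Rightarrow> bool" where
  "csmooth k W L \<longleftrightarrow> kopen k W \<and> (\<forall>(w, c)\<in>set L. cinf k W c)"

definition cmap :: "(((nat \<Rightarrow> real) \<Rightarrow> real) \<Rightarrow> ((nat \<Rightarrow> real) \<Rightarrow> real)) \<Rightarrow> comb \<Rightarrow> comb" where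
  "cmap F L = map (\<lambda>(w, c). (w, F c)) L"

definition cscale :: "fermat \<Rightarrow> comb \<Rightarrow> comb" where
  "cscale z L = map (\<lambda>(w, c). (z * w, c)) L"

abbreviation cderiv :: "nat \<Rightarrow> comb \<Rightarrow> comb" where
  "cderiv i \<equiv> cmap (pderiv_k i)"

lemma ceval_Nil [simp]: "ceval k [] X = 0"
  by (simp add: ceval_def)

lemma ceval_Cons [simp]: "ceval k (p # L) X = fst p * fext k (snd p) X + ceval k L X"
  by (simp add: ceval_def split_beta)

lemma ceval_append [simp]: "ceval k (L @ L') X = ceval k L X + ceval k L' X"
  by (simp add: ceval_def)

lemma cmap_Nil [simp]: "cmap F [] = []"
  by (simp add: cmap_def)

lemma cmap_Cons [simp]: "cmap F (p # L) = (fst p, F (snd p)) # cmap F L"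
  by (simp add: cmap_def split_beta)

lemma cmap_append [simp]: "cmap F (L @ L') = cmap F L @ cmap F L'"
  by (simp add: cmap_def)

lemma cscale_Nil [simp]: "cscale z [] = []"
  by (simp add: cscale_def)

lemma cscale_Cons [simp]: "cscale z (p # L) = (z * fst p, snd p) # cscale z L"
  by (simp add: cscale_def split_beta)

lemma ceval_cscale [simp]: "ceval k (cscale z L) X = z * ceval k L X"
  by (induction L) (auto simp: algebra_simps)

lemma cmap_cscale [simp]: "cmap F (cscale z L) = cscale z (cmap F L)"
  by (induction L) auto

lemma csmooth_Nil [simp]: "csmooth k W [] \<longleftrightarrow> kopen k W"
  by (simp add: csmooth_def)

lemma csmooth_Cons [simp]: "csmooth k W (p # L) \<longleftrightarrow> cinf k W (snd p) \<and> csmooth k W L"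
  by (auto simp: csmooth_def)

lemma csmooth_kopen: "csmooth k W L \<Longrightarrow> kopen k W"
  by (simp add: csmooth_def)

lemma csmooth_append [simp]: "csmooth k W (L @ L') \<longleftrightarrow> csmooth k W L \<and> csmooth k W L'"
  by (auto simp: csmooth_def)

lemma csmooth_cscale [simp]: "csmooth k W (cscale z L) \<longleftrightarrow> csmooth k W L"
  by (induction L) auto

lemma csmooth_cmap: "csmooth k W L \<Longrightarrow> kopen k' W' \<Longrightarrow> (\<And>c. cinf k W c \<Longrightarrow> cinf k' W' (F c)) \<Longrightarrow> csmooth k' W' (cmap F L)"
  by (induction L) auto

lemma csmooth_cderiv: "csmooth k W L \<Longrightarrow> i < k \<Longrightarrow> csmooth k W (cderiv i L)"
  by (rule csmooth_cmap) (auto intro: cinf_pderiv csmooth_kopen)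

lemma csmooth_subset: "csmooth k W L \<Longrightarrow> V \<subseteq> W \<Longrightarrow> kopen k V \<Longrightarrow> csmooth k V L"
  by (induction L) (auto intro: cinf_subset)

section \<open>Taylor expansion of combinations\<close>

definition nil_index :: "fermat \<Rightarrow> nat" where
  "nil_index w = (SOME N. nil_part w ^ Suc N = 0)"

lemma nil_index: "nil_part w ^ Suc (nil_index w) = 0"
  unfolding nil_index_def using nil_part_nilpotent by (rule someI_ex)

text \<open>Meant to be evaluated with the coordinate \<open>j\<close> replaced by the standard part
  of \<open>b\<close>. The powers of the nilpotent part become Fermat coefficients, and the second
  components remain ordinary real functions.\<close>

definition taylor :: "nat \<Rightarrow> fermat \<Rightarrow> ((nat \<Rightarrow> real) \<Rightarrow> real) \<Rightarrow> comb" where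
  "taylor j b c = map (\<lambda>n. (fconst (1 / fact n) * nil_part b ^ n, (pderiv_k j ^^ n) c)) [0..<Suc (nil_index b)]"

definition ctaylor :: "nat \<Rightarrow> fermat \<Rightarrow> comb \<Rightarrow> comb" where
  "ctaylor j b L = concat (map (\<lambda>(w, c). cscale w (taylor j b c)) L)"

lemma ctaylor_Nil [simp]: "ctaylor j b [] = []"
  by (simp add: ctaylor_def)

lemma ctaylor_Cons [simp]: "ctaylor j b (p # L) = cscale (fst p) (taylor j b (snd p)) @ ctaylor j b L"
  by (simp add: ctaylor_def split_beta)

lemma csmooth_taylor: "cinf k W c \<Longrightarrow> j < k \<Longrightarrow> csmooth k W (taylor j b c)"
  by (auto simp: csmooth_def taylor_def intro: cinf_kopen cinf_pderiv_iter)

lemma csmooth_ctaylor: "csmooth k W L \<Longrightarrow> j < k \<Longrightarrow> csmooth k W (ctaylor j b L)"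
  by (induction L) (auto intro: csmooth_taylor)

lemma ceval_taylor:
  assumes "cinf k W c" "j < k" "stv k X \<in> W" "X j = b"
  shows "ceval k (taylor j b c) (X(j := fconst (st b))) = fext k c X"
  using fext_taylor[OF assms(1,3,2), of "nil_index b"] nil_index[of b] assms(4)
  by (simp add: ceval_def taylor_def o_def interv_sum_list_conv_sum_set_nat atLeast0LessThan del: upt_Suc sum.lessThan_Suc)

lemma ceval_ctaylor:
  assumes "csmooth k W L" "j < k" "stv k X \<in> W" "X j = b"
  shows "ceval k (ctaylor j b L) (X(j := fconst (st b))) = ceval k L X"
  using assms(1) by (induction L) (auto simp: ceval_taylor[OF _ assms(2-4)])

lemma cmap_taylor: "cmap (pderiv_k i) (taylor j b c) = map (\<lambda>n. (fconst (1 / fact n) * nil_part b ^ n, pderiv_k i ((pderiv_k j ^^ n) c))) [0..<Suc (nil_index b)]"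
  by (simp add: cmap_def taylor_def del: upt_Suc)

text \<open>Symmetry of mixed partial derivatives, which holds on \<open>W\<close> only; hence an
  equation between values and not between lists. It ensures that eliminating coordinates respects
  differentiation.\<close>

lemma ceval_cderiv_taylor:
  assumes "cinf k W c" "i < k" "j < k" "stv k X \<in> W"
  shows "ceval k (cderiv i (taylor j b c)) X = ceval k (taylor j b (pderiv_k i c)) X"
proof -
  have "fext k (pderiv_k i ((pderiv_k j ^^ n) c)) X = fext k ((pderiv_k j ^^ n) (pderiv_k i c)) X" for n
    using pderiv_commute_iter[OF assms(1-3)] assms(4)
    by (intro fext_cong[OF cinf_pderiv[OF cinf_pderiv_iter[OF assms(1,3)] assms(2)]]) auto
  then show ?thesis unfolding cmap_taylor by (simp add: ceval_def taylor_def o_def del: upt_Suc)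
qed

lemma ceval_cderiv_ctaylor:
  assumes "csmooth k W L" "i < k" "j < k" "stv k X \<in> W"
  shows "ceval k (cderiv i (ctaylor j b L)) X = ceval k (ctaylor j b (cderiv i L)) X"
  using assms(1) by (induction L) (auto simp: ceval_cderiv_taylor[OF _ assms(2-4)])

definition standardize :: "nat set \<Rightarrow> (nat \<Rightarrow> fermat) \<Rightarrow> nat \<Rightarrow> fermat" where
  "standardize A Y = (\<lambda>i. if i \<in> A then fconst (st (Y i)) else Y i)"

lemma stv_standardize [simp]: "stv k (standardize A Y) = stv k Y"
  by (auto simp: stv_def standardize_def)

text \<open>Taylor expansion in the coordinates of \<open>A\<close>, which are fixed to \<open>q\<close>: the increments are nilpotent, so
  the expansion is finite and its coefficients depend on \<open>q\<close> only. This removes the nonstandard parameters of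
  local representations.\<close>

lemma eliminate:
  assumes "finite A" "A \<subseteq> {..<k}" "csmooth k W L"
  shows "\<exists>L'. csmooth k W L' \<and> (\<forall>Y. stv k Y \<in> W \<and> (\<forall>j\<in>A. Y j = q j) \<longrightarrow>
     ceval k L Y = ceval k L' (standardize A Y) \<and> (\<forall>i<k. ceval k (cderiv i L) Y = ceval k (cderiv i L') (standardize A Y)))"
  using assms(1,2)
proof (induction A rule: finite_induct)
  case empty
  then show ?case using assms(3) by (intro exI[of _ L]) (simp add: standardize_def)
next
  case (insert j A)
  then obtain L1 where L1: "csmooth k W L1" "\<And>Y. stv k Y \<in> W \<Longrightarrow> (\<forall>j\<in>A. Y j = q j) \<Longrightarrow>
     ceval k L Y = ceval k L1 (standardize A Y) \<and> (\<forall>i<k. ceval k (cderiv i L) Y = ceval k (cderiv i L1) (standardize A Y))" by auto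
  have j: "j < k" using insert by simp
  show ?case
  proof (intro exI[of _ "ctaylor j (q j) L1"] conjI allI impI csmooth_ctaylor L1 j; elim conjE)
    fix Y assume Y: "stv k Y \<in> W" "\<forall>j\<in>insert j A. Y j = q j"
    have s: "standardize (insert j A) Y = (standardize A Y)(j := fconst (st (q j)))"
      using Y by (auto simp: standardize_def)
    have sj: "standardize A Y j = q j" using Y insert by (simp add: standardize_def)
    have sW: "stv k (standardize A Y) \<in> W" using Y by simp
    have sW': "stv k (standardize (insert j A) Y) \<in> W" using Y by simp
    show "ceval k L Y = ceval k (ctaylor j (q j) L1) (standardize (insert j A) Y)"
      using L1(2)[OF Y(1)] Y(2) ceval_ctaylor[OF L1(1) j sW sj] unfolding s by simp
    fix i assume i: "i < k"
    show "ceval k (cderiv i L) Y = ceval k (cderiv i (ctaylor j (q j) L1)) (standardize (insert j A) Y)"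
      using L1(2)[OF Y(1)] Y(2) i ceval_ctaylor[OF csmooth_cderiv[OF L1(1) i] j sW sj] ceval_cderiv_ctaylor[OF L1(1) i j sW'] unfolding s by simp
  qed
qed

lemma ceval_substv:
  assumes "csmooth k W L" "\<rho> ` ({..<k} - A) \<subseteq> {..<n}" "substv k A r \<rho> 0 (stv n X) \<in> W"
  shows "ceval k L (substv k A (\<lambda>i. fconst (r i)) \<rho> z X) = ceval n (cmap (\<lambda>c v. c (substv k A r \<rho> 0 v)) L) X"
  using assms(1) by (induction L) (auto simp: fext_substv[OF _ assms(2,3)])

lemma ceval_arg_cong: "(\<And>i. i < k \<Longrightarrow> X i = Y i) \<Longrightarrow> ceval k L X = ceval k L Y"
  by (induction L) (auto simp: fext_arg_cong[of k X Y])

lemma ceval_cderiv_substv: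
  assumes L: "csmooth k W L" and \<rho>: "inj_on \<rho> ({..<k} - A)" "\<rho> ` ({..<k} - A) \<subseteq> {..<n}"
    and W': "kopen n W'" "\<And>v. v \<in> W' \<Longrightarrow> substv k A r \<rho> 0 v \<in> W"
    and i: "i < k" "i \<notin> A" and X: "stv n X \<in> W'"
  shows "ceval k (cderiv i L) (substv k A (\<lambda>i. fconst (r i)) \<rho> z X) =
         ceval n (cderiv (\<rho> i) (cmap (\<lambda>c v. c (substv k A r \<rho> 0 v)) L)) X"
proof -
  have ri: "\<rho> i < n" using \<rho> i by auto
  have "ceval k (cderiv i L) (substv k A (\<lambda>i. fconst (r i)) \<rho> z X) =
      ceval n (cmap (\<lambda>c v. c (substv k A r \<rho> 0 v)) (cderiv i L)) X"
    by (rule ceval_substv[OF csmooth_cderiv[OF L i(1)] \<rho>(2) W'(2)[OF X]])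
  also have "\<dots> = ceval n (cderiv (\<rho> i) (cmap (\<lambda>c v. c (substv k A r \<rho> 0 v)) L)) X"
    using L
  proof (induction L)
    case (Cons p L)
    then have c: "cinf k W (snd p)" by simp
    have "fext n (\<lambda>v. pderiv_k i (snd p) (substv k A r \<rho> 0 v)) X = fext n (pderiv_k (\<rho> i) (\<lambda>v. snd p (substv k A r \<rho> 0 v))) X"
    proof (rule fext_cong[OF _ _ X])
      show "cinf n W' (\<lambda>v. pderiv_k i (snd p) (substv k A r \<rho> 0 v))"
        by (rule cinf_substv[OF cinf_pderiv[OF c i(1)] \<rho> W'])
      show "pderiv_k i (snd p) (substv k A r \<rho> 0 v) = pderiv_k (\<rho> i) (\<lambda>v. snd p (substv k A r \<rho> 0 v)) v" if "v \<in> W'" for v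
        using pderiv_substv[OF c \<rho>(1) i W'(2)[OF that]] by simp
    qed
    then show ?case using Cons by simp
  qed simp
  finally show ?thesis .
qed

lemma csmooth_substv:
  assumes "csmooth k W L" "inj_on \<rho> ({..<k} - A)" "\<rho> ` ({..<k} - A) \<subseteq> {..<n}"
    "kopen n W'" "\<And>v. v \<in> W' \<Longrightarrow> substv k A r \<rho> 0 v \<in> W"
  shows "csmooth n W' (cmap (\<lambda>c v. c (substv k A r \<rho> 0 v)) L)"
  using assms by (intro csmooth_cmap[OF assms(1)] cinf_substv)

section \<open>Local representations versus combinations\<close>

lemma fstar_iff: "X \<in> fstar k V \<longleftrightarrow> fpt k X \<and> stv k X \<in> V"
  by (simp add: fstar_def)

text \<open>Once the parameters are expanded around their standard parts, these real numbers can be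
  frozen into the functions. The clause on derivatives links the combination with
  \<open>fderiv1\<close>, which is defined through \<open>\<alpha>\<close>.\<close>

lemma local_rep_imp_ceval:
  assumes "local_rep n S f V pd P q \<alpha>"
  shows "\<exists>L. csmooth n V L \<and> (\<forall>y\<in>fstar n V \<inter> S. f y = ceval n L y) \<and>
    (\<forall>y\<in>fstar n V. \<forall>i<n. fext (pd + n) (pderiv_k (pd + i) \<alpha>) (catv pd q y) = ceval n (cderiv i L) y)"
proof -
  let ?k = "pd + n" and ?A = "{..<pd}" and ?\<rho> = "\<lambda>i. i - pd"
  let ?W = "{catv pd u v | u v. u \<in> P \<and> v \<in> V}"
  let ?r = "stv pd q"
  have V: "kopen n V" and q: "q \<in> fstar pd P" and \<alpha>: "cinf ?k ?W \<alpha>"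
    and f: "\<And>y. y \<in> fstar n V \<inter> S \<Longrightarrow> f y = fext ?k \<alpha> (catv pd q y)"
    using assms unfolding local_rep_def by blast+
  have \<rho>: "inj_on ?\<rho> ({..<?k} - ?A)" "?\<rho> ` ({..<?k} - ?A) \<subseteq> {..<n}"
    by (auto simp: inj_on_def)
  have ins: "substv ?k ?A ?r ?\<rho> 0 v = catv pd ?r v" if "kvec n v" for v :: "nat \<Rightarrow> real"
    using that by (auto simp: substv_def catv_def kvec_def)
  have inW: "substv ?k ?A ?r ?\<rho> 0 v \<in> ?W" if "v \<in> V" for v
    using that ins[OF kopen_kvec[OF V that]] q by (auto simp: fstar_iff)
  have sma: "csmooth ?k ?W [(1, \<alpha>)]" using \<alpha> cinf_kopen[OF \<alpha>] by simp
  obtain L1 where L1: "csmooth ?k ?W L1" "\<And>Y. stv ?k Y \<in> ?W \<Longrightarrow> (\<forall>j\<in>?A. Y j = q j) \<Longrightarrow>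
     ceval ?k [(1, \<alpha>)] Y = ceval ?k L1 (standardize ?A Y) \<and> (\<forall>i<?k. ceval ?k (cderiv i [(1, \<alpha>)]) Y = ceval ?k (cderiv i L1) (standardize ?A Y))"
    using eliminate[OF _ _ sma, of ?A q] by auto
  let ?L = "cmap (\<lambda>c v. c (substv ?k ?A ?r ?\<rho> 0 v)) L1"
  have main: "fext ?k \<alpha> (catv pd q y) = ceval n ?L y \<and>
      (\<forall>i<n. fext ?k (pderiv_k (pd + i) \<alpha>) (catv pd q y) = ceval n (cderiv i ?L) y)" if y: "y \<in> fstar n V" for y
  proof -
    let ?Y = "catv pd q y"
    have "stv ?k ?Y = catv pd ?r (stv n y)" by (auto simp: stv_def catv_def fun_eq_iff)
    then have YW: "stv ?k ?Y \<in> ?W" using y q by (auto simp: fstar_iff)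
    have Yq: "\<forall>j\<in>?A. ?Y j = q j" by (simp add: catv_def)
    \<comment> \<open>Beyond \<open>?k\<close> both sides are zero: on the left because
      \<open>y\<close> is a point with \<open>n\<close> coordinates, on the right by the
      padding.\<close>
    have st: "standardize ?A ?Y = substv ?k ?A (\<lambda>i. fconst (?r i)) ?\<rho> 0 y"
      using y by (auto simp: standardize_def substv_def catv_def stv_def fun_eq_iff fstar_iff fpt_def fzero_eq)
    have yV: "stv n y \<in> V" using y by (simp add: fstar_iff)
    show ?thesis
    proof (intro conjI allI impI)
      show "fext ?k \<alpha> (catv pd q y) = ceval n ?L y"
        using L1(2)[OF YW Yq] ceval_substv[OF L1(1) \<rho>(2) inW[OF yV], of 0] unfolding st by simp
      fix i assume i: "i < n"
      then show "fext ?k (pderiv_k (pd + i) \<alpha>) (catv pd q y) = ceval n (cderiv i ?L) y"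
        using L1(2)[OF YW Yq] ceval_cderiv_substv[OF L1(1) \<rho> V inW, of "pd + i" y 0] yV unfolding st by simp
    qed
  qed
  have "csmooth n V ?L" by (rule csmooth_substv[OF L1(1) \<rho> V inW])
  then show ?thesis using main f by (intro exI[of _ ?L]) auto
qed

text \<open>The Fermat coefficients themselves become the parameters: \<open>\<alpha>\<close> is
  linear in them, with the real functions as factors, so all of the real space of dimension
  \<open>pd\<close> can serve as parameter domain \<open>P\<close>.\<close>

lemma ceval_imp_local_rep:
  assumes L: "csmooth n V L" and f: "\<And>y. y \<in> fstar n V \<inter> S \<Longrightarrow> f y = ceval n L y"
  shows "\<exists>pd P q \<alpha>. local_rep n S f V pd P q \<alpha>"
proof -
  define pd where "pd = length L"
  let ?k = "pd + n"
  define P where "P = {v. kvec pd v}"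
  define q where "q l = (if l < pd then fst (L ! l) else fzero)" for l
  let ?\<rho> = "\<lambda>i. pd + i"
  define \<alpha> where "\<alpha> v = (\<Sum>l<pd. v l * snd (L ! l) (substv n {} (\<lambda>_. 0) ?\<rho> 0 v))" for v
  let ?W = "{catv pd u v | u v. u \<in> P \<and> v \<in> V}"
  have V: "kopen n V" using L by (rule csmooth_kopen)
  have P: "kopen pd P" unfolding kopen_def P_def by (auto intro!: exI[of _ 1])
  have \<rho>: "inj_on ?\<rho> ({..<n} - {})" "?\<rho> ` ({..<n} - {}) \<subseteq> {..<?k}" by auto
  have ins: "substv n {} (\<lambda>_. 0) ?\<rho> 0 (catv pd u v) = v" if "kvec n v" for u v :: "nat \<Rightarrow> real"
    using that by (auto simp: substv_def catv_def kvec_def)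
  \<comment> \<open>The product domain as a preimage of \<open>V\<close>; in this form its openness
    follows from that of \<open>V\<close> with the same radius.\<close>
  have Weq: "?W = {w. kvec ?k w \<and> substv n {} (\<lambda>_. 0) ?\<rho> 0 w \<in> V}"
  proof safe
    fix u v assume "u \<in> P" "v \<in> V"
    moreover from this have "kvec n v" using kopen_kvec[OF V] by blast
    ultimately show "kvec ?k (catv pd u v)" "substv n {} (\<lambda>_. 0) ?\<rho> 0 (catv pd u v) \<in> V"
      using ins by (auto simp: kvec_def catv_def)
  next
    fix w assume w: "kvec ?k w" "substv n {} (\<lambda>_. 0) ?\<rho> 0 w \<in> V"
    have "w = catv pd (\<lambda>i. if i < pd then w i else 0) (substv n {} (\<lambda>_. 0) ?\<rho> 0 w)"
      using w(1) by (auto simp: catv_def substv_def kvec_def fun_eq_iff)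
    then show "\<exists>u v. w = catv pd u v \<and> u \<in> P \<and> v \<in> V"
      using w(2) by (intro exI[of _ "\<lambda>i. if i < pd then w i else 0"] exI[of _ "substv n {} (\<lambda>_. 0) ?\<rho> 0 w"])
        (auto simp: P_def kvec_def)
  qed
  have W: "kopen ?k ?W"
    unfolding kopen_def Weq
  proof safe
    fix v assume v: "kvec ?k v" "substv n {} (\<lambda>_. 0) ?\<rho> 0 v \<in> V"
    from V v(2) obtain e where e: "e > 0" "\<forall>w. kvec n w \<longrightarrow> (\<forall>i<n. \<bar>w i - substv n {} (\<lambda>_. 0) ?\<rho> 0 v i\<bar> < e) \<longrightarrow> w \<in> V"
      by (rule kopenE)
    show "\<exists>e>0. \<forall>w. kvec ?k w \<and> (\<forall>i<?k. \<bar>w i - v i\<bar> < e) \<longrightarrow> w \<in> {w. kvec ?k w \<and> substv n {} (\<lambda>_. 0) ?\<rho> 0 w \<in> V}"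
    proof (intro exI[of _ e] conjI allI impI)
      fix w assume "kvec ?k w \<and> (\<forall>i<?k. \<bar>w i - v i\<bar> < e)"
      then show "w \<in> {w. kvec ?k w \<and> substv n {} (\<lambda>_. 0) ?\<rho> 0 w \<in> V}"
        using e(2)[rule_format, of "substv n {} (\<lambda>_. 0) ?\<rho> 0 w"] by (auto simp: substv_def kvec_def)
    qed (rule e)
  qed
  have inV: "substv n {} (\<lambda>_. 0) ?\<rho> 0 w \<in> V" if "w \<in> ?W" for w using that unfolding Weq by blast
  have c: "cinf n V (snd (L ! l))" if "l < pd" for l
    using L that nth_mem[of l L] unfolding csmooth_def pd_def by (auto simp: split_beta)
  have ci: "cinf ?k ?W (\<lambda>v. snd (L ! l) (substv n {} (\<lambda>_. 0) ?\<rho> 0 v))" if "l < pd" for l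
    by (rule cinf_substv[OF c[OF that] \<rho> W inV])
  have cl: "cinf ?k ?W (\<lambda>v. v l)" if "l < pd" for l using that by (intro cinf_proj W) simp
  have \<alpha>: "cinf ?k ?W \<alpha>"
    unfolding \<alpha>_def[abs_def] by (intro cinf_sum W cinf_mult ci cl) auto
  have qP: "q \<in> fstar pd P" by (auto simp: fstar_iff fpt_def q_def P_def kvec_stv)
  have "f y = fext ?k \<alpha> (catv pd q y)" if y: "y \<in> fstar n V \<inter> S" for y
  proof -
    let ?Y = "catv pd q y"
    have "stv ?k ?Y = catv pd (stv pd q) (stv n y)" by (auto simp: stv_def catv_def fun_eq_iff)
    then have YW: "stv ?k ?Y \<in> ?W" using y qP by (auto simp: fstar_iff)
    have "fext ?k \<alpha> ?Y = (\<Sum>l<pd. fext ?k (\<lambda>v. v l * snd (L ! l) (substv n {} (\<lambda>_. 0) ?\<rho> 0 v)) ?Y)"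
      unfolding \<alpha>_def[abs_def] by (rule fext_sum[OF W _ YW]) (intro cinf_mult ci cl; simp)
    also have "\<dots> = (\<Sum>l<pd. fst (L ! l) * fext n (snd (L ! l)) y)"
    proof (rule sum.cong[OF refl])
      fix l assume "l \<in> {..<pd}"
      then have l: "l < pd" by simp
      have "fext ?k (\<lambda>v. v l * snd (L ! l) (substv n {} (\<lambda>_. 0) ?\<rho> 0 v)) ?Y =
          fext ?k (\<lambda>v. v l) ?Y * fext ?k (\<lambda>v. snd (L ! l) (substv n {} (\<lambda>_. 0) ?\<rho> 0 v)) ?Y"
        by (rule fext_mult[OF cl[OF l] ci[OF l] YW])
      also have "fext ?k (\<lambda>v. v l) ?Y = fst (L ! l)" using l by (simp add: fext_proj catv_def q_def)
      also have "fext ?k (\<lambda>v. snd (L ! l) (substv n {} (\<lambda>_. 0) ?\<rho> 0 v)) ?Y =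
          fext n (snd (L ! l)) (substv n {} (\<lambda>i. fconst 0) ?\<rho> 0 ?Y)"
        by (rule fext_substv[OF c[OF l] \<rho>(2), symmetric]) (rule inV[OF YW])
      also have "\<dots> = fext n (snd (L ! l)) y"
        by (rule fext_arg_cong) (simp add: substv_def catv_def)
      finally show "fext ?k (\<lambda>v. v l * snd (L ! l) (substv n {} (\<lambda>_. 0) ?\<rho> 0 v)) ?Y = fst (L ! l) * fext n (snd (L ! l)) y" .
    qed
    also have "\<dots> = ceval n L y"
      by (simp add: ceval_def pd_def sum_list_sum_nth atLeast0LessThan split_beta)
    finally show ?thesis using f[OF y] by simp
  qed
  then have "local_rep n S f V pd P q \<alpha>"
    unfolding local_rep_def using V P qP \<alpha> by blast
  then show ?thesis by blast
qed

lemma fsmooth_iff: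
  "fsmooth n S f \<longleftrightarrow> (\<forall>x\<in>S. \<exists>V L. x \<in> fstar n V \<and> csmooth n V L \<and> (\<forall>y\<in>fstar n V \<inter> S. f y = ceval n L y))"
  unfolding fsmooth_def using local_rep_imp_ceval ceval_imp_local_rep by meson

section \<open>Integration in one variable\<close>

text \<open>The real function multiplying \<open>t^a\<close> when every Fermat coefficient in the
  list is expanded in powers of \<open>t\<close>.\<close>

definition ccoef :: "real \<Rightarrow> comb \<Rightarrow> (nat \<Rightarrow> real) \<Rightarrow> real" where
  "ccoef a L v = sum_list (map (\<lambda>(w, c). coef w a * c v) L)"

definition csupport :: "comb \<Rightarrow> real set" where
  "csupport L = (\<Union>(w, c)\<in>set L. {a. coef w a \<noteq> 0})"

lemma finite_csupport [simp]: "finite (csupport L)"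
  by (auto simp: csupport_def finite_coef)

lemma csupport_Cons: "csupport (p # L) = {a. coef (fst p) a \<noteq> 0} \<union> csupport L"
  by (auto simp: csupport_def split_beta)

lemma csupport_cderiv [simp]: "csupport (cmap F L) = csupport L"
  by (auto simp: csupport_def cmap_def split_beta image_iff)

lemma ccoef_Nil: "ccoef a [] = (\<lambda>v. 0)"
  by (simp add: ccoef_def fun_eq_iff)

lemma ccoef_Cons: "ccoef a (p # L) = (\<lambda>v. coef (fst p) a * snd p v + ccoef a L v)"
  by (simp add: ccoef_def fun_eq_iff split_beta)

lemma ccoef_not_supp: "a \<notin> csupport L \<Longrightarrow> ccoef a L v = 0"
  by (induction L) (auto simp: ccoef_Nil ccoef_Cons csupport_Cons)

lemma cinf_ccoef: "csmooth k W L \<Longrightarrow> cinf k W (ccoef a L)"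
proof (induction L)
  case Nil
  then show ?case by (simp add: ccoef_Nil cinf_const)
next
  case (Cons p L)
  then show ?case unfolding ccoef_Cons by (intro cinf_add cinf_cmult) auto
qed

lemma pderiv_ccoef:
  assumes "csmooth k W L" "i < k" "v \<in> W"
  shows "pderiv_k i (ccoef a L) v = ccoef a (cderiv i L) v"
  using assms(1)
proof (induction L)
  case Nil
  then show ?case by (simp add: ccoef_Nil pderiv_const)
next
  case (Cons p L)
  then have c: "cinf k W (snd p)" "csmooth k W L" by auto
  have "pderiv_k i (ccoef a (p # L)) v = coef (fst p) a * pderiv_k i (snd p) v + pderiv_k i (ccoef a L) v"
    unfolding ccoef_Cons using pderiv_add[OF cinf_cmult[OF c(1)] cinf_ccoef[OF c(2)] assms(3,2)]
      pderiv_cmult[OF c(1) assms(3,2)] by simp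
  then show ?case using Cons c by (simp add: ccoef_Cons)
qed

lemma ceval_ccoef:
  assumes "csmooth k W L" "stv k X \<in> W" "finite E" "csupport L \<subseteq> E"
  shows "ceval k L X = (\<Sum>a\<in>E. fmonom a * fext k (ccoef a L) X)"
  using assms(1,4)
proof (induction L)
  case Nil
  then show ?case by (simp add: ccoef_Nil fext_const)
next
  case (Cons p L)
  then have c: "cinf k W (snd p)" "csmooth k W L" and s: "csupport L \<subseteq> E" "\<And>a. a \<notin> E \<Longrightarrow> coef (fst p) a = 0"
    by (auto simp: csupport_Cons)
  have "fext k (ccoef a (p # L)) X = fconst (coef (fst p) a) * fext k (snd p) X + fext k (ccoef a L) X" for a
    unfolding ccoef_Cons using fext_add[OF cinf_cmult[OF c(1)] cinf_ccoef[OF c(2)] assms(2)]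
      fext_cmult[OF c(1) assms(2)] by simp
  then have "(\<Sum>a\<in>E. fmonom a * fext k (ccoef a (p # L)) X) =
     (\<Sum>a\<in>E. fconst (coef (fst p) a) * fmonom a) * fext k (snd p) X + (\<Sum>a\<in>E. fmonom a * fext k (ccoef a L) X)"
    by (simp add: sum_distrib_right sum.distrib distrib_left mult.assoc mult.left_commute)
  also have "(\<Sum>a\<in>E. fconst (coef (fst p) a) * fmonom a) = fst p"
    using coef_expansion[OF assms(3) s(2)] by simp
  finally show ?case using Cons c s by simp
qed

text \<open>At a standard point each extended function takes a real value, so linearity of
  \<open>coef\<close> applies. Consequently the coefficient functions depend on the represented
  function only and not on the chosen combination.\<close>

lemma coef_ceval:
  assumes "csmooth k W L" "v \<in> W" "\<And>i. i < k \<Longrightarrow> X i = fconst (v i)"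
  shows "coef (ceval k L X) a = ccoef a L v"
  using assms(1)
proof (induction L)
  case (Cons p L)
  then have "fext k (snd p) X = fconst (snd p v)" using assms by (intro fext_standardize[of k W]) auto
  then show ?case using Cons coef_scale[of "snd p v" "fst p"] by (simp add: ccoef_Cons coef_add mult.commute)
qed (simp add: ccoef_Nil coef_0)

section \<open>The one-dimensional case and standard points of intervals\<close>

definition vec1 :: "real \<Rightarrow> nat \<Rightarrow> real" where
  "vec1 r = (\<lambda>i. if i = 0 then r else 0)"

definition interval1 :: "real \<Rightarrow> real \<Rightarrow> (nat \<Rightarrow> real) set" where
  "interval1 l u = obox 1 (\<lambda>_. l) (\<lambda>_. u)"

lemma vec1_0 [simp]: "vec1 r 0 = r"
  by (simp add: vec1_def)

lemma vec1_upd [simp]: "(vec1 r)(0 := s) = vec1 s"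
  by (auto simp: vec1_def)

lemma kvec_vec1 [simp]: "kvec (Suc 0) (vec1 r)"
  by (simp add: kvec_def vec1_def)

lemma kvec_1_eq: "kvec (Suc 0) v \<Longrightarrow> v = vec1 (v 0)"
  by (auto simp: kvec_def vec1_def fun_eq_iff)

lemma vec1_in_interval1 [simp]: "vec1 r \<in> interval1 l u \<longleftrightarrow> l < r \<and> r < u"
  by (simp add: interval1_def obox_def)

lemma kopen_interval1: "kopen (Suc 0) (interval1 l u)"
  using kopen_obox[of 1] by (simp add: interval1_def)

lemma interval1_mono: "l' \<le> l \<Longrightarrow> u \<le> u' \<Longrightarrow> interval1 l u \<subseteq> interval1 l' u'"
  by (auto simp: interval1_def obox_def)

lemma stv_pt1 [simp]: "stv (Suc 0) (pt1 x) = vec1 (st x)"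
  by (auto simp: stv_def vec1_def pt1_def fun_eq_iff)

lemma pt1_in_fstar: "pt1 x \<in> fstar (Suc 0) V \<longleftrightarrow> vec1 (st x) \<in> V"
  unfolding fstar_iff stv_pt1 by (simp add: fpt_def pt1_def)

lemma pt1_0 [simp]: "pt1 x 0 = x"
  by (simp add: pt1_def)

text \<open>\<open>T\<close> plays the role of the set of standard points in the interior of \<open>J\<close>. A combination that vanishes on
  these points has vanishing real coefficient functions there, hence all their derivatives vanish up to the
  boundary; this makes derivatives on \<open>J\<close> well defined.\<close>

definition standard_core :: "fermat set \<Rightarrow> real set \<Rightarrow> bool" where
  "standard_core J T \<longleftrightarrow> open T \<and> convex T \<and> T \<noteq> {} \<and> (\<forall>r\<in>T. fconst r \<in> J) \<and> (\<forall>x\<in>J. st x \<in> closure T)"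

lemma standard_core_near:
  assumes "standard_core J T" "x \<in> J" "e > 0"
  obtains r where "r \<in> T" "\<bar>r - st x\<bar> < e"
  using assms closure_approachable[of "st x" T] unfolding standard_core_def dist_real_def by blast

lemma standard_core_between:
  assumes "standard_core J T" "x \<in> J" "y \<in> J" "st x < q" "q < st y"
  shows "q \<in> T"
proof -
  obtain r where r: "r \<in> T" "\<bar>r - st x\<bar> < q - st x" using standard_core_near[OF assms(1,2), of "q - st x"] assms by auto
  obtain s where s: "s \<in> T" "\<bar>s - st y\<bar> < st y - q" using standard_core_near[OF assms(1,3), of "st y - q"] assms by auto
  have "is_interval T" using assms(1) by (simp add: standard_core_def is_interval_convex_1)
  then show ?thesis using r s mem_is_interval_1_I[of T r s q] by auto
qed

lemma standard_core_st_interval: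
  assumes "standard_core J T" "x \<in> J" "y \<in> J" "st x \<le> q" "q \<le> st y"
  shows "\<exists>z\<in>J. st z = q"
proof (cases "q = st x \<or> q = st y")
  case True
  then show ?thesis using assms by auto
next
  case False
  then have "q \<in> T" using assms by (intro standard_core_between[OF assms(1-3)]) auto
  then show ?thesis using assms(1) by (intro bexI[of _ "fconst q"]) (auto simp: standard_core_def)
qed

lemma xle_st: "xle a b \<Longrightarrow> xst a \<le> xst b"
  by (cases a; cases b) (auto simp flip: less_eq_fermat_def intro: fst_part_mono)

lemma xlt_st: "xst a < xst b \<Longrightarrow> xlt a b"
  by (cases a; cases b) (auto simp: xlt_def less_imp_le simp flip: less_eq_fermat_def dest: fst_part_less)

text \<open>\<open>T\<close> is the open real interval between the standard parts of the endpoints.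
  It is nonempty because the interval is non-infinitesimal, and a real number strictly inside
  belongs to \<open>J\<close> whichever endpoints are included.\<close>

lemma noninf_interval_standard_core:
  assumes "noninf_interval J"
  shows "\<exists>T. standard_core J T"
proof -
  obtain a b lc rc where J: "J = ivl a b lc rc" and ab: "xst a < xst b"
    using assms unfolding noninf_interval_def by blast
  define T where "T = {r. xst a < ereal r \<and> ereal r < xst b}"
  have "open T" unfolding T_def
    by (intro open_Collect_conj open_Collect_less continuous_intros continuous_on_ereal)
  moreover have cv: "convex T"
    unfolding is_interval_convex_1[symmetric] is_interval_1
  proof safe
    fix p q r assume "p \<in> T" "q \<in> T" "p \<le> r" "r \<le> q"
    then show "r \<in> T" using less_le_trans[of "xst a" "ereal p" "ereal r"] le_less_trans[of "ereal r" "ereal q" "xst b"]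
      by (simp add: T_def)
  qed
  moreover have ne: "T \<noteq> {}" using ereal_dense2[OF ab] unfolding T_def by auto
  moreover have "fconst r \<in> J" if "r \<in> T" for r
  proof -
    have "xlt a (Fin (fconst r))" "xlt (Fin (fconst r)) b" using that by (auto simp: T_def intro: xlt_st)
    then show ?thesis unfolding J ivl_def by (auto simp: xlt_def)
  qed
  moreover have "st x \<in> closure T" if "x \<in> J" for x
  proof -
    have x: "xst a \<le> ereal (st x)" "ereal (st x) \<le> xst b"
      using that xle_st[of a "Fin x"] xle_st[of "Fin x" b] unfolding J ivl_def by (auto simp: xlt_def split: if_splits)
    obtain z where z: "z \<in> T" using ne by blast
    \<comment> \<open>The standard part of a point of \<open>J\<close> may be an endpoint of
      \<open>T\<close>; it is approached along the segment from a fixed inner point.\<close>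
    have seg: "open_segment (st x) z \<subseteq> T"
    proof
      fix y assume y: "y \<in> open_segment (st x) z"
      then consider "st x < y" "y < z" | "z < y" "y < st x"
        by (auto simp: open_segment_eq_real_ivl split: if_splits)
      then show "y \<in> T"
      proof cases
        case 1
        then have "ereal (st x) < ereal y" "ereal y < ereal z" by auto
        then show ?thesis using x z le_less_trans[of "xst a" "ereal (st x)" "ereal y"] less_trans[of "ereal y" "ereal z" "xst b"] by (simp add: T_def)
      next
        case 2
        then have "ereal z < ereal y" "ereal y < ereal (st x)" by auto
        then show ?thesis using x z less_trans[of "xst a" "ereal z" "ereal y"] less_le_trans[of "ereal y" "ereal (st x)" "xst b"] by (simp add: T_def)
      qed
    qed
    show ?thesis
    proof (cases "st x = z")
      case True
      then show ?thesis using z closure_subset by blast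
    next
      case False
      then have "st x \<in> closure (open_segment (st x) z)" by (simp add: closure_open_segment)
      then show ?thesis using closure_mono[OF seg] by blast
    qed
  qed
  ultimately show ?thesis unfolding standard_core_def by blast
qed

section \<open>Combinations determined by their values at standard points\<close>

lemma kopen_line: "open T \<Longrightarrow> kopen (Suc 0) {v. kvec (Suc 0) v \<and> v 0 \<in> T}"
  unfolding kopen_def
proof safe
  fix v :: "nat \<Rightarrow> real" assume "open T" "v 0 \<in> T"
  then obtain e where "e > 0" "ball (v 0) e \<subseteq> T" by (auto simp: open_contains_ball)
  then show "\<exists>e>0. \<forall>w. kvec (Suc 0) w \<and> (\<forall>i<Suc 0. \<bar>w i - v i\<bar> < e) \<longrightarrow> w \<in> {v. kvec (Suc 0) v \<and> v 0 \<in> T}"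
    by (intro exI[of _ e]) (auto simp: subset_iff dist_real_def abs_minus_commute)
qed

text \<open>On the open set all derivatives vanish by locality, and continuity carries this to the
  closure. An endpoint at which the function is known from one side only is covered by this.\<close>

lemma vanish_derivs:
  assumes c: "cinf (Suc 0) (interval1 l u) c" and T: "open T" and z: "\<And>r. r \<in> T \<Longrightarrow> l < r \<Longrightarrow> r < u \<Longrightarrow> c (vec1 r) = 0"
    and p: "l < p" "p < u" "p \<in> closure T"
  shows "(pderiv_k 0 ^^ n) c (vec1 p) = 0"
proof -
  let ?W = "{v. kvec (Suc 0) v \<and> v 0 \<in> T \<inter> {l<..<u}}"
  have W: "kopen (Suc 0) ?W" using T by (intro kopen_line open_Int) auto
  have "\<forall>v\<in>?W. (pderiv_k 0 ^^ n) c v = 0"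
  proof (induction n)
    case 0
    then show ?case using z kvec_1_eq by (metis (mono_tags, lifting) IntE funpow_0 greaterThanLessThan_iff mem_Collect_eq)
  next
    case (Suc n)
    show ?case
    proof
      fix v assume v: "v \<in> ?W"
      have "pderiv_k 0 ((pderiv_k 0 ^^ n) c) v = pderiv_k 0 (\<lambda>_. 0) v"
        using Suc by (intro pderiv_k_cong[OF W v]) auto
      then show "(pderiv_k 0 ^^ Suc n) c v = 0" by (simp add: pderiv_const)
    qed
  qed
  then have zn: "(pderiv_k 0 ^^ n) c (vec1 r) = 0" if "r \<in> T" "l < r" "r < u" for r using that by simp
  have "\<bar>(pderiv_k 0 ^^ n) c (vec1 p)\<bar> < e" if e: "e > 0" for e
  proof -
    have k: "kcont (Suc 0) (interval1 l u) ((pderiv_k 0 ^^ n) c)" using cinf_kcont[OF cinf_pderiv_iter[OF c]] by simp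
    have vp: "vec1 p \<in> interval1 l u" using p by simp
    from k vp e obtain \<delta> where d: "\<delta> > 0" "\<forall>w. w \<in> interval1 l u \<longrightarrow> (\<forall>i<Suc 0. \<bar>w i - vec1 p i\<bar> < \<delta>) \<longrightarrow>
       \<bar>(pderiv_k 0 ^^ n) c w - (pderiv_k 0 ^^ n) c (vec1 p)\<bar> < e"
      by (rule kcontE)
    obtain r where r: "r \<in> T" "dist r p < min \<delta> (min (p - l) (u - p))"
      using p(3) d(1) p(1,2) unfolding closure_approachable by (metis diff_gt_0_iff_gt min_less_iff_conj)
    then have "l < r" "r < u" "\<bar>r - p\<bar> < \<delta>" by (auto simp: dist_real_def abs_less_iff)
    then show ?thesis using d(2)[rule_format, of "vec1 r"] zn[OF r(1)] by simp
  qed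
  from this[of "\<bar>(pderiv_k 0 ^^ n) c (vec1 p)\<bar>"] show ?thesis by auto
qed

text \<open>Taylor expansion at the standard part of \<open>x\<close>: every coefficient is a
  derivative of \<open>c\<close> at a point of the closure of \<open>T\<close>. The shift
  \<open>m\<close> treats values (\<open>m = 0\<close>) and derivatives (\<open>m = 1\<close>)
  together.\<close>

lemma vanish_fext:
  assumes c: "cinf (Suc 0) (interval1 l u) c" and T: "open T" and z: "\<And>r. r \<in> T \<Longrightarrow> l < r \<Longrightarrow> r < u \<Longrightarrow> c (vec1 r) = 0"
    and x: "l < st x" "st x < u" "st x \<in> closure T"
  shows "fext (Suc 0) ((pderiv_k 0 ^^ m) c) (pt1 x) = 0"
proof -
  let ?d = "(pderiv_k 0 ^^ m) c"
  have d: "cinf (Suc 0) (interval1 l u) ?d" by (rule cinf_pderiv_iter[OF c]) simp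
  have "fext (Suc 0) ((pderiv_k 0 ^^ n) ?d) ((pt1 x)(0 := fconst (st x))) = 0" for n
  proof -
    have "fext (Suc 0) ((pderiv_k 0 ^^ n) ?d) ((pt1 x)(0 := fconst (st x))) =
       fconst ((pderiv_k 0 ^^ n) ?d (vec1 (st x)))"
      using x by (intro fext_standardize[OF cinf_pderiv_iter[OF d]]) auto
    also have "(pderiv_k 0 ^^ n) ?d (vec1 (st x)) = 0"
      using vanish_derivs[OF c T z x, of "n + m"] by (simp add: funpow_add)
    finally show ?thesis by (simp del: fun_upd_apply)
  qed
  then show ?thesis
    using fext_taylor[OF d, of "pt1 x" 0 "nil_index x"] nil_index[of x] x
    by (simp del: sum.lessThan_Suc power_Suc fun_upd_apply)
qed

lemma fext_ccoef_cderiv: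
  assumes "csmooth k W L" "stv k X \<in> W" "i < k"
  shows "fext k (ccoef a (cderiv i L)) X = fext k (pderiv_k i (ccoef a L)) X"
  using assms by (intro fext_cong[OF cinf_ccoef[OF csmooth_cderiv]]) (auto simp: pderiv_ccoef)

lemma ceval_zero_imp_deriv_zero:
  assumes J: "standard_core J T" and L: "csmooth (Suc 0) (interval1 l u) L"
    and z: "\<And>y. y \<in> J \<Longrightarrow> l < st y \<Longrightarrow> st y < u \<Longrightarrow> ceval (Suc 0) L (pt1 y) = 0"
    and x: "x \<in> J" "l < st x" "st x < u"
  shows "ceval (Suc 0) (cderiv 0 L) (pt1 x) = 0"
proof -
  have T: "open T" and xT: "st x \<in> closure T" using J x by (auto simp: standard_core_def)
  have "fext (Suc 0) (ccoef a (cderiv 0 L)) (pt1 x) = 0" for a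
  proof -
    \<comment> \<open>The real points of \<open>T\<close> belong to \<open>J\<close>, and there the
      coefficients of the value 0 can be read off.\<close>
    have "ccoef a L (vec1 r) = 0" if "r \<in> T" "l < r" "r < u" for r
      using coef_ceval[OF L, of "vec1 r" "pt1 (fconst r)" a] z[of "fconst r"] that J by (auto simp: standard_core_def coef_0)
    from vanish_fext[OF cinf_ccoef[OF L] T this x(2,3) xT, of 1] show ?thesis
      using fext_ccoef_cderiv[OF L, of "pt1 x" 0 a] x by simp
  qed
  then show ?thesis
    using ceval_ccoef[OF csmooth_cderiv[OF L], of 0 "pt1 x" "csupport L"] x by simp
qed

text \<open>Each real coefficient function has derivative 0 on the convex set of real points of
  \<open>T\<close> between \<open>l\<close> and \<open>u\<close>, hence is a constant there. The
  finitely many nonzero constants assemble into one Fermat number, and this carries over to the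
  nonstandard points.\<close>

lemma ceval_deriv_zero_imp_const:
  assumes J: "standard_core J T" and L: "csmooth (Suc 0) (interval1 l u) L"
    and z: "\<And>y. y \<in> J \<Longrightarrow> l < st y \<Longrightarrow> st y < u \<Longrightarrow> ceval (Suc 0) (cderiv 0 L) (pt1 y) = 0"
  shows "\<exists>K. \<forall>y\<in>J. l < st y \<and> st y < u \<longrightarrow> ceval (Suc 0) L (pt1 y) = K"
proof -
  have T: "open T" using J by (simp add: standard_core_def)
  have "\<exists>K. \<forall>r\<in>T \<inter> {l<..<u}. ccoef a L (vec1 r) = K" for a
  proof (rule has_field_derivative_zero_constant)
    show "convex (T \<inter> {l<..<u})" using J by (intro convex_Int) (auto simp: standard_core_def)
    fix r assume r: "r \<in> T \<inter> {l<..<u}"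
    then have rv: "vec1 r \<in> interval1 l u" by simp
    have "ccoef a (cderiv 0 L) (vec1 r) = 0"
      using coef_ceval[OF csmooth_cderiv[OF L] rv, of 0 "pt1 (fconst r)" a] z[of "fconst r"] r J by (auto simp: standard_core_def coef_0)
    then have "pderiv_k 0 (ccoef a L) (vec1 r) = 0" using pderiv_ccoef[OF L _ rv, of 0 a] by simp
    with cinf_has_deriv[OF cinf_ccoef[OF L] rv, of 0 a]
    show "((\<lambda>r. ccoef a L (vec1 r)) has_real_derivative 0) (at r within T \<inter> {l<..<u})"
      by (simp add: has_field_derivative_at_within del: fun_upd_apply)
  qed
  then obtain K where K: "\<And>a r. r \<in> T \<Longrightarrow> l < r \<Longrightarrow> r < u \<Longrightarrow> ccoef a L (vec1 r) = K a"
    by (metis IntI greaterThanLessThan_iff)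
  have "ceval (Suc 0) L (pt1 y) = (\<Sum>a\<in>csupport L. fmonom a * fconst (K a))"
    if y: "y \<in> J" "l < st y" "st y < u" for y
  proof -
    have yT: "st y \<in> closure T" using J y by (simp add: standard_core_def)
    have "fext (Suc 0) (ccoef a L) (pt1 y) = fconst (K a)" for a
    proof -
      have ck: "cinf (Suc 0) (interval1 l u) (\<lambda>v. ccoef a L v - K a)" by (intro cinf_diff cinf_ccoef[OF L] cinf_const kopen_interval1)
      have "fext (Suc 0) (\<lambda>v. ccoef a L v - K a) (pt1 y) = 0"
        using vanish_fext[OF ck T _ y(2,3) yT, of 0] K by simp
      moreover have "fext (Suc 0) (\<lambda>v. (ccoef a L v - K a) + K a) (pt1 y) = fext (Suc 0) (\<lambda>v. ccoef a L v - K a) (pt1 y) + fconst (K a)"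
        using y by (subst fext_add[OF ck cinf_const[OF kopen_interval1]]) (auto simp: fext_const)
      ultimately show ?thesis by simp
    qed
    then show ?thesis using ceval_ccoef[OF L, of "pt1 y" "csupport L"] y by simp
  qed
  then show ?thesis by blast
qed

section \<open>Derivatives of smooth functions on an interval\<close>

definition rep1 :: "fermat set \<Rightarrow> (fermat \<Rightarrow> fermat) \<Rightarrow> real \<Rightarrow> real \<Rightarrow> comb \<Rightarrow> bool" where
  "rep1 J g l u L \<longleftrightarrow> csmooth (Suc 0) (interval1 l u) L \<and>
     (\<forall>y\<in>J. l < st y \<and> st y < u \<longrightarrow> g y = ceval (Suc 0) L (pt1 y))"

lemma interval1_inside:
  assumes "kopen (Suc 0) V" "vec1 p \<in> V"
  obtains l u where "l < p" "p < u" "interval1 l u \<subseteq> V"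
proof -
  obtain l u where lu: "vec1 p \<in> obox (Suc 0) l u" "obox (Suc 0) l u \<subseteq> V" using obox_inside[OF assms] by blast
  moreover have "obox (Suc 0) l u = interval1 (l 0) (u 0)" by (auto simp: interval1_def obox_def)
  ultimately show thesis using that by auto
qed

lemma pderiv_primitive_interval1:
  "cinf (Suc 0) (interval1 l u) c \<Longrightarrow> l < r \<Longrightarrow> r < u \<Longrightarrow> v \<in> interval1 l u \<Longrightarrow> pderiv_k 0 (primitive 0 r c) v = c v"
  unfolding interval1_def by (rule pderiv_primitive_same[of "Suc 0"]) auto

lemma rep1_subset: "rep1 J g l u L \<Longrightarrow> l \<le> l' \<Longrightarrow> u' \<le> u \<Longrightarrow> rep1 J g l' u' L"
  unfolding rep1_def using csmooth_subset[OF _ interval1_mono kopen_interval1] by force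

lemma fsmooth1_iff:
  "fsmooth1 J g \<longleftrightarrow> (\<forall>x\<in>J. \<exists>l u L. l < st x \<and> st x < u \<and> rep1 J g l u L)"
proof
  assume s: "fsmooth1 J g"
  show "\<forall>x\<in>J. \<exists>l u L. l < st x \<and> st x < u \<and> rep1 J g l u L"
  proof
    fix x assume x: "x \<in> J"
    then obtain V L where V: "pt1 x \<in> fstar (Suc 0) V" "csmooth (Suc 0) V L"
      "\<And>y. y \<in> fstar (Suc 0) V \<Longrightarrow> y \<in> pt1 ` J \<Longrightarrow> g (y 0) = ceval (Suc 0) L y"
      using s unfolding fsmooth1_def fsmooth_iff One_nat_def by blast
    have "vec1 (st x) \<in> V" using V(1) by (simp add: pt1_in_fstar)
    with csmooth_kopen[OF V(2)] obtain l u where lu: "l < st x" "st x < u" "interval1 l u \<subseteq> V" by (rule interval1_inside)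
    have "g y = ceval (Suc 0) L (pt1 y)" if "y \<in> J" "l < st y" "st y < u" for y
      using V(3)[of "pt1 y"] that subsetD[OF lu(3), of "vec1 (st y)"] by (simp add: pt1_in_fstar)
    then show "\<exists>l u L. l < st x \<and> st x < u \<and> rep1 J g l u L"
      using lu csmooth_subset[OF V(2) lu(3) kopen_interval1] unfolding rep1_def by blast
  qed
next
  assume *: "\<forall>x\<in>J. \<exists>l u L. l < st x \<and> st x < u \<and> rep1 J g l u L"
  show "fsmooth1 J g"
    unfolding fsmooth1_def fsmooth_iff One_nat_def
  proof
    fix X assume "X \<in> pt1 ` J"
    then obtain x where x: "x \<in> J" "X = pt1 x" by blast
    then obtain l u L where "l < st x" "st x < u" "rep1 J g l u L" using * by blast
    then show "\<exists>V L. X \<in> fstar (Suc 0) V \<and> csmooth (Suc 0) V L \<and> (\<forall>y\<in>fstar (Suc 0) V \<inter> pt1 ` J. g (y 0) = ceval (Suc 0) L y)"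
      using x unfolding rep1_def by (intro exI[of _ "interval1 l u"] exI[of _ L]) (auto simp: pt1_in_fstar)
  qed
qed

lemma rep1_deriv_unique:
  assumes J: "standard_core J T" and r: "rep1 J g l u L" "rep1 J g l' u' L'"
    and x: "x \<in> J" "l < st x" "st x < u" "l' < st x" "st x < u'"
  shows "ceval (Suc 0) (cderiv 0 L) (pt1 x) = ceval (Suc 0) (cderiv 0 L') (pt1 x)"
proof -
  let ?l = "max l l'" and ?u = "min u u'"
  let ?M = "L @ cscale (-1) L'"
  have "csmooth (Suc 0) (interval1 ?l ?u) ?M"
    using rep1_subset[OF r(1), of ?l ?u] rep1_subset[OF r(2), of ?l ?u] by (simp add: rep1_def)
  then have "ceval (Suc 0) (cderiv 0 ?M) (pt1 x) = 0"
    using r x by (intro ceval_zero_imp_deriv_zero[OF J, of ?l ?u]) (auto simp: rep1_def)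
  then show ?thesis by simp
qed

text \<open>The choice in \<open>fderiv1\<close> yields some local representation, unrelated to
  \<open>L\<close>. Converted into a combination it represents \<open>g\<close> on the same side of
  \<open>x\<close> as \<open>L\<close> does, and the two derivatives agree.\<close>

lemma fderiv1_eq:
  assumes J: "standard_core J T" and r: "rep1 J g l u L"
    and x: "x \<in> J" "l < st x" "st x < u"
  shows "fderiv1 J g x = ceval (Suc 0) (cderiv 0 L) (pt1 x)"
proof -
  let ?P = "\<lambda>w. \<exists>V pd P q \<alpha>. pt1 x \<in> fstar 1 V \<and> local_rep 1 (pt1 ` J) (\<lambda>X. g (X 0)) V pd P q \<alpha> \<and>
      w = fext (pd + 1) (pderiv_k pd \<alpha>) (catv pd q (pt1 x))"
  have "\<exists>w. ?P w"
  proof -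
    have "csmooth (Suc 0) (interval1 l u) L" using r by (simp add: rep1_def)
    moreover have "g (y 0) = ceval (Suc 0) L y" if "y \<in> fstar (Suc 0) (interval1 l u) \<inter> pt1 ` J" for y
      using that r by (auto simp: rep1_def pt1_in_fstar)
    ultimately obtain pd P q \<alpha> where "local_rep (Suc 0) (pt1 ` J) (\<lambda>X. g (X 0)) (interval1 l u) pd P q \<alpha>"
      using ceval_imp_local_rep[of "Suc 0" "interval1 l u" L "pt1 ` J" "\<lambda>X. g (X 0)"] by blast
    moreover have "pt1 x \<in> fstar (Suc 0) (interval1 l u)" using x by (simp add: pt1_in_fstar)
    ultimately show ?thesis unfolding One_nat_def by blast
  qed
  then have "?P (fderiv1 J g x)" unfolding fderiv1_def by (rule someI_ex)
  then obtain V pd P q \<alpha> where V: "pt1 x \<in> fstar (Suc 0) V"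
    "local_rep (Suc 0) (pt1 ` J) (\<lambda>X. g (X 0)) V pd P q \<alpha>"
    "fderiv1 J g x = fext (pd + 1) (pderiv_k pd \<alpha>) (catv pd q (pt1 x))" unfolding One_nat_def by blast
  from local_rep_imp_ceval[OF V(2)] obtain L' where L': "csmooth (Suc 0) V L'"
    "\<And>y. y \<in> fstar (Suc 0) V \<inter> pt1 ` J \<Longrightarrow> g (y 0) = ceval (Suc 0) L' y"
    "\<And>y i. y \<in> fstar (Suc 0) V \<Longrightarrow> i < Suc 0 \<Longrightarrow> fext (pd + Suc 0) (pderiv_k (pd + i) \<alpha>) (catv pd q y) = ceval (Suc 0) (cderiv i L') y"
    by blast
  have "vec1 (st x) \<in> V" using V(1) by (simp add: pt1_in_fstar)
  with csmooth_kopen[OF L'(1)] obtain l' u' where lu: "l' < st x" "st x < u'" "interval1 l' u' \<subseteq> V" by (rule interval1_inside)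
  have "g y = ceval (Suc 0) L' (pt1 y)" if "y \<in> J" "l' < st y" "st y < u'" for y
    using L'(2)[of "pt1 y"] that subsetD[OF lu(3), of "vec1 (st y)"] by (simp add: pt1_in_fstar)
  then have "rep1 J g l' u' L'" using csmooth_subset[OF L'(1) lu(3) kopen_interval1] unfolding rep1_def by blast
  from rep1_deriv_unique[OF J r this x lu(1,2)]
  show ?thesis using V(3) L'(3)[OF V(1), of 0] by simp
qed

section \<open>Antiderivatives by bisection over standard parts\<close>

lemma locally_const_imp_const:
  assumes J: "standard_core J T" and rs: "r \<le> s" "\<And>q. r \<le> q \<Longrightarrow> q \<le> s \<Longrightarrow> \<exists>y\<in>J. st y = q"
    and loc: "\<And>x. x \<in> J \<Longrightarrow> r \<le> st x \<Longrightarrow> st x \<le> s \<Longrightarrow> \<exists>l u K. l < st x \<and> st x < u \<and>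
      (\<forall>y\<in>J. l < st y \<and> st y < u \<and> r \<le> st y \<and> st y \<le> s \<longrightarrow> h y = K)"
  shows "\<exists>K. \<forall>y\<in>J. r \<le> st y \<and> st y \<le> s \<longrightarrow> h y = K"
proof -
  define P where "P p q \<longleftrightarrow> (r \<le> p \<and> q \<le> s \<longrightarrow> (\<exists>K. \<forall>y\<in>J. p \<le> st y \<and> st y \<le> q \<longrightarrow> h y = K))" for p q
  have "P r s"
  proof (rule Bolzano[OF rs(1)])
    fix a b c assume ab: "P a b" "P b c" "a \<le> b" "b \<le> c"
    show "P a c" unfolding P_def
    proof
      assume ac: "r \<le> a \<and> c \<le> s"
      then obtain K K' where K: "\<forall>y\<in>J. a \<le> st y \<and> st y \<le> b \<longrightarrow> h y = K"
        "\<forall>y\<in>J. b \<le> st y \<and> st y \<le> c \<longrightarrow> h y = K'" using ab unfolding P_def by (metis order_trans)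
      \<comment> \<open>A point of \<open>J\<close> with standard part exactly \<open>b\<close>
        belongs to both halves and identifies the two constants.\<close>
      obtain y where "y \<in> J" "st y = b" using rs(2)[of b] ab ac by auto
      then have "K = K'" using K ab by force
      then show "\<exists>K. \<forall>y\<in>J. a \<le> st y \<and> st y \<le> c \<longrightarrow> h y = K"
        using K by (metis linorder_le_cases)
    qed
  next
    fix x assume x: "r \<le> x" "x \<le> s"
    then obtain y where y: "y \<in> J" "st y = x" using rs(2) by blast
    then obtain l u K where K: "l < x" "x < u"
      "\<forall>y\<in>J. l < st y \<and> st y < u \<and> r \<le> st y \<and> st y \<le> s \<longrightarrow> h y = K" using loc[of y] x by blast
    show "\<exists>d>0. \<forall>a b. a \<le> x \<and> x \<le> b \<and> b - a < d \<longrightarrow> P a b"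
    proof (intro exI[of _ "min (x - l) (u - x)"] conjI allI impI)
      fix a b assume "a \<le> x \<and> x \<le> b \<and> b - a < min (x - l) (u - x)"
      then show "P a b" unfolding P_def using K(3) by (intro impI exI[of _ K]) auto
    qed (use K in auto)
  qed
  then show ?thesis unfolding P_def by blast
qed

text \<open>Bisection leads to arbitrarily short ranges of standard parts, on which \<open>G\<close>
  alone might not determine a derivative. Therefore \<open>f\<close> is tied to the derivative of
  \<open>L\<close> at all points of \<open>J\<close> near \<open>x\<close>, whereas \<open>G\<close>
  is tied to \<open>L\<close> only within the range.\<close>

definition antider_on :: "fermat set \<Rightarrow> (fermat \<Rightarrow> fermat) \<Rightarrow> real \<Rightarrow> real \<Rightarrow> (fermat \<Rightarrow> fermat) \<Rightarrow> bool" where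
  "antider_on J f r s G \<longleftrightarrow> (\<forall>x\<in>J. r \<le> st x \<and> st x \<le> s \<longrightarrow>
     (\<exists>l u L. l < st x \<and> st x < u \<and> csmooth (Suc 0) (interval1 l u) L \<and>
       (\<forall>y\<in>J. l < st y \<and> st y < u \<longrightarrow> f y = ceval (Suc 0) (cderiv 0 L) (pt1 y)) \<and>
       (\<forall>y\<in>J. l < st y \<and> st y < u \<and> r \<le> st y \<and> st y \<le> s \<longrightarrow> G y = ceval (Suc 0) L (pt1 y))))"

lemma antider_onE:
  assumes "antider_on J f r s G" "x \<in> J" "r \<le> st x" "st x \<le> s"
  obtains l u L where "l < st x" "st x < u" "csmooth (Suc 0) (interval1 l u) L"
    "\<forall>y\<in>J. l < st y \<and> st y < u \<longrightarrow> f y = ceval (Suc 0) (cderiv 0 L) (pt1 y)"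
    "\<forall>y\<in>J. l < st y \<and> st y < u \<and> r \<le> st y \<and> st y \<le> s \<longrightarrow> G y = ceval (Suc 0) L (pt1 y)"
  using assms unfolding antider_on_def by metis

lemma antider_diff_const:
  assumes J: "standard_core J T" and L: "csmooth (Suc 0) (interval1 l u) L" "csmooth (Suc 0) (interval1 l' u') L'"
    and d: "\<forall>y\<in>J. l < st y \<and> st y < u \<longrightarrow> f y = ceval (Suc 0) (cderiv 0 L) (pt1 y)"
      "\<forall>y\<in>J. l' < st y \<and> st y < u' \<longrightarrow> f y = ceval (Suc 0) (cderiv 0 L') (pt1 y)"
  shows "\<exists>K. \<forall>y\<in>J. max l l' < st y \<and> st y < min u u' \<longrightarrow> ceval (Suc 0) L (pt1 y) = ceval (Suc 0) L' (pt1 y) + K"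
proof -
  let ?l = "max l l'" and ?u = "min u u'"
  let ?M = "L @ cscale (-1) L'"
  have "csmooth (Suc 0) (interval1 ?l ?u) ?M"
    using csmooth_subset[OF L(1) interval1_mono kopen_interval1] csmooth_subset[OF L(2) interval1_mono kopen_interval1] by simp
  then have "\<exists>K. \<forall>y\<in>J. ?l < st y \<and> st y < ?u \<longrightarrow> ceval (Suc 0) ?M (pt1 y) = K"
    using d by (intro ceval_deriv_zero_imp_const[OF J, of ?l ?u]) auto
  then obtain K where "\<forall>y\<in>J. ?l < st y \<and> st y < ?u \<longrightarrow> ceval (Suc 0) L (pt1 y) - ceval (Suc 0) L' (pt1 y) = K" by auto
  then show ?thesis by (intro exI[of _ K]) (auto simp: algebra_simps)
qed

lemma const_cell: "csmooth (Suc 0) (interval1 l u) [(K, \<lambda>_. 1)]"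
  by (simp add: cinf_const kopen_interval1)

lemma ceval_const_cell: "ceval k [(K, \<lambda>_. 1)] X = K" "ceval k (cderiv i [(K, \<lambda>_. 1)]) X = 0"
proof -
  have "pderiv_k i (\<lambda>_. 1) = (\<lambda>_. 0)" by (intro ext pderiv_const)
  then show "ceval k (cderiv i [(K, \<lambda>_. 1)]) X = 0" by (simp add: fext_const)
qed (simp add: fext_const)

text \<open>Near a single point, primitives of the real functions in a representation give an
  antiderivative. Two adjacent pieces are joined after shifting one of them by the constant by which
  their representations differ near the common point.\<close>

lemma antider_exists:
  assumes J: "standard_core J T" and f: "fsmooth1 J f"
    and rs: "r \<le> s" "\<And>q. r \<le> q \<Longrightarrow> q \<le> s \<Longrightarrow> \<exists>y\<in>J. st y = q"
  shows "\<exists>G. antider_on J f r s G"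
proof -
  define P where "P p q \<longleftrightarrow> (r \<le> p \<and> q \<le> s \<longrightarrow> (\<exists>G. antider_on J f p q G))" for p q
  have "P r s"
  proof (rule Bolzano[OF rs(1)])
    fix x assume x: "r \<le> x" "x \<le> s"
    then obtain y where y: "y \<in> J" "st y = x" using rs(2) by blast
    then obtain l u L0 where L0: "l < x" "x < u" "rep1 J f l u L0" using f unfolding fsmooth1_iff by blast
    let ?L = "cmap (primitive 0 x) L0"
    have s0: "csmooth (Suc 0) (interval1 l u) L0" using L0 by (simp add: rep1_def)
    have sL: "csmooth (Suc 0) (interval1 l u) ?L"
      using L0 by (intro csmooth_cmap[OF s0 kopen_interval1]) (auto simp: interval1_def intro!: cinf_primitive)
    have eq: "ceval (Suc 0) (cderiv 0 ?L) (pt1 z) = ceval (Suc 0) L0 (pt1 z)" if z: "l < st z" "st z < u" for z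
      using s0
    proof (induction L0)
      case (Cons p L0)
      have c: "cinf (Suc 0) (interval1 l u) (snd p)" using Cons by simp
      have "fext (Suc 0) (snd p) (pt1 z) = fext (Suc 0) (pderiv_k 0 (primitive 0 x (snd p))) (pt1 z)"
        using c L0(1,2) z by (intro fext_cong[OF c]) (auto simp: pderiv_primitive_interval1)
      then show ?case using Cons by simp
    qed simp
    show "\<exists>d>0. \<forall>a b. a \<le> x \<and> x \<le> b \<and> b - a < d \<longrightarrow> P a b"
    proof (intro exI[of _ "min (x - l) (u - x)"] conjI allI impI)
      fix a b assume ab: "a \<le> x \<and> x \<le> b \<and> b - a < min (x - l) (u - x)"
      have "antider_on J f a b (\<lambda>y. ceval (Suc 0) ?L (pt1 y))"
        unfolding antider_on_def
      proof (intro ballI impI)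
        fix z assume "z \<in> J" "a \<le> st z \<and> st z \<le> b"
        then have "l < st z" "st z < u" using ab by auto
        then show "\<exists>l u L. l < st z \<and> st z < u \<and> csmooth (Suc 0) (interval1 l u) L \<and>
           (\<forall>y\<in>J. l < st y \<and> st y < u \<longrightarrow> f y = ceval (Suc 0) (cderiv 0 L) (pt1 y)) \<and>
           (\<forall>y\<in>J. l < st y \<and> st y < u \<and> a \<le> st y \<and> st y \<le> b \<longrightarrow>
              ceval (Suc 0) ?L (pt1 y) = ceval (Suc 0) L (pt1 y))"
          using sL eq L0(3) by (intro exI[of _ l] exI[of _ u] exI[of _ ?L]) (auto simp: rep1_def)
      qed
      then show "P a b" unfolding P_def by blast
    qed (use L0 in auto)
  next
    fix a b c assume ab: "P a b" "P b c" "a \<le> b" "b \<le> c"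
    show "P a c" unfolding P_def
    proof
      assume ac: "r \<le> a \<and> c \<le> s"
      then obtain G1 G2 where G: "antider_on J f a b G1" "antider_on J f b c G2"
        using ab unfolding P_def by (metis order_trans)
      obtain z where z: "z \<in> J" "st z = b" using rs(2)[of b] ab ac by auto
      obtain l1 u1 L1 where 1: "l1 < b" "b < u1" "csmooth (Suc 0) (interval1 l1 u1) L1"
        "\<forall>y\<in>J. l1 < st y \<and> st y < u1 \<longrightarrow> f y = ceval (Suc 0) (cderiv 0 L1) (pt1 y)"
        "\<forall>y\<in>J. l1 < st y \<and> st y < u1 \<and> a \<le> st y \<and> st y \<le> b \<longrightarrow> G1 y = ceval (Suc 0) L1 (pt1 y)"
        using antider_onE[OF G(1) z(1)] z ab by auto
      obtain l2 u2 L2 where 2: "l2 < b" "b < u2" "csmooth (Suc 0) (interval1 l2 u2) L2"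
        "\<forall>y\<in>J. l2 < st y \<and> st y < u2 \<longrightarrow> f y = ceval (Suc 0) (cderiv 0 L2) (pt1 y)"
        "\<forall>y\<in>J. l2 < st y \<and> st y < u2 \<and> b \<le> st y \<and> st y \<le> c \<longrightarrow> G2 y = ceval (Suc 0) L2 (pt1 y)"
        using antider_onE[OF G(2) z(1)] z ab by auto
      obtain K where K: "\<forall>y\<in>J. max l1 l2 < st y \<and> st y < min u1 u2 \<longrightarrow> ceval (Suc 0) L1 (pt1 y) = ceval (Suc 0) L2 (pt1 y) + K"
        using antider_diff_const[OF J 1(3) 2(3) 1(4) 2(4)] by blast
      define G where "G y = (if st y \<le> b then G1 y else G2 y + K)" for y
      have "antider_on J f a c G"
        unfolding antider_on_def
      proof (intro ballI impI)
        fix x assume x: "x \<in> J" "a \<le> st x \<and> st x \<le> c"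
        let ?C = "\<lambda>l u L. l < st x \<and> st x < u \<and> csmooth (Suc 0) (interval1 l u) L \<and>
           (\<forall>y\<in>J. l < st y \<and> st y < u \<longrightarrow> f y = ceval (Suc 0) (cderiv 0 L) (pt1 y)) \<and>
           (\<forall>y\<in>J. l < st y \<and> st y < u \<and> a \<le> st y \<and> st y \<le> c \<longrightarrow> G y = ceval (Suc 0) L (pt1 y))"
        consider "st x < b" | "st x > b" | "st x = b" by linarith
        then show "\<exists>l u L. ?C l u L"
        proof cases
          case c1: 1
          obtain l u L where L: "l < st x" "st x < u" "csmooth (Suc 0) (interval1 l u) L"
            "\<forall>y\<in>J. l < st y \<and> st y < u \<longrightarrow> f y = ceval (Suc 0) (cderiv 0 L) (pt1 y)"
            "\<forall>y\<in>J. l < st y \<and> st y < u \<and> a \<le> st y \<and> st y \<le> b \<longrightarrow> G1 y = ceval (Suc 0) L (pt1 y)"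
            using antider_onE[OF G(1) x(1)] x c1 by auto
          have "?C l (min u b) L"
            using L c1 csmooth_subset[OF L(3) interval1_mono[of l l "min u b" u] kopen_interval1] by (auto simp: G_def)
          then show ?thesis by blast
        next
          case c2: 2
          obtain l u L where L: "l < st x" "st x < u" "csmooth (Suc 0) (interval1 l u) L"
            "\<forall>y\<in>J. l < st y \<and> st y < u \<longrightarrow> f y = ceval (Suc 0) (cderiv 0 L) (pt1 y)"
            "\<forall>y\<in>J. l < st y \<and> st y < u \<and> b \<le> st y \<and> st y \<le> c \<longrightarrow> G2 y = ceval (Suc 0) L (pt1 y)"
            using antider_onE[OF G(2) x(1)] x c2 by auto
          have "?C (max l b) u (L @ [(K, \<lambda>_. 1)])"
            using L c2 csmooth_subset[OF L(3) interval1_mono[of l "max l b" u u] kopen_interval1] const_cell[of "max l b" u K]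
            by (auto simp: G_def ceval_const_cell simp del: cmap_Cons ceval_Cons csmooth_Cons)
          then show ?thesis by blast
        next
          case c3: 3
          \<comment> \<open>Around \<open>b\<close> the single combination \<open>L1\<close>
            represents both branches, since on the right \<open>G2 + K\<close> equals
            \<open>L2 + K\<close>, which is \<open>L1\<close>.\<close>
          have "?C (max l1 l2) (min u1 u2) L1"
            using 1 2 c3 K csmooth_subset[OF 1(3) interval1_mono[of l1 "max l1 l2" "min u1 u2" u1] kopen_interval1]
            by (auto simp: G_def)
          then show ?thesis by blast
        qed
      qed
      then show "\<exists>G. antider_on J f a c G" by blast
    qed
  qed
  then show ?thesis unfolding P_def by blast
qed

lemma antider_unique:
  assumes J: "standard_core J T" and G: "antider_on J f r s G" "antider_on J f r' s' G'"
    and pq: "p \<le> q" "r \<le> p" "q \<le> s" "r' \<le> p" "q \<le> s'" "\<And>t. p \<le> t \<Longrightarrow> t \<le> q \<Longrightarrow> \<exists>y\<in>J. st y = t"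
  shows "\<exists>K. \<forall>y\<in>J. p \<le> st y \<and> st y \<le> q \<longrightarrow> G y - G' y = K"
proof (rule locally_const_imp_const[OF J pq(1,6)])
  fix x assume x: "x \<in> J" "p \<le> st x" "st x \<le> q"
  obtain l u L where L: "l < st x" "st x < u" "csmooth (Suc 0) (interval1 l u) L"
    "\<forall>y\<in>J. l < st y \<and> st y < u \<longrightarrow> f y = ceval (Suc 0) (cderiv 0 L) (pt1 y)"
    "\<forall>y\<in>J. l < st y \<and> st y < u \<and> r \<le> st y \<and> st y \<le> s \<longrightarrow> G y = ceval (Suc 0) L (pt1 y)"
    using antider_onE[OF G(1) x(1)] x pq by auto
  obtain l' u' L' where L': "l' < st x" "st x < u'" "csmooth (Suc 0) (interval1 l' u') L'"
    "\<forall>y\<in>J. l' < st y \<and> st y < u' \<longrightarrow> f y = ceval (Suc 0) (cderiv 0 L') (pt1 y)"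
    "\<forall>y\<in>J. l' < st y \<and> st y < u' \<and> r' \<le> st y \<and> st y \<le> s' \<longrightarrow> G' y = ceval (Suc 0) L' (pt1 y)"
    using antider_onE[OF G(2) x(1)] x pq by auto
  obtain K where K: "\<forall>y\<in>J. max l l' < st y \<and> st y < min u u' \<longrightarrow> ceval (Suc 0) L (pt1 y) = ceval (Suc 0) L' (pt1 y) + K"
    using antider_diff_const[OF J L(3) L'(3) L(4) L'(4)] by blast
  show "\<exists>l u K. l < st x \<and> st x < u \<and>
      (\<forall>y\<in>J. l < st y \<and> st y < u \<and> p \<le> st y \<and> st y \<le> q \<longrightarrow> G y - G' y = K)"
  proof (intro exI conjI ballI impI)
    fix y assume "y \<in> J" "max l l' < st y \<and> st y < min u u' \<and> p \<le> st y \<and> st y \<le> q"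
    then show "G y - G' y = K" using L(5) L'(5) K pq by auto
  qed (use L L' in auto)
qed

lemma smooth_antider_on:
  assumes J: "standard_core J T" and G: "fsmooth1 J G" "\<And>x. x \<in> J \<Longrightarrow> fderiv1 J G x = f x"
  shows "antider_on J f r s G"
  unfolding antider_on_def
proof (intro ballI impI)
  fix x assume x: "x \<in> J"
  then obtain l u L where L: "l < st x" "st x < u" "rep1 J G l u L" using G(1) unfolding fsmooth1_iff by blast
  have "f y = ceval (Suc 0) (cderiv 0 L) (pt1 y)" if "y \<in> J" "l < st y" "st y < u" for y
    using fderiv1_eq[OF J L(3) that] G(2)[OF that(1)] by simp
  then show "\<exists>l u L. l < st x \<and> st x < u \<and> csmooth (Suc 0) (interval1 l u) L \<and>
     (\<forall>y\<in>J. l < st y \<and> st y < u \<longrightarrow> f y = ceval (Suc 0) (cderiv 0 L) (pt1 y)) \<and>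
     (\<forall>y\<in>J. l < st y \<and> st y < u \<and> r \<le> st y \<and> st y \<le> s \<longrightarrow> G y = ceval (Suc 0) L (pt1 y))"
    using L unfolding rep1_def by blast
qed

text \<open>The standard parts of points of \<open>J\<close> need not form a compact set, so
  bisection yields only antiderivatives between \<open>u\<close> and one point at a time. Normalised
  to vanish at \<open>u\<close> they no longer depend on the range, and fit together.\<close>

lemma antider_global:
  assumes J: "standard_core J T" and f: "fsmooth1 J f" and u: "u \<in> J"
  shows "\<exists>I. fsmooth1 J I \<and> I u = 0 \<and> (\<forall>x\<in>J. fderiv1 J I x = f x) \<and> (\<forall>x. x \<notin> J \<longrightarrow> I x = 0)"
proof -
  let ?u = "st u"
  let ?lo = "\<lambda>x. min ?u (st x)" and ?hi = "\<lambda>x. max ?u (st x)"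
  have hull: "\<exists>y\<in>J. st y = q" if "x \<in> J" "y \<in> J" "min ?u (st x) \<le> q" "q \<le> max ?u (st y)" for x y q
    using standard_core_st_interval[OF J u u] standard_core_st_interval[OF J u that(2)] standard_core_st_interval[OF J that(1) u]
      standard_core_st_interval[OF J that(1,2)] that(3,4) by (smt (verit))
  define Gx where "Gx x = (SOME G. antider_on J f (?lo x) (?hi x) G)" for x
  have Gx: "antider_on J f (?lo x) (?hi x) (Gx x)" if "x \<in> J" for x
  proof -
    have "\<exists>G. antider_on J f (?lo x) (?hi x) G"
      by (rule antider_exists[OF J f]) (use hull[OF that that] in auto)
    from someI_ex[OF this] show ?thesis unfolding Gx_def .
  qed
  define I where "I x = (if x \<in> J then Gx x x - Gx x u else 0)" for x
  have I: "I x = G x - G u" if G: "antider_on J f p q G" and x: "x \<in> J" "p \<le> ?lo x" "?hi x \<le> q" for x p q G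
  proof -
    have "\<exists>K. \<forall>y\<in>J. ?lo x \<le> st y \<and> st y \<le> ?hi x \<longrightarrow> Gx x y - G y = K"
      by (rule antider_unique[OF J Gx[OF x(1)] G]) (use x hull[OF x(1) x(1)] in auto)
    then obtain K where "\<forall>y\<in>J. ?lo x \<le> st y \<and> st y \<le> ?hi x \<longrightarrow> Gx x y - G y = K" by blast
    then have "Gx x x - G x = K" "Gx x u - G u = K" using x u by auto
    then show ?thesis using x by (simp add: I_def algebra_simps)
  qed
  have rep: "\<exists>l h L. l < st x \<and> st x < h \<and> rep1 J I l h L \<and>
      (\<forall>y\<in>J. l < st y \<and> st y < h \<longrightarrow> ceval (Suc 0) (cderiv 0 L) (pt1 y) = f y)" if x: "x \<in> J" for x
  proof -
    \<comment> \<open>The range must contain the standard parts of all points of \<open>J\<close>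
      near \<open>x\<close>. A point \<open>z\<close> further right provides room; if there is none,
      \<open>st x\<close> is the largest standard part in \<open>J\<close>.\<close>
    have "\<exists>z\<in>J. \<exists>h > st x. \<forall>y\<in>J. st y < h \<longrightarrow> st y \<le> ?hi z"
    proof (cases "\<exists>z\<in>J. st x < st z")
      case True
      then obtain z where "z \<in> J" "st x < st z" by blast
      then show ?thesis by (intro bexI[of _ z] exI[of _ "st z"]) auto
    next
      case False
      then show ?thesis using x by (intro bexI[of _ x] exI[of _ "st x + 1"]) (auto simp: not_less)
    qed
    then obtain z h where z: "z \<in> J" "h > st x" "\<And>y. y \<in> J \<Longrightarrow> st y < h \<Longrightarrow> st y \<le> ?hi z" by blast
    have "\<exists>z\<in>J. \<exists>l < st x. \<forall>y\<in>J. l < st y \<longrightarrow> ?lo z \<le> st y"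
    proof (cases "\<exists>z\<in>J. st z < st x")
      case True
      then obtain z where "z \<in> J" "st z < st x" by blast
      then show ?thesis by (intro bexI[of _ z] exI[of _ "st z"]) auto
    next
      case False
      then show ?thesis using x by (intro bexI[of _ x] exI[of _ "st x - 1"]) (auto simp: not_less)
    qed
    then obtain z' l where z': "z' \<in> J" "l < st x" "\<And>y. y \<in> J \<Longrightarrow> l < st y \<Longrightarrow> ?lo z' \<le> st y" by blast
    have "\<exists>G. antider_on J f (?lo z') (?hi z) G"
      by (rule antider_exists[OF J f]) (use hull[OF z'(1) z(1)] in auto)
    then obtain G where G: "antider_on J f (?lo z') (?hi z) G" by blast
    have bx: "?lo z' \<le> st x" "st x \<le> ?hi z" using z(3)[OF x z(2)] z'(3)[OF x z'(2)] by auto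
    obtain l2 u2 L2 where 2: "l2 < st x" "st x < u2" "csmooth (Suc 0) (interval1 l2 u2) L2"
        "\<forall>y\<in>J. l2 < st y \<and> st y < u2 \<longrightarrow> f y = ceval (Suc 0) (cderiv 0 L2) (pt1 y)"
        "\<forall>y\<in>J. l2 < st y \<and> st y < u2 \<and> ?lo z' \<le> st y \<and> st y \<le> ?hi z \<longrightarrow> G y = ceval (Suc 0) L2 (pt1 y)"
      using antider_onE[OF G x bx] by blast
    let ?l = "max l l2" and ?h = "min h u2" and ?L = "L2 @ [(- G u, \<lambda>_. 1)]"
    have sL: "csmooth (Suc 0) (interval1 ?l ?h) ?L"
      using csmooth_subset[OF 2(3) interval1_mono[of l2 ?l ?h u2] kopen_interval1] const_cell by (simp del: csmooth_Cons)
    have "I y = ceval (Suc 0) ?L (pt1 y)" if y: "y \<in> J" "?l < st y" "st y < ?h" for y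
    proof -
      have b: "?lo z' \<le> st y" "st y \<le> ?hi z" using z(3)[of y] z'(3)[of y] y by auto
      have "I y = G y - G u" using b by (intro I[OF G y(1)]) auto
      also have "G y = ceval (Suc 0) L2 (pt1 y)" using 2(5) b y by auto
      finally show ?thesis by (simp add: ceval_const_cell del: ceval_Cons)
    qed
    then have "rep1 J I ?l ?h ?L" using sL by (simp add: rep1_def del: ceval_append csmooth_append)
    moreover have "\<forall>y\<in>J. ?l < st y \<and> st y < ?h \<longrightarrow> ceval (Suc 0) (cderiv 0 ?L) (pt1 y) = f y"
      using 2(4) by (auto simp: ceval_const_cell simp del: cmap_Cons ceval_Cons)
    ultimately show ?thesis using 2 z(2) z'(2) by (intro exI[of _ ?l] exI[of _ ?h] exI[of _ ?L]) auto
  qed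
  show ?thesis
  proof (intro exI[of _ I] conjI ballI allI impI)
    show "fsmooth1 J I" unfolding fsmooth1_iff using rep by blast
    show "I u = 0" using u by (simp add: I_def)
    show "I x = 0" if "x \<notin> J" for x using that by (simp add: I_def)
    show "fderiv1 J I x = f x" if x: "x \<in> J" for x
    proof -
      obtain l h L where "l < st x" "st x < h" "rep1 J I l h L"
        "\<forall>y\<in>J. l < st y \<and> st y < h \<longrightarrow> ceval (Suc 0) (cderiv 0 L) (pt1 y) = f y" using rep[OF x] by blast
      then show ?thesis using fderiv1_eq[OF J _ x] x by auto
    qed
  qed
qed

text \<open>Two candidates differ by a constant between \<open>u\<close> and any given point of
  \<open>K\<close>, and both vanish at \<open>u\<close>. Off \<open>K\<close> the value is
  prescribed as zero, so the definite description singles out one function.\<close>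

lemma fantider_props:
  assumes K: "noninf_interval K" and f: "fsmooth1 K f" and u: "u \<in> K"
  shows "fsmooth1 K (fantider K f u)" "fantider K f u u = 0" "\<And>x. x \<in> K \<Longrightarrow> fderiv1 K (fantider K f u) x = f x"
proof -
  obtain T where J: "standard_core K T" using noninf_interval_standard_core[OF K] by blast
  let ?P = "\<lambda>I. fsmooth1 K I \<and> I u = fzero \<and> (\<forall>x\<in>K. fderiv1 K I x = f x) \<and> (\<forall>x. x \<notin> K \<longrightarrow> I x = fzero)"
  obtain I where I: "?P I" using antider_global[OF J f u] unfolding fzero_eq by blast
  have "I' = I" if I': "?P I'" for I'
  proof
    fix x
    show "I' x = I x"
    proof (cases "x \<in> K")
      case True
      let ?p = "min (st u) (st x)" and ?q = "max (st u) (st x)"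
      have hull: "\<exists>y\<in>K. st y = t" if "?p \<le> t" "t \<le> ?q" for t
        using standard_core_st_interval[OF J u True] standard_core_st_interval[OF J True u] that by (smt (verit))
      have "\<exists>C. \<forall>y\<in>K. ?p \<le> st y \<and> st y \<le> ?q \<longrightarrow> I' y - I y = C"
        by (rule antider_unique[OF J smooth_antider_on[OF J, of I' f ?p ?q] smooth_antider_on[OF J, of I f ?p ?q]])
          (use I I' hull in auto)
      then obtain C where "\<forall>y\<in>K. ?p \<le> st y \<and> st y \<le> ?q \<longrightarrow> I' y - I y = C" by blast
      then have "I' x - I x = C" "I' u - I u = C" using True u by auto
      then show ?thesis using I I' by simp
    qed (use I I' in auto)
  qed
  then have "fantider K f u = I" unfolding fantider_def by (intro the_equality I)
  then show "fsmooth1 K (fantider K f u)" "fantider K f u u = 0" "\<And>x. x \<in> K \<Longrightarrow> fderiv1 K (fantider K f u) x = f x"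
    using I by (auto simp: fzero_eq)
qed

section \<open>Iterated integrals\<close>

lemma ivl_Fin: "x \<in> ivl (Fin a) (Fin b) lc rc \<longleftrightarrow> (if lc then a \<le> x else a < x) \<and> (if rc then x \<le> b else x < b)"
  by (auto simp: ivl_def xlt_def simp flip: less_eq_fermat_def)

lemma ivl_Fin_le: "x \<in> ivl (Fin a) (Fin b) lc rc \<Longrightarrow> a \<le> x \<and> x \<le> b"
  by (auto simp: ivl_Fin split: if_splits)

lemma ivl_Fin_less: "a < x \<Longrightarrow> x < b \<Longrightarrow> x \<in> ivl (Fin a) (Fin b) lc rc"
  by (auto simp: ivl_Fin)

text \<open>Otherwise density provides a point strictly between the differing endpoints that belongs
  to the first interval but not to the second. The common point \<open>c\<close> places it on the
  correct side of the opposite endpoint.\<close>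

lemma ivl_endpoints_le:
  assumes "ivl (Fin a) (Fin b) lc rc = ivl (Fin a') (Fin b') lc' rc'" "c \<in> ivl (Fin a) (Fin b) lc rc"
  shows "a' \<le> a" "b \<le> b'"
proof -
  have c: "a \<le> c" "c \<le> b" "a' \<le> c" "c \<le> b'" using assms ivl_Fin_le by blast+
  show "a' \<le> a"
  proof (rule ccontr)
    assume "\<not> a' \<le> a"
    then obtain z where z: "a < z" "z < a'" using fermat_dense[of a a'] by (auto simp: not_le)
    then have "z \<in> ivl (Fin a) (Fin b) lc rc" using c by (intro ivl_Fin_less) auto
    then have "a' \<le> z" using assms(1) ivl_Fin_le by blast
    then show False using z by simp
  qed
  show "b \<le> b'"
  proof (rule ccontr)
    assume "\<not> b \<le> b'"
    then obtain z where z: "b' < z" "z < b" using fermat_dense[of b' b] by (auto simp: not_le)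
    then have "z \<in> ivl (Fin a) (Fin b) lc rc" using c by (intro ivl_Fin_less) auto
    then have "z \<le> b'" using assms(1) ivl_Fin_le by blast
    then show False using z by simp
  qed
qed

lemma ivl_endpoints_unique:
  assumes "ivl (Fin a) (Fin b) lc rc = ivl (Fin a') (Fin b') lc' rc'" "ivl (Fin a) (Fin b) lc rc \<noteq> {}"
  shows "a' = a" "b' = b"
proof -
  obtain c where c: "c \<in> ivl (Fin a) (Fin b) lc rc" "c \<in> ivl (Fin a') (Fin b') lc' rc'" using assms by auto
  show "a' = a" "b' = b"
    using ivl_endpoints_le[OF assms(1) c(1)] ivl_endpoints_le[OF assms(1)[symmetric] c(2)] by auto
qed

definition good_ivl :: "fermat set \<Rightarrow> bool" where
  "good_ivl I \<longleftrightarrow> I \<noteq> {} \<and> (\<exists>a b lc rc. a \<le> b \<and> I = ivl (Fin a) (Fin b) lc rc)"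

text \<open>\<open>fint\<close> selects an arbitrary admissible triple, so every triple has to give
  the same value; the second premise accounts for the default value when there is none.\<close>

lemma fint_eqI:
  assumes "\<And>a b K. fint_ok I g a b K \<Longrightarrow> fantider K g a b = v"
    and "(\<nexists>a b K. fint_ok I g a b K) \<Longrightarrow> v = 0"
  shows "fint I g = v"
proof (cases "\<exists>a b K. fint_ok I g a b K")
  case True
  then have "\<exists>v. \<exists>a b K. fint_ok I g a b K \<and> v = fantider K g a b" by blast
  from someI_ex[OF this] have "\<exists>a b K. fint_ok I g a b K \<and> fint I g = fantider K g a b"
    using True by (simp add: fint_def)
  then show ?thesis using assms(1) by blast
qed (simp add: fint_def assms(2) fzero_eq)

text \<open>For an empty interval the endpoints are not determined but must coincide; for an unbounded one there are
  no data at all, and \<^const>\<open>fint\<close> is 0 by convention.\<close>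

lemma fint_degenerate:
  assumes "\<not> good_ivl I"
  shows "fint I g = 0"
proof (rule fint_eqI)
  fix a b K assume ok: "fint_ok I g a b K"
  then obtain lc rc where I: "a \<le> b" "I = ivl (Fin a) (Fin b) lc rc"
    unfolding fint_ok_def less_eq_fermat_def by blast
  then have "I = {}" using assms unfolding good_ivl_def by blast
  have "a = b"
  proof (rule ccontr)
    assume "a \<noteq> b"
    then have "a < b" using I(1) by simp
    then obtain z where "a < z" "z < b" using fermat_dense by blast
    then show False using ivl_Fin_less I \<open>I = {}\<close> by blast
  qed
  then show "fantider K g a b = 0" using ok fantider_props(2) unfolding fint_ok_def by blast
qed simp

text \<open>Carries a vanishing inner integral through the outer ones, whatever their intervals
  are.\<close>

lemma fint_zero: "fint I (\<lambda>_. 0) = 0"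
proof (rule fint_eqI)
  fix a b K assume ok: "fint_ok I (\<lambda>_. 0) a b K"
  then have K: "noninf_interval K" "a \<in> K" "b \<in> K" "fsmooth1 K (\<lambda>_. 0)" "a \<le> b"
    unfolding fint_ok_def less_eq_fermat_def by auto
  obtain T where J: "standard_core K T" using noninf_interval_standard_core[OF K(1)] by blast
  let ?A = "fantider K (\<lambda>_. 0) a"
  note A = fantider_props[OF K(1,4,2)]
  have 1: "antider_on K (\<lambda>_. 0) (st a) (st b) ?A" by (rule smooth_antider_on[OF J A(1,3)])
  have 2: "antider_on K (\<lambda>_. 0) (st a) (st b) (\<lambda>_. 0)"
    unfolding antider_on_def
  proof (intro ballI impI)
    fix x
    show "\<exists>l u L. l < st x \<and> st x < u \<and> csmooth (Suc 0) (interval1 l u) L \<and>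
       (\<forall>y\<in>K. l < st y \<and> st y < u \<longrightarrow> 0 = ceval (Suc 0) (cderiv 0 L) (pt1 y)) \<and>
       (\<forall>y\<in>K. l < st y \<and> st y < u \<and> st a \<le> st y \<and> st y \<le> st b \<longrightarrow>
         0 = ceval (Suc 0) L (pt1 y))"
      by (intro exI[of _ "st x - 1"] exI[of _ "st x + 1"] exI[of _ "[]"]) (auto simp: kopen_interval1)
  qed
  have "\<exists>C. \<forall>y\<in>K. st a \<le> st y \<and> st y \<le> st b \<longrightarrow> ?A y - 0 = C"
    using fst_part_mono[OF K(5)] standard_core_st_interval[OF J K(2,3)]
    by (intro antider_unique[OF J 1 2]) auto
  then have "?A b = ?A a" using K fst_part_mono[OF K(5)] by fastforce
  then show "?A b = 0" using A(2) by simp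
qed simp

text \<open>Whichever \<open>K\<close> is selected, \<open>fantider\<close> and the combination
  \<open>L\<close> are both antiderivatives of \<open>g\<close> at the points of \<open>K\<close>
  between the standard parts of \<open>a\<close> and \<open>b\<close>. They differ by a constant
  there, which cancels in the difference of the endpoint values.\<close>

lemma fint_eq_antider:
  assumes I: "a \<le> b" "I = ivl (Fin a) (Fin b) lc rc" "I \<noteq> {}"
    and L: "csmooth (Suc 0) (interval1 l u) L" "l < st a" "st b < u"
    and g: "\<And>s. l < st s \<Longrightarrow> st s < u \<Longrightarrow> g s = ceval (Suc 0) (cderiv 0 L) (pt1 s)"
  shows "fint I g = ceval (Suc 0) L (pt1 b) - ceval (Suc 0) L (pt1 a)"
proof (rule fint_eqI)
  fix a' b' K assume ok: "fint_ok I g a' b' K"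
  then obtain lc' rc' where "I = ivl (Fin a') (Fin b') lc' rc'" unfolding fint_ok_def by blast
  then have ab: "a' = a" "b' = b" using ivl_endpoints_unique[of a b lc rc a' b' lc' rc'] I by auto
  have K: "noninf_interval K" "a \<in> K" "b \<in> K" "fsmooth1 K g"
    using ok ab unfolding fint_ok_def by auto
  obtain T where J: "standard_core K T" using noninf_interval_standard_core[OF K(1)] by blast
  let ?A = "fantider K g a"
  note A = fantider_props[OF K(1,4,2)]
  have ab': "st a \<le> st b" using I(1) by (rule fst_part_mono)
  have 1: "antider_on K g (st a) (st b) ?A" by (rule smooth_antider_on[OF J A(1,3)])
  have 2: "antider_on K g (st a) (st b) (\<lambda>y. ceval (Suc 0) L (pt1 y))"
    unfolding antider_on_def
    by (intro ballI impI exI[of _ l] exI[of _ u] exI[of _ L]) (use L g in auto)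
  have "\<exists>C. \<forall>y\<in>K. st a \<le> st y \<and> st y \<le> st b \<longrightarrow> ?A y - ceval (Suc 0) L (pt1 y) = C"
    using ab' standard_core_st_interval[OF J K(2,3)] by (intro antider_unique[OF J 1 2]) auto
  then obtain C where "\<forall>y\<in>K. st a \<le> st y \<and> st y \<le> st b \<longrightarrow> ?A y - ceval (Suc 0) L (pt1 y) = C" by blast
  then have "?A b - ceval (Suc 0) L (pt1 b) = C" "?A a - ceval (Suc 0) L (pt1 a) = C" using K ab' by auto
  then show "fantider K g a' b' = ceval (Suc 0) L (pt1 b) - ceval (Suc 0) L (pt1 a)"
    using A(2) ab by (metis add.commute diff_0 diff_add_cancel uminus_add_conv_diff)
next
  obtain p where p: "l < p" "p < st a" using dense[OF L(2)] by blast
  obtain q where q: "st b < q" "q < u" using dense[OF L(3)] by blast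
  \<comment> \<open>Real endpoints strictly outside the standard parts of \<open>a\<close> and
    \<open>b\<close> make \<open>?K\<close> non-infinitesimal even when \<open>a\<close> and
    \<open>b\<close> are infinitely close, and \<open>?K\<close> still lies in the domain of
    \<open>L\<close>.\<close>
  let ?K = "ivl (Fin (fconst p)) (Fin (fconst q)) True True"
  have ab': "st a \<le> st b" using I(1) by (rule fst_part_mono)
  have mem: "x \<in> ?K" if "st a \<le> st x" "st x \<le> st b" for x
  proof -
    have "fconst p < x" "x < fconst q" using p q that by (auto intro!: fst_part_less)
    then show ?thesis by (simp add: ivl_Fin less_imp_le)
  qed
  have st: "l < st x \<and> st x < u" if "x \<in> ?K" for x
  proof -
    have "fconst p \<le> x" "x \<le> fconst q" using that by (auto simp: ivl_Fin)
    from this[THEN fst_part_mono] show ?thesis using p q by simp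
  qed
  have "fint_ok I g a b ?K"
    unfolding fint_ok_def
  proof (intro conjI)
    show "\<exists>lc rc. fle a b \<and> I = ivl (Fin a) (Fin b) lc rc" using I by (auto simp flip: less_eq_fermat_def)
    have "fconst p \<le> fconst q" using p q ab' by (intro less_imp_le fst_part_less) simp
    then show "noninf_interval ?K" unfolding noninf_interval_def
      using p q ab' by (intro exI[of _ "Fin (fconst p)"] exI[of _ "Fin (fconst q)"] exI[of _ True]) (auto simp flip: less_eq_fermat_def)
    show "I \<subseteq> ?K" using I mem ivl_Fin_le fst_part_mono by blast
    show "a \<in> ?K" "b \<in> ?K" using mem ab' by auto
    have "rep1 ?K g l u (cderiv 0 L)" unfolding rep1_def using csmooth_cderiv[OF L(1)] g by auto
    then show "fsmooth1 ?K g" unfolding fsmooth1_iff using st by blast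
  qed
  then show "\<nexists>a b K. fint_ok I g a b K \<Longrightarrow> ceval (Suc 0) L (pt1 b) - ceval (Suc 0) L (pt1 a) = 0" by blast
qed

section \<open>Restriction to lines and substitution of nonstandard values\<close>

lemma fstar_obox_upd:
  assumes "Y \<in> fstar d (obox d l u)" "i < d" "l i < st s" "st s < u i"
  shows "Y(i := s) \<in> fstar d (obox d l u)"
  using assms by (auto simp: fstar_iff fpt_def stv_upd intro!: obox_upd simp del: fun_upd_apply) (simp add: fpt_def)

text \<open>The coordinates of \<open>Y\<close> other than \<open>i\<close> are nonstandard and
  cannot be inserted into real functions. After their elimination only standard parts have to be
  inserted, which leaves a combination in one variable.\<close>

lemma slice:
  assumes L: "csmooth d (obox d l u) L" and Y: "Y \<in> fstar d (obox d l u)" and i: "i < d"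
  shows "\<exists>L1. csmooth (Suc 0) (interval1 (l i) (u i)) L1 \<and> (\<forall>s. l i < st s \<and> st s < u i \<longrightarrow>
     ceval d L (Y(i := s)) = ceval (Suc 0) L1 (pt1 s) \<and> ceval d (cderiv i L) (Y(i := s)) = ceval (Suc 0) (cderiv 0 L1) (pt1 s))"
proof -
  \<comment> \<open>A single coordinate remains free, so the constant map 0 is injective where
    injectivity is required.\<close>
  let ?A = "{..<d} - {i}" and ?\<rho> = "\<lambda>_::nat. 0::nat" and ?r = "\<lambda>i. st (Y i)"
  let ?Q = "obox d l u"
  obtain L' where L': "csmooth d ?Q L'" "\<And>Z. stv d Z \<in> ?Q \<Longrightarrow> (\<forall>j\<in>?A. Z j = Y j) \<Longrightarrow>
     ceval d L Z = ceval d L' (standardize ?A Z) \<and> (\<forall>i<d. ceval d (cderiv i L) Z = ceval d (cderiv i L') (standardize ?A Z))"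
    using eliminate[OF _ _ L, of ?A Y] by auto
  have \<rho>: "inj_on ?\<rho> ({..<d} - ?A)" "?\<rho> ` ({..<d} - ?A) \<subseteq> {..<Suc 0}" using i by (auto simp: inj_on_def)
  have inQ: "substv d ?A ?r ?\<rho> 0 v \<in> ?Q" if "v \<in> interval1 (l i) (u i)" for v
    using that Y i by (auto simp: substv_def interval1_def obox_def fstar_iff kvec_def stv_def)
  let ?L1 = "cmap (\<lambda>c v. c (substv d ?A ?r ?\<rho> 0 v)) L'"
  have "csmooth (Suc 0) (interval1 (l i) (u i)) ?L1" by (rule csmooth_substv[OF L'(1) \<rho> kopen_interval1 inQ])
  moreover have "ceval d L (Y(i := s)) = ceval (Suc 0) ?L1 (pt1 s) \<and> ceval d (cderiv i L) (Y(i := s)) = ceval (Suc 0) (cderiv 0 ?L1) (pt1 s)"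
    if s: "l i < st s" "st s < u i" for s
  proof -
    have sQ: "stv d (Y(i := s)) \<in> ?Q" using fstar_obox_upd[OF Y i s] by (simp add: fstar_iff)
    have eq: "\<And>j. j < d \<Longrightarrow> standardize ?A (Y(i := s)) j = substv d ?A (\<lambda>i. fconst (?r i)) ?\<rho> 0 (pt1 s) j"
      by (auto simp: standardize_def substv_def)
    have eqL: "ceval d L (standardize ?A (Y(i := s))) = ceval d L (substv d ?A (\<lambda>i. fconst (?r i)) ?\<rho> 0 (pt1 s))" for L
      by (rule ceval_arg_cong) (rule eq)
    have v: "vec1 (st s) \<in> interval1 (l i) (u i)" using s by simp
    have m: "substv d ?A ?r ?\<rho> 0 (stv (Suc 0) (pt1 s)) \<in> ?Q" using inQ[OF v] by simp
    have e1: "ceval d L (Y(i := s)) = ceval d L' (substv d ?A (\<lambda>i. fconst (?r i)) ?\<rho> 0 (pt1 s))"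
      using L'(2)[OF sQ] eqL[of L'] by simp
    have e2: "ceval d (cderiv i L) (Y(i := s)) = ceval d (cderiv i L') (substv d ?A (\<lambda>i. fconst (?r i)) ?\<rho> 0 (pt1 s))"
      using L'(2)[OF sQ] eqL[of "cderiv i L'"] i by simp
    show ?thesis
      unfolding e1 e2
      using ceval_substv[OF L'(1) \<rho>(2) m, of 0] ceval_cderiv_substv[where X = "pt1 s" and z = 0, OF L'(1) \<rho> kopen_interval1 inQ i] v by simp
  qed
  ultimately show ?thesis by blast
qed

text \<open>The substitution of a nonstandard \<open>b\<close> for the coordinate \<open>j\<close>:
  Taylor expansion accounts for the nilpotent part, the standard part is inserted into the real
  functions. The result is formally still a combination in all \<open>d\<close> variables, as the
  iteration requires.\<close>

definition csubst :: "nat \<Rightarrow> nat \<Rightarrow> fermat \<Rightarrow> comb \<Rightarrow> comb" where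
  "csubst d j b L = cmap (\<lambda>c v. c (substv d {j} (\<lambda>_. st b) (\<lambda>i. i) 0 v)) (ctaylor j b L)"

lemma
  assumes L: "csmooth d (obox d l u) L" and j: "j < d" and b: "l j < st b" "st b < u j"
  shows csmooth_csubst: "csmooth d (obox d l u) (csubst d j b L)"
    and ceval_csubst: "X \<in> fstar d (obox d l u) \<Longrightarrow> ceval d (csubst d j b L) X = ceval d L (X(j := b))"
    and ceval_cderiv_csubst: "X \<in> fstar d (obox d l u) \<Longrightarrow> i < d \<Longrightarrow> i \<noteq> j \<Longrightarrow>
      ceval d (cderiv i (csubst d j b L)) X = ceval d (cderiv i L) (X(j := b))"
proof -
  let ?Q = "obox d l u"
  let ?r = "\<lambda>_::nat. st b"
  have T: "csmooth d ?Q (ctaylor j b L)" by (rule csmooth_ctaylor[OF L j])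
  have \<rho>: "inj_on (\<lambda>i. i) ({..<d} - {j})" "(\<lambda>i. i) ` ({..<d} - {j}) \<subseteq> {..<d}" by auto
  have inQ: "substv d {j} ?r (\<lambda>i. i) 0 v \<in> ?Q" if "v \<in> ?Q" for v
    using that b by (auto simp: substv_def obox_def kvec_def)
  show "csmooth d ?Q (csubst d j b L)" unfolding csubst_def by (rule csmooth_substv[OF T \<rho> kopen_obox inQ])
  assume X: "X \<in> fstar d ?Q"
  have XQ: "stv d X \<in> ?Q" using X by (simp add: fstar_iff)
  have XbQ: "stv d (X(j := b)) \<in> ?Q" using fstar_obox_upd[OF X j b] by (simp add: fstar_iff)
  have XbQ': "stv d (X(j := fconst (st b))) \<in> ?Q" using fstar_obox_upd[OF X j, of "fconst (st b)"] b by (simp add: fstar_iff)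
  have eq: "\<And>i. i < d \<Longrightarrow> substv d {j} (\<lambda>i. fconst (?r i)) (\<lambda>i. i) 0 X i = ((X(j := b))(j := fconst (st b))) i"
    by (auto simp: substv_def)
  have eqL: "ceval d L (substv d {j} (\<lambda>i. fconst (?r i)) (\<lambda>i. i) 0 X) = ceval d L ((X(j := b))(j := fconst (st b)))" for L
    by (rule ceval_arg_cong) (rule eq)
  show "ceval d (csubst d j b L) X = ceval d L (X(j := b))"
    unfolding csubst_def
    using ceval_substv[OF T \<rho>(2) inQ[OF XQ], of 0] eqL[of "ctaylor j b L"] ceval_ctaylor[OF L j XbQ, of b] by simp
  assume i: "i < d" "i \<noteq> j"
  have "ceval d (cderiv i (csubst d j b L)) X = ceval d (cderiv i (ctaylor j b L)) (substv d {j} (\<lambda>i. fconst (?r i)) (\<lambda>i. i) 0 X)"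
    unfolding csubst_def using ceval_cderiv_substv[where X = X and z = 0, OF T \<rho> kopen_obox inQ i(1)] i XQ by simp
  also have "\<dots> = ceval d (cderiv i (ctaylor j b L)) ((X(j := b))(j := fconst (st b)))" by (rule eqL)
  also have "\<dots> = ceval d (ctaylor j b (cderiv i L)) ((X(j := b))(j := fconst (st b)))"
    using ceval_cderiv_ctaylor[OF L i(1) j, of "(X(j := b))(j := fconst (st b))" b] XbQ' by simp
  also have "\<dots> = ceval d (cderiv i L) (X(j := b))" using ceval_ctaylor[OF csmooth_cderiv[OF L i(1)] j XbQ] by simp
  finally show "ceval d (cderiv i (csubst d j b L)) X = ceval d (cderiv i L) (X(j := b))" .
qed

lemma ceval_cderiv_primitive:
  assumes "csmooth d (obox d l u) L" "j < d" "l j < r" "r < u j" "X \<in> fstar d (obox d l u)"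
  shows "ceval d (cderiv j (cmap (primitive j r) L)) X = ceval d L X"
  using assms(1)
proof (induction L)
  case (Cons p L)
  then have c: "cinf d (obox d l u) (snd p)" by simp
  have "fext d (snd p) X = fext d (pderiv_k j (primitive j r (snd p))) X"
    using assms by (intro fext_cong[OF c]) (auto simp: fstar_iff pderiv_primitive_same[OF c])
  then show ?case using Cons by simp
qed simp

lemma csmooth_primitive:
  "csmooth d (obox d l u) L \<Longrightarrow> j < d \<Longrightarrow> l j < r \<Longrightarrow> r < u j \<Longrightarrow> csmooth d (obox d l u) (cmap (primitive j r) L)"
  by (rule csmooth_cmap) (auto intro: kopen_obox cinf_primitive)

lemma ceval_cderiv_commute:
  assumes "csmooth k W L" "i < k" "j < k" "stv k X \<in> W"
  shows "ceval k (cderiv i (cderiv j L)) X = ceval k (cderiv j (cderiv i L)) X"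
  using assms(1)
proof (induction L)
  case (Cons p L)
  then have c: "cinf k W (snd p)" by simp
  have "fext k (pderiv_k i (pderiv_k j (snd p))) X = fext k (pderiv_k j (pderiv_k i (snd p))) X"
    by (intro fext_cong[OF cinf_pderiv[OF cinf_pderiv[OF c assms(3)] assms(2)]] pderiv_commute[OF c assms(2,3)] assms(4))
  then show ?case using Cons by simp
qed simp

text \<open>\<open>l\<close> and \<open>u\<close> bound an open box strictly around the standard
  parts of the endpoints, so primitives and endpoint substitutions never leave the domain of the
  functions involved.\<close>

locale integration_box =
  fixes d :: nat and I :: "nat \<Rightarrow> fermat set" and a b :: "nat \<Rightarrow> fermat" and lc rc :: "nat \<Rightarrow> bool" and l u :: "nat \<Rightarrow> real"
  assumes ab: "\<And>i. i < d \<Longrightarrow> a i \<le> b i"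
    and I: "\<And>i. i < d \<Longrightarrow> I i = ivl (Fin (a i)) (Fin (b i)) (lc i) (rc i)"
    and I_ne: "\<And>i. i < d \<Longrightarrow> I i \<noteq> {}"
    and la: "\<And>i. i < d \<Longrightarrow> l i < st (a i)"
    and bu: "\<And>i. i < d \<Longrightarrow> st (b i) < u i"
begin

abbreviation "Q \<equiv> obox d l u"
abbreviation "FQ \<equiv> fstar d (obox d l u)"

definition int_op :: "nat \<Rightarrow> ((nat \<Rightarrow> fermat) \<Rightarrow> fermat) \<Rightarrow> (nat \<Rightarrow> fermat) \<Rightarrow> fermat" where
  "int_op j h x = fint (I j) (\<lambda>s. h (x(j := s)))"

text \<open>One combination for the whole box, in contrast to the local representations of
  \<open>fsmooth\<close>; this is the class of functions preserved by integration.\<close>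

definition smooth_on :: "((nat \<Rightarrow> fermat) \<Rightarrow> fermat) \<Rightarrow> bool" where
  "smooth_on h \<longleftrightarrow> (\<exists>L. csmooth d Q L \<and> (\<forall>x\<in>FQ. h x = ceval d L x))"

lemma ends: 
  assumes "i < d"
  shows "l i < st (a i)" "st (a i) < u i" "l i < st (b i)" "st (b i) < u i"
  using la[OF assms] bu[OF assms] fst_part_mono[OF ab[OF assms]] by auto

lemma int_op_eq:
  assumes L: "csmooth d Q L" and h: "\<And>x. x \<in> FQ \<Longrightarrow> h x = ceval d (cderiv i L) x" and i: "i < d" and x: "x \<in> FQ"
  shows "int_op i h x = ceval d L (x(i := b i)) - ceval d L (x(i := a i))"
proof -
  obtain L1 where L1: "csmooth (Suc 0) (interval1 (l i) (u i)) L1" "\<And>s. l i < st s \<Longrightarrow> st s < u i \<Longrightarrow>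
     ceval d L (x(i := s)) = ceval (Suc 0) L1 (pt1 s) \<and> ceval d (cderiv i L) (x(i := s)) = ceval (Suc 0) (cderiv 0 L1) (pt1 s)"
    using slice[OF L x i] by blast
  have "int_op i h x = ceval (Suc 0) L1 (pt1 (b i)) - ceval (Suc 0) L1 (pt1 (a i))"
    unfolding int_op_def
    using L1 h fstar_obox_upd[OF x i] by (intro fint_eq_antider[OF ab I I_ne L1(1) la bu] i) auto
  then show ?thesis using L1(2)[of "a i"] L1(2)[of "b i"] ends[OF i] by simp
qed

text \<open>Represents the integral in the coordinate \<open>j\<close> of the
  \<open>j\<close>-derivative of \<open>L\<close>, as a combination to which further integrations
  apply.\<close>

definition cdiff :: "nat \<Rightarrow> comb \<Rightarrow> comb" where
  "cdiff j L = csubst d j (b j) L @ cscale (-1) (csubst d j (a j) L)"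

lemma csmooth_cdiff: "csmooth d Q L \<Longrightarrow> j < d \<Longrightarrow> csmooth d Q (cdiff j L)"
  unfolding cdiff_def using ends[of j] by (simp add: csmooth_csubst)

lemma ceval_cdiff: "csmooth d Q L \<Longrightarrow> j < d \<Longrightarrow> x \<in> FQ \<Longrightarrow> ceval d (cdiff j L) x = ceval d L (x(j := b j)) - ceval d L (x(j := a j))"
  unfolding cdiff_def using ends[of j] by (simp add: ceval_csubst[of d l u])

lemma ceval_cderiv_cdiff: "csmooth d Q L \<Longrightarrow> j < d \<Longrightarrow> x \<in> FQ \<Longrightarrow> i < d \<Longrightarrow> i \<noteq> j \<Longrightarrow>
    ceval d (cderiv i (cdiff j L)) x = ceval d (cderiv i L) (x(j := b j)) - ceval d (cderiv i L) (x(j := a j))"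
  unfolding cdiff_def using ends[of j] by (simp add: ceval_cderiv_csubst[of d l u])

lemma smooth_onE:
  assumes "smooth_on h" "j < d"
  obtains L where "csmooth d Q L" "\<And>x. x \<in> FQ \<Longrightarrow> h x = ceval d (cderiv j L) x"
proof -
  from assms obtain L where L: "csmooth d Q L" "\<forall>x\<in>FQ. h x = ceval d L x" unfolding smooth_on_def by blast
  show thesis
    using ends[OF assms(2)] L assms(2)
    by (intro that[of "cmap (primitive j (st (a j))) L"] csmooth_primitive) (auto simp: ceval_cderiv_primitive)
qed

lemma smooth_on_int_op:
  assumes "smooth_on h" "j < d"
  shows "smooth_on (int_op j h)"
proof -
  obtain L where L: "csmooth d Q L" "\<And>x. x \<in> FQ \<Longrightarrow> h x = ceval d (cderiv j L) x" using smooth_onE[OF assms] by blast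
  show ?thesis unfolding smooth_on_def
    using int_op_eq[OF L assms(2)] ceval_cdiff[OF L(1) assms(2)] csmooth_cdiff[OF L(1) assms(2)] by metis
qed

text \<open>Equalities between inner integrals are available on \<open>FQ\<close> only. For base
  points in \<open>FQ\<close> this suffices, since there both integrands have the same
  antiderivative \<open>L\<close> in the coordinate \<open>j\<close>.\<close>

lemma int_op_cong:
  assumes "smooth_on h" "j < d" "\<And>x. x \<in> FQ \<Longrightarrow> h x = h' x" "x \<in> FQ"
  shows "int_op j h x = int_op j h' x"
proof -
  obtain L where L: "csmooth d Q L" "\<And>x. x \<in> FQ \<Longrightarrow> h x = ceval d (cderiv j L) x" using smooth_onE[OF assms(1,2)] by blast
  then show ?thesis using int_op_eq[OF L assms(2,4)] int_op_eq[of L h' j x] assms by simp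
qed

lemma int_op_int_op:
  assumes M: "csmooth d Q M" and h: "\<And>x. x \<in> FQ \<Longrightarrow> h x = ceval d (cderiv j (cderiv i M)) x"
    and ij: "i < d" "j < d" "i \<noteq> j" and x: "x \<in> FQ"
  shows "int_op i (int_op j h) x = (ceval d M (x(i := b i, j := b j)) - ceval d M (x(i := b i, j := a j))) -
      (ceval d M (x(i := a i, j := b j)) - ceval d M (x(i := a i, j := a j)))"
proof -
  have "int_op j h y = ceval d (cderiv i (cdiff j M)) y" if "y \<in> FQ" for y
    using int_op_eq[OF csmooth_cderiv[OF M ij(1)] h ij(2) that] ceval_cderiv_cdiff[OF M ij(2) that ij(1,3)] by simp
  from int_op_eq[OF csmooth_cdiff[OF M ij(2)] this ij(1) x]
  show ?thesis using ceval_cdiff[OF M ij(2) fstar_obox_upd[OF x ij(1)]] ends[OF ij(1)] by simp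
qed

lemma int_op_commute:
  assumes h: "smooth_on h" and ij: "i < d" "j < d" and x: "x \<in> FQ"
  shows "int_op i (int_op j h) x = int_op j (int_op i h) x"
proof (cases "i = j")
  case False
  obtain L where L: "csmooth d Q L" "\<And>x. x \<in> FQ \<Longrightarrow> h x = ceval d (cderiv j L) x" using smooth_onE[OF h ij(2)] by blast
  \<comment> \<open>\<open>L\<close> is a primitive of \<open>h\<close> in the coordinate
    \<open>j\<close> and \<open>M\<close> one of \<open>L\<close> in the coordinate
    \<open>i\<close>, so the mixed derivative of \<open>M\<close> recovers \<open>h\<close>.\<close>
  define M where "M = cmap (primitive i (st (a i))) L"
  have M: "csmooth d Q M" unfolding M_def using ends[OF ij(1)] by (intro csmooth_primitive L(1) ij)
  have dM: "ceval d (cderiv j (cderiv i M)) y = ceval d (cderiv j L) y" if y: "y \<in> FQ" for y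
    unfolding M_def using L(1)
  proof (induction L)
    case (Cons p L)
    then have c: "cinf d Q (snd p)" by simp
    have "fext d (pderiv_k j (snd p)) y = fext d (pderiv_k j (pderiv_k i (primitive i (st (a i)) (snd p)))) y"
    proof (rule fext_cong[OF cinf_pderiv[OF c ij(2)]])
      fix v assume v: "v \<in> Q"
      show "pderiv_k j (snd p) v = pderiv_k j (pderiv_k i (primitive i (st (a i)) (snd p))) v"
        using ends[OF ij(1)] by (intro pderiv_k_cong[OF kopen_obox v ij(2)]) (simp add: pderiv_primitive_same[OF c ij(1)])
    qed (use y in \<open>simp add: fstar_iff\<close>)
    then show ?case using Cons by simp
  qed simp
  have h1: "h y = ceval d (cderiv j (cderiv i M)) y" if "y \<in> FQ" for y using L(2) dM that by simp
  have h2: "h y = ceval d (cderiv i (cderiv j M)) y" if y: "y \<in> FQ" for y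
    using h1[OF y] ceval_cderiv_commute[OF M ij] y by (simp add: fstar_iff)
  have "int_op i (int_op j h) x = (ceval d M (x(i := b i, j := b j)) - ceval d M (x(i := b i, j := a j))) -
      (ceval d M (x(i := a i, j := b j)) - ceval d M (x(i := a i, j := a j)))"
    by (rule int_op_int_op[OF M h1 ij False x])
  also have "\<dots> = (ceval d M (x(j := b j, i := b i)) - ceval d M (x(j := b j, i := a i))) -
      (ceval d M (x(j := a j, i := b i)) - ceval d M (x(j := a j, i := a i)))"
    unfolding fun_upd_twist[OF False, of x] by (simp add: algebra_simps)
  also have "\<dots> = int_op j (int_op i h) x"
    by (rule int_op_int_op[OF M h2 ij(2,1) False[symmetric] x, symmetric])
  finally show ?thesis .
qed simp

lemma iter_int_Cons: "iter_int I (j # js) f = int_op j (iter_int I js f)"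
  by (rule ext) (simp add: int_op_def)

lemma smooth_on_iter_int: "smooth_on f \<Longrightarrow> set js \<subseteq> {..<d} \<Longrightarrow> smooth_on (iter_int I js f)"
proof (induction js)
  case Nil
  have "iter_int I [] f = f" by (rule ext) simp
  then show ?case using Nil by simp
next
  case (Cons j js)
  then show ?case unfolding iter_int_Cons by (intro smooth_on_int_op) auto
qed

lemma iter_int_move_front:
  assumes "smooth_on f" "set (as @ j # bs) \<subseteq> {..<d}" "x \<in> FQ"
  shows "iter_int I (as @ j # bs) f x = iter_int I (j # as @ bs) f x"
  using assms(2,3)
proof (induction as arbitrary: x)
  case (Cons k as)
  have kj: "k < d" "j < d" using Cons.prems by auto
  have s: "smooth_on (iter_int I (as @ bs) f)" "smooth_on (iter_int I (as @ j # bs) f)"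
    using assms(1) Cons.prems by (auto intro!: smooth_on_iter_int)
  have "iter_int I ((k # as) @ j # bs) f x = int_op k (iter_int I (as @ j # bs) f) x"
    by (simp only: append_Cons iter_int_Cons)
  also have "\<dots> = int_op k (iter_int I (j # as @ bs) f) x"
    using Cons s kj by (intro int_op_cong) auto
  also have "\<dots> = int_op j (int_op k (iter_int I (as @ bs) f)) x"
    unfolding iter_int_Cons by (rule int_op_commute[OF s(1) kj Cons.prems(2)])
  finally show ?case by (simp only: append_Cons iter_int_Cons)
qed simp

lemma iter_int_perm:
  assumes "smooth_on f" "mset js = mset js'" "set js \<subseteq> {..<d}" "x \<in> FQ"
  shows "iter_int I js f x = iter_int I js' f x"
  using assms(2-4)
proof (induction js arbitrary: js' x)
  case (Cons j js)
  have "j \<in> set js'" using Cons.prems(1) by (metis list.set_intros(1) set_mset_mset)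
  then obtain as bs where js': "js' = as @ j # bs" by (meson split_list)
  have m: "mset js = mset (as @ bs)" using Cons.prems(1) js' by simp
  have sub: "set (as @ j # bs) \<subseteq> {..<d}"
    using Cons.prems(1,2) js' by (metis set_mset_mset)
  have "iter_int I (j # js) f x = int_op j (iter_int I js f) x" by (simp only: iter_int_Cons)
  also have "\<dots> = int_op j (iter_int I (as @ bs) f) x"
    using Cons m by (intro int_op_cong smooth_on_iter_int assms(1)) auto
  also have "\<dots> = iter_int I js' f x"
    using iter_int_move_front[OF assms(1) sub Cons.prems(3)] unfolding js' by (simp only: iter_int_Cons)
  finally show ?case .
qed simp

end

text \<open>Every integration variable is overwritten, so the base point matters only in the
  remaining coordinates. This permits a change to a base point inside the box.\<close>

lemma iter_int_agree:
  assumes "\<And>i. i \<notin> set js \<Longrightarrow> x i = x' i"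
  shows "iter_int I js f x = iter_int I js f x'"
  using assms
proof (induction js arbitrary: x x')
  case Nil
  then have "x = x'" by (intro ext) simp
  then show ?case by simp
next
  case (Cons j js)
  have "iter_int I js f (x(j := s)) = iter_int I js f (x'(j := s))" for s
    by (rule Cons.IH) (use Cons.prems in auto)
  then show ?case by simp
qed

lemma iter_int_degenerate:
  assumes "j \<in> set js" "\<not> good_ivl (I j)"
  shows "iter_int I js f x = 0"
  using assms(1)
proof (induction js arbitrary: x)
  case (Cons k js)
  show ?case
  proof (cases "k = j")
    case True
    then show ?thesis using fint_degenerate[OF assms(2)] by simp
  next
    case False
    then have "iter_int I js f y = 0" for y using Cons by simp
    then show ?thesis by (simp add: fint_zero)
  qed
qed simp

text \<open>Proved by bisection in one coordinate after the other: the first \<open>m\<close> coordinates already range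
  over their whole intervals, the others are still near the point \<open>v\<close>.\<close>

lemma box_compactness:
  fixes r s :: "nat \<Rightarrow> real" and Good :: "(nat \<Rightarrow> real) set \<Rightarrow> bool"
  assumes mono: "\<And>A B. Good A \<Longrightarrow> B \<subseteq> A \<Longrightarrow> Good B"
    and un: "\<And>A B. Good A \<Longrightarrow> Good B \<Longrightarrow> Good (A \<union> B)"
    and rs: "\<And>i. i < d \<Longrightarrow> r i \<le> s i"
    and loc: "\<And>v. kvec d v \<Longrightarrow> (\<And>i. i < d \<Longrightarrow> r i \<le> v i \<and> v i \<le> s i) \<Longrightarrow>
      \<exists>e>0. Good {w. kvec d w \<and> (\<forall>i<d. \<bar>w i - v i\<bar> < e)}"
  shows "\<exists>e>0. Good (obox d (\<lambda>i. r i - e) (\<lambda>i. s i + e))"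
proof -
  let ?K = "{v. kvec d v \<and> (\<forall>i<d. r i \<le> v i \<and> v i \<le> s i)}"
  define nb where "nb m e v = {w. kvec d w \<and> (\<forall>i<m. r i - e < w i \<and> w i < s i + e) \<and>
     (\<forall>i. m \<le> i \<and> i < d \<longrightarrow> \<bar>w i - v i\<bar> < e)}" for m e v
  have "\<forall>v\<in>?K. \<exists>e>0. Good (nb m e v)" if "m \<le> d" for m
    using that
  proof (induction m)
    case 0
    show ?case
    proof
      fix v assume "v \<in> ?K"
      then show "\<exists>e>0. Good (nb 0 e v)" using loc[of v] by (simp add: nb_def)
    qed
  next
    case (Suc m)
    show ?case
    proof
      fix v assume v: "v \<in> ?K"
      define S where "S p q e = {w. kvec d w \<and> (\<forall>i<m. r i - e < w i \<and> w i < s i + e) \<and> p - e < w m \<and> w m < q + e \<and>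
         (\<forall>i. Suc m \<le> i \<and> i < d \<longrightarrow> \<bar>w i - v i\<bar> < e)}" for p q e
      have m: "m < d" using Suc by simp
      have "\<exists>e>0. Good (S (r m) (s m) e)"
      proof (rule Bolzano[where P = "\<lambda>p q. \<exists>e>0. Good (S p q e)", OF rs[OF m]])
        fix p q t assume "\<exists>e>0. Good (S p q e)" "\<exists>e>0. Good (S q t e)" "p \<le> q" "q \<le> t"
        then obtain e1 e2 where e: "e1 > 0" "Good (S p q e1)" "e2 > 0" "Good (S q t e2)" by blast
        \<comment> \<open>Points whose coordinate \<open>m\<close> is at most \<open>q\<close> fall
          into the left slab, all others into the right one.\<close>
        have "S p t (min e1 e2) \<subseteq> S p q e1 \<union> S q t e2"
        proof
          fix w assume w: "w \<in> S p t (min e1 e2)"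
          show "w \<in> S p q e1 \<union> S q t e2"
          proof (cases "w m \<le> q")
            case True
            then have "w \<in> S p q e1" using w e unfolding S_def by force
            then show ?thesis by simp
          next
            case False
            then have "w \<in> S q t e2" using w e unfolding S_def by force
            then show ?thesis by simp
          qed
        qed
        then have "Good (S p t (min e1 e2))" using mono[OF un[OF e(2,4)]] by blast
        then show "\<exists>e>0. Good (S p t e)" using e by (intro exI[of _ "min e1 e2"]) auto
      next
        fix x assume x: "r m \<le> x" "x \<le> s m"
        have "v(m := x) \<in> ?K" using v x m by (auto simp: kvec_def)
        then obtain e where e: "e > 0" "Good (nb m e (v(m := x)))" using Suc by auto
        show "\<exists>\<delta>>0. \<forall>p q. p \<le> x \<and> x \<le> q \<and> q - p < \<delta> \<longrightarrow> (\<exists>e>0. Good (S p q e))"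
        \<comment> \<open>An interval of length below \<open>e/2\<close> containing
          \<open>x\<close>, enlarged by \<open>e/2\<close> at both ends, stays within distance
          \<open>e\<close> of \<open>x\<close>.\<close>
        proof (rule exI[of _ "e/2"], intro conjI allI impI)
          fix p q assume pq: "p \<le> x \<and> x \<le> q \<and> q - p < e / 2"
          have "S p q (e/2) \<subseteq> nb m e (v(m := x))"
          proof
            fix w assume w: "w \<in> S p q (e/2)"
            have "\<bar>w i - (v(m := x)) i\<bar> < e" if "m \<le> i" "i < d" for i
            proof (cases "i = m")
              case True
              then show ?thesis using w pq unfolding S_def by (auto simp: abs_less_iff)
            next
              case False
              then have "\<bar>w i - v i\<bar> < e / 2" using w that unfolding S_def by auto
              then show ?thesis using False e(1) by simp
            qed
            moreover have "\<forall>i<m. r i - e < w i \<and> w i < s i + e" using w e(1) unfolding S_def by force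
            ultimately show "w \<in> nb m e (v(m := x))" using w unfolding S_def nb_def by blast
          qed
          then show "\<exists>e>0. Good (S p q e)" using mono[OF e(2)] e(1) by (intro exI[of _ "e/2"]) auto
        qed (use e in auto)
      qed
      moreover have "nb (Suc m) e v = S (r m) (s m) e" for e
        unfolding nb_def S_def by (auto simp: less_Suc_eq)
      ultimately show "\<exists>e>0. Good (nb (Suc m) e v)" by simp
    qed
  qed
  \<comment> \<open>For \<open>m = d\<close> the set \<open>nb\<close> no longer depends on its
    centre, so one point of \<open>?K\<close> suffices.\<close>
  moreover have "(\<lambda>i. if i < d then r i else 0) \<in> ?K" using rs by (auto simp: kvec_def)
  ultimately obtain e where e: "e > 0" "Good (nb d e (\<lambda>i. if i < d then r i else 0))" by blast
  have "obox d (\<lambda>i. r i - e) (\<lambda>i. s i + e) = nb d e (\<lambda>i. if i < d then r i else 0)"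
    unfolding nb_def obox_def by auto
  then show ?thesis using e by auto
qed

section \<open>A single combination near a closed box\<close>

definition std_point :: "nat \<Rightarrow> (nat \<Rightarrow> real) \<Rightarrow> nat \<Rightarrow> fermat" where
  "std_point d v = (\<lambda>i. if i < d then fconst (v i) else fzero)"

lemma std_point_in_fstar: "kvec d v \<Longrightarrow> std_point d v \<in> fstar d W \<longleftrightarrow> v \<in> W"
proof -
  assume "kvec d v"
  then have "stv d (std_point d v) = v" by (auto simp: stv_def std_point_def kvec_def)
  then show ?thesis by (simp add: fstar_iff fpt_def std_point_def)
qed

text \<open>The coefficient functions \<open>F a\<close> are read off from \<open>f\<close> at
  standard points, hence are defined on all of \<open>V\<close> at once, and no partition or
  patching of representations is required. What could fail globally is finiteness: different points
  might need different exponents without bound.\<close>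

lemma global_rep:
  assumes V: "kopen d V" and f: "fsmooth d (fstar d V) f"
    and rs: "\<And>i. i < d \<Longrightarrow> r i \<le> s i"
    and K: "\<And>v. kvec d v \<Longrightarrow> (\<And>i. i < d \<Longrightarrow> r i \<le> v i \<and> v i \<le> s i) \<Longrightarrow> v \<in> V"
  shows "\<exists>e>0. \<exists>L. csmooth d (obox d (\<lambda>i. r i - e) (\<lambda>i. s i + e)) L \<and>
    (\<forall>x\<in>fstar d (obox d (\<lambda>i. r i - e) (\<lambda>i. s i + e)). f x = ceval d L x)"
proof -
  define F where "F a v = coef (f (std_point d v)) a" for a v
  have local: "\<exists>W L. v \<in> W \<and> W \<subseteq> V \<and> csmooth d W L \<and> (\<forall>x\<in>fstar d W. f x = ceval d L x) \<and> (\<forall>a. \<forall>w\<in>W. F a w = ccoef a L w)"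
    if v: "v \<in> V" for v
  proof -
    have kv: "kvec d v" using kopen_kvec[OF V v] .
    have "std_point d v \<in> fstar d V" using v kv by (simp add: std_point_in_fstar)
    then obtain W L where W: "std_point d v \<in> fstar d W" "csmooth d W L" "\<forall>x\<in>fstar d W \<inter> fstar d V. f x = ceval d L x"
      using f unfolding fsmooth_iff by blast
    have op: "kopen d (W \<inter> V)" using csmooth_kopen[OF W(2)] V by (rule kopen_Int)
    have smW: "csmooth d (W \<inter> V) L" using csmooth_subset[OF W(2) _ op] by simp
    have fW: "f x = ceval d L x" if "x \<in> fstar d (W \<inter> V)" for x using that W(3) by (simp add: fstar_iff)
    have "F a w = ccoef a L w" if w: "w \<in> W \<inter> V" for a w
    proof -
      have "std_point d w \<in> fstar d (W \<inter> V)" using w kopen_kvec[OF op w] by (simp add: std_point_in_fstar)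
      then show ?thesis unfolding F_def using fW coef_ceval[OF smW w, of "std_point d w" a] by (simp add: std_point_def)
    qed
    moreover have "v \<in> W" using W(1) kv by (simp add: std_point_in_fstar)
    ultimately show ?thesis using v smW fW by (intro exI[of _ "W \<inter> V"] exI[of _ L]) auto
  qed
  have F: "cinf d V (F a)" for a
  proof (rule cinf_local[OF V])
    fix v assume "v \<in> V"
    from local[OF this] obtain W L where W: "v \<in> W" "csmooth d W L" "\<forall>a. \<forall>w\<in>W. F a w = ccoef a L w"
      by (elim exE conjE)
    have "cinf d W (F a)" using cinf_ccoef[OF W(2), of a] cinf_cong[of W "F a" "ccoef a L" d] W(3) by simp
    then show "\<exists>W. v \<in> W \<and> cinf d W (F a)" using W(1) by blast
  qed
  \<comment> \<open>Being represented by one combination does not evidently pass to unions; using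
    only finitely many exponents does.\<close>
  define Good where "Good A \<longleftrightarrow> A \<subseteq> V \<and> (\<exists>E. finite E \<and> (\<forall>w\<in>A. \<forall>a. a \<notin> E \<longrightarrow> F a w = 0))" for A
  have "\<exists>e>0. Good (obox d (\<lambda>i. r i - e) (\<lambda>i. s i + e))"
  proof (rule box_compactness[OF _ _ rs])
    show "Good B" if "Good A" "B \<subseteq> A" for A B using that unfolding Good_def by blast
    show "Good (A \<union> B)" if "Good A" "Good B" for A B
    proof -
      from that obtain E E' where "finite E" "\<forall>w\<in>A. \<forall>a. a \<notin> E \<longrightarrow> F a w = 0"
        "finite E'" "\<forall>w\<in>B. \<forall>a. a \<notin> E' \<longrightarrow> F a w = 0" unfolding Good_def by blast
      then show ?thesis using that unfolding Good_def by (intro conjI exI[of _ "E \<union> E'"]) auto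
    qed
    fix v assume v: "kvec d v" "\<And>i. i < d \<Longrightarrow> r i \<le> v i \<and> v i \<le> s i"
    then have "v \<in> V" using K by blast
    from local[OF this] obtain W L where W: "v \<in> W" "W \<subseteq> V" "csmooth d W L" "\<forall>a. \<forall>w\<in>W. F a w = ccoef a L w"
      by (elim exE conjE)
    from csmooth_kopen[OF W(3)] W(1) obtain e where e: "e > 0" "\<forall>w. kvec d w \<longrightarrow> (\<forall>i<d. \<bar>w i - v i\<bar> < e) \<longrightarrow> w \<in> W"
      by (rule kopenE)
    have "Good {w. kvec d w \<and> (\<forall>i<d. \<bar>w i - v i\<bar> < e)}"
      unfolding Good_def using e(2) W(2,4) by (intro conjI exI[of _ "csupport L"]) (auto simp: ccoef_not_supp)
    then show "\<exists>e>0. Good {w. kvec d w \<and> (\<forall>i<d. \<bar>w i - v i\<bar> < e)}" using e(1) by blast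
  qed
  then obtain e where e: "e > 0" "Good (obox d (\<lambda>i. r i - e) (\<lambda>i. s i + e))" by blast
  let ?Q = "obox d (\<lambda>i. r i - e) (\<lambda>i. s i + e)"
  from e(2) obtain E where QV: "?Q \<subseteq> V" and E: "finite E" "\<And>w a. w \<in> ?Q \<Longrightarrow> a \<notin> E \<Longrightarrow> F a w = 0" unfolding Good_def by blast
  obtain es where es: "set es = E" "distinct es" using finite_distinct_list[OF E(1)] by blast
  let ?L = "map (\<lambda>a. (fmonom a, F a)) es"
  have FQ: "cinf d ?Q (F a)" for a using F QV kopen_obox by (rule cinf_subset)
  have "csmooth d ?Q ?L" using FQ by (auto simp: csmooth_def kopen_obox)
  moreover have "f x = ceval d ?L x" if x: "x \<in> fstar d ?Q" for x
  proof -
    have xQ: "stv d x \<in> ?Q" using x by (simp add: fstar_iff)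
    then have xV: "stv d x \<in> V" using QV by blast
    obtain W L where W: "stv d x \<in> W" "W \<subseteq> V" "csmooth d W L" "\<forall>x\<in>fstar d W. f x = ceval d L x" "\<forall>a. \<forall>w\<in>W. F a w = ccoef a L w"
      using local[OF xV] by (elim exE conjE)
    have "f x = ceval d L x" using x W(1,4) by (simp add: fstar_iff)
    \<comment> \<open>A local combination may involve exponents outside \<open>E\<close>; their
      coefficient functions \<open>F a\<close> vanish on \<open>?Q\<close>, so these terms drop out
      below.\<close>
    also have "\<dots> = (\<Sum>a\<in>E \<union> csupport L. fmonom a * fext d (ccoef a L) x)"
      by (rule ceval_ccoef[OF W(3,1)]) (use E in auto)
    also have "\<dots> = (\<Sum>a\<in>E \<union> csupport L. fmonom a * fext d (F a) x)"
    proof (rule sum.cong[OF refl])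
      fix a
      have "fext d (ccoef a L) x = fext d (F a) x"
        using W(1,5) by (intro fext_cong[OF cinf_ccoef[OF W(3)]]) auto
      then show "fmonom a * fext d (ccoef a L) x = fmonom a * fext d (F a) x" by simp
    qed
    also have "\<dots> = (\<Sum>a\<in>E. fmonom a * fext d (F a) x)"
    proof (rule sum.mono_neutral_right)
      show "\<forall>a\<in>(E \<union> csupport L) - E. fmonom a * fext d (F a) x = 0"
      proof
        fix a assume "a \<in> (E \<union> csupport L) - E"
        then have "fext d (F a) x = fext d (\<lambda>_. 0) x"
          using E(2) xQ by (intro fext_cong[OF FQ]) auto
        then show "fmonom a * fext d (F a) x = 0" by (simp add: fext_const)
      qed
    qed (use E in auto)
    also have "\<dots> = ceval d ?L x"
      using es by (simp add: ceval_def o_def sum_list_distinct_conv_sum_set)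
    finally show ?thesis .
  qed
  ultimately show ?thesis using e(1) by blast
qed

text \<open>An endpoint may be excluded from \<open>I\<close>, but a shift by the infinitesimal
  \<open>fmonom 1\<close> keeps its standard part. If the endpoints are infinitely close, any point
  of \<open>I\<close> serves.\<close>

lemma ivl_standard_part:
  assumes I: "I = ivl (Fin a) (Fin b) lc rc" "I \<noteq> {}" and p: "st a \<le> p" "p \<le> st b"
  shows "\<exists>x\<in>I. st x = p"
proof -
  have less: "\<exists>x\<in>I. st x = p" if "a < x" "x < b" "st x = p" for x
    using that ivl_Fin_less I(1) by blast
  consider "st a < p" "p < st b" | "st a = p" "p < st b" | "st a < p" "p = st b"
    | "st a = p" "p = st b" using p by linarith
  then show ?thesis
  proof cases
    case 1
    then show ?thesis by (intro less[of "fconst p"] fst_part_less) auto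
  next
    case 2
    then show ?thesis using fmonom_1_pos
      by (intro less[of "a + fmonom 1"] fst_part_less[of "a + fmonom 1" b]) (auto simp: fst_part_add fst_part_fmonom_1)
  next
    case 3
    then show ?thesis using fmonom_1_pos
      by (intro less[of "b - fmonom 1"] fst_part_less[of a "b - fmonom 1"]) (auto simp: fst_part_diff fst_part_fmonom_1)
  next
    case 4
    obtain z where z: "z \<in> I" using I(2) by blast
    then have "a \<le> z" "z \<le> b" using I(1) ivl_Fin_le by blast+
    then show ?thesis using z 4 fst_part_mono[of a z] fst_part_mono[of z b] by (intro bexI[of _ z]) auto
  qed
qed

theorem theorem36:
  fixes d :: nat and I :: "nat \<Rightarrow> fermat set" and U :: "(nat \<Rightarrow> fermat) set"
    and f :: "(nat \<Rightarrow> fermat) \<Rightarrow> fermat" and \<sigma> :: "nat \<Rightarrow> nat"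
  assumes "\<forall>i<d. finterval (I i)"
    and "fopen d U"
    and "fbox d I \<subseteq> U"
    and "fsmooth d U f"
    and "\<sigma> permutes {..<d}"
  shows "iter_int I [0..<d] f (\<lambda>i. fzero) = iter_int I (map \<sigma> [0..<d]) f (\<lambda>i. fzero)"
proof -
  have inj: "inj \<sigma>" and img: "\<sigma> ` {..<d} = {..<d}"
    using assms(5) by (auto simp: permutes_inj permutes_image)
  have sets: "set [0..<d] = {..<d}" "set (map \<sigma> [0..<d]) = {..<d}"
    using img by (auto simp: atLeast0LessThan)
  show ?thesis
  proof (cases "\<forall>i<d. good_ivl (I i)")
    case False
    then obtain j where "j < d" "\<not> good_ivl (I j)" by blast
    then show ?thesis using sets by (simp add: iter_int_degenerate[of j])
  next
    case True
    then have "\<forall>i. \<exists>a b lc rc. i < d \<longrightarrow> a \<le> b \<and> I i = ivl (Fin a) (Fin b) lc rc \<and> I i \<noteq> {}"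
      unfolding good_ivl_def by blast
    then obtain a b lc rc where ab: "\<And>i. i < d \<Longrightarrow> a i \<le> b i"
      and I: "\<And>i. i < d \<Longrightarrow> I i = ivl (Fin (a i)) (Fin (b i)) (lc i) (rc i)" "\<And>i. i < d \<Longrightarrow> I i \<noteq> {}"
      by metis
    obtain V where V: "kopen d V" "U = fstar d V" using assms(2) unfolding fopen_def by blast
    \<comment> \<open>Each real point of the closed box of standard parts lifts to a point of the
      Fermat box, and membership in \<open>U\<close> depends on standard parts only.\<close>
    have K: "v \<in> V" if v: "kvec d v" "\<And>i. i < d \<Longrightarrow> st (a i) \<le> v i \<and> v i \<le> st (b i)" for v
    proof -
      have "\<exists>x. x \<in> I i \<and> st x = v i" if i: "i < d" for i
        using ivl_standard_part[OF I(1)[OF i] I(2)[OF i], of "v i"] v(2)[OF i] by auto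
      then obtain x where x: "\<And>i. i < d \<Longrightarrow> x i \<in> I i \<and> st (x i) = v i" by metis
      let ?x = "\<lambda>i. if i < d then x i else fzero"
      have "?x \<in> fbox d I" using x by (simp add: fbox_def fpt_def)
      then have "stv d ?x \<in> V" using assms(3) V(2) by (auto simp: fstar_iff)
      moreover have "stv d ?x = v" using x v(1) by (auto simp: stv_def kvec_def)
      ultimately show ?thesis by simp
    qed
    have "fsmooth d (fstar d V) f" using assms(4) V by simp
    from global_rep[where r = "\<lambda>i. st (a i)" and s = "\<lambda>i. st (b i)", OF V(1) this fst_part_mono[OF ab] K] obtain e L where e: "e > 0"
      and L: "csmooth d (obox d (\<lambda>i. st (a i) - e) (\<lambda>i. st (b i) + e)) L"
      "\<forall>x\<in>fstar d (obox d (\<lambda>i. st (a i) - e) (\<lambda>i. st (b i) + e)). f x = ceval d L x"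
      by blast
    interpret integration_box d I a b lc rc "\<lambda>i. st (a i) - e" "\<lambda>i. st (b i) + e"
      using ab I e by unfold_locales auto
    have f: "smooth_on f" unfolding smooth_on_def using L by blast
    \<comment> \<open>The origin, from which both iterated integrals start, may lie outside the box;
      the corner \<open>a\<close> replaces it because all \<open>d\<close> coordinates are
      integrated.\<close>
    define x where "x i = (if i < d then a i else fzero)" for i
    have x: "x \<in> FQ"
      using e fst_part_mono[OF ab] by (fastforce simp: fstar_iff fpt_def x_def obox_def stv_def kvec_def)
    have agree: "iter_int I js f (\<lambda>i. fzero) = iter_int I js f x" if "set js = {..<d}" for js
      by (rule iter_int_agree) (use that in \<open>auto simp: x_def\<close>)
    have "mset (map \<sigma> [0..<d]) = mset [0..<d]"
      using sets inj by (intro set_eq_iff_mset_eq_distinct[THEN iffD1]) (auto simp: distinct_map inj_on_def inj_def)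
    then have "iter_int I [0..<d] f x = iter_int I (map \<sigma> [0..<d]) f x"
      using sets x by (intro iter_int_perm[OF f]) auto
    then show ?thesis using agree[OF sets(1)] agree[OF sets(2)] by simp
  qed
qed

end
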